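(* Let $A$ be a $C^*$-algebra that has a countable approximate identity. Suppose that every minimal primal ideal of $A$ is modular and that $\mathrm{Prim}(A)$ is quasi-completely regular. Then $A$ has a nonzero center.
   Context: "Ideal" means closed two-sided ideal. An ideal $I$ of $A$ is modular if $A/I$ has a unit. An ideal $I$ of $A$ is primal if whenever $n\ge 2$ and $I_1,\dots,I_n$ are ideals of $A$ with $I_1 I_2\cdots I_n=\{0\}$, then $I_k\subseteq I$ for some $k$. A minimal primal ideal is a primal ideal that is minimal with respect to inclusion among the primal ideals of $A$. $\mathrm{Prim}(A)$ is the primitive ideal space of $A$ with the Jacobson (hull-kernel) topology. A topological space $X$ is quasi-completely regular if for every non-empty open subset $U$ of $X$ there is a real-valued continuous function on $X$ that is not identically zero and is identically $0$ on $X\setminus U$. *)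

theory Defs
  imports "HOL-Analysis.Analysis"
begin

section \<open>C*-algebras\<close>

text \<open>
  Complex C*-algebras, not assumed unital. The class \<open>real_normed_algebra\<close> supplies
  the ring structure and the submultiplicative norm; it has no unit.
\<close>

class cstar_algebra = real_normed_algebra + banach +
  fixes scaleC :: "complex \<Rightarrow> 'a \<Rightarrow> 'a"  (infixr "*\<^sub>C" 75)
    and star :: "'a \<Rightarrow> 'a"
  assumes scaleC_of_real: "complex_of_real r *\<^sub>C x = r *\<^sub>R x"
    and scaleC_add_right: "c *\<^sub>C (x + y) = c *\<^sub>C x + c *\<^sub>C y"
    and scaleC_add_left: "(c + d) *\<^sub>C x = c *\<^sub>C x + d *\<^sub>C x"
    and scaleC_scaleC: "c *\<^sub>C d *\<^sub>C x = (c * d) *\<^sub>C x"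
    and mult_scaleC_left: "(c *\<^sub>C x) * y = c *\<^sub>C (x * y)"
    and mult_scaleC_right: "x * (c *\<^sub>C y) = c *\<^sub>C (x * y)"
    and norm_scaleC: "norm (c *\<^sub>C x) = cmod c * norm x"
    and star_star: "star (star x) = x"
    and star_add: "star (x + y) = star x + star y"
    and star_scaleC: "star (c *\<^sub>C x) = cnj c *\<^sub>C star x"
    and star_mult: "star (x * y) = star y * star x"
    and cstar_identity: "norm (star x * x) = (norm x)\<^sup>2"

definition center :: "'a::cstar_algebra set" where
  "center = {z. \<forall>a. z * a = a * z}"

text \<open>
  No bound on the norms is required (for a sequence, boundedness is automatic by the
  uniform boundedness principle), and neither positivity nor monotonicity.
\<close>

definition approximate_identity_seq :: "(nat \<Rightarrow> 'a::cstar_algebra) \<Rightarrow> bool" where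
  "approximate_identity_seq u \<longleftrightarrow>
     (\<forall>a. (\<lambda>n. u n * a) \<longlonglongrightarrow> a) \<and> (\<forall>a. (\<lambda>n. a * u n) \<longlonglongrightarrow> a)"


section \<open>Closed two-sided ideals\<close>

definition closed_ideal :: "'a::cstar_algebra set \<Rightarrow> bool" where
  "closed_ideal I \<longleftrightarrow>
     0 \<in> I \<and> (\<forall>x\<in>I. \<forall>y\<in>I. x + y \<in> I) \<and> (\<forall>c. \<forall>x\<in>I. c *\<^sub>C x \<in> I) \<and>
     (\<forall>a. \<forall>x\<in>I. a * x \<in> I \<and> x * a \<in> I) \<and> closed I"

text \<open>The coset of \<open>e\<close> is a unit of the quotient algebra by \<open>I\<close>.\<close>

definition modular_ideal :: "'a::cstar_algebra set \<Rightarrow> bool" where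
  "modular_ideal I \<longleftrightarrow> closed_ideal I \<and> (\<exists>e. \<forall>a. e * a - a \<in> I \<and> a * e - a \<in> I)"

text \<open>
  The real span suffices: if \<open>I\<close> is a complex subspace, the set of products is already
  closed under multiplication by complex scalars.
\<close>

definition ideal_mult :: "'a::cstar_algebra set \<Rightarrow> 'a set \<Rightarrow> 'a set" where
  "ideal_mult I J = closure (span {x * y | x y. x \<in> I \<and> y \<in> J})"

text \<open>The value on the empty list is a dummy; only lists of length at least 2 are used.\<close>

fun ideal_prod_list :: "'a::cstar_algebra set list \<Rightarrow> 'a set" where
  "ideal_prod_list [] = UNIV"
| "ideal_prod_list [I] = I"
| "ideal_prod_list (I # J # Js) = ideal_mult I (ideal_prod_list (J # Js))"

definition primal_ideal :: "'a::cstar_algebra set \<Rightarrow> bool" where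
  "primal_ideal I \<longleftrightarrow> closed_ideal I \<and>
     (\<forall>Js. length Js \<ge> 2 \<and> (\<forall>J\<in>set Js. closed_ideal J) \<and> ideal_prod_list Js = {0} \<longrightarrow>
        (\<exists>J\<in>set Js. J \<subseteq> I))"

definition minimal_primal_ideal :: "'a::cstar_algebra set \<Rightarrow> bool" where
  "minimal_primal_ideal I \<longleftrightarrow>
     primal_ideal I \<and> (\<forall>J. primal_ideal J \<and> J \<subseteq> I \<longrightarrow> J = I)"


section \<open>Hilbert spaces and irreducible representations\<close>

text \<open>
  Hilbert spaces are given by a carrier set and operations on it, so that one can quantify
  existentially over them. The inner product is linear in the first argument.
\<close>

locale complex_inner_product_space =
  fixes H :: "'h set"
    and vadd :: "'h \<Rightarrow> 'h \<Rightarrow> 'h"  (infixl "\<oplus>" 65)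
    and vzero :: 'h  ("\<zero>")
    and vscale :: "complex \<Rightarrow> 'h \<Rightarrow> 'h"  (infixr "\<odot>" 75)
    and ip :: "'h \<Rightarrow> 'h \<Rightarrow> complex"
  assumes zero_closed: "\<zero> \<in> H"
    and add_closed: "\<lbrakk>x \<in> H; y \<in> H\<rbrakk> \<Longrightarrow> x \<oplus> y \<in> H"
    and scale_closed: "x \<in> H \<Longrightarrow> c \<odot> x \<in> H"
    and add_assoc: "\<lbrakk>x \<in> H; y \<in> H; z \<in> H\<rbrakk> \<Longrightarrow> (x \<oplus> y) \<oplus> z = x \<oplus> (y \<oplus> z)"
    and add_commute: "\<lbrakk>x \<in> H; y \<in> H\<rbrakk> \<Longrightarrow> x \<oplus> y = y \<oplus> x"
    and add_zero: "x \<in> H \<Longrightarrow> x \<oplus> \<zero> = x"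
    and add_inverse: "x \<in> H \<Longrightarrow> x \<oplus> (-1) \<odot> x = \<zero>"
    and scale_add_right: "\<lbrakk>x \<in> H; y \<in> H\<rbrakk> \<Longrightarrow> c \<odot> (x \<oplus> y) = c \<odot> x \<oplus> c \<odot> y"
    and scale_add_left: "x \<in> H \<Longrightarrow> (c + d) \<odot> x = c \<odot> x \<oplus> d \<odot> x"
    and scale_scale: "x \<in> H \<Longrightarrow> c \<odot> d \<odot> x = (c * d) \<odot> x"
    and scale_one: "x \<in> H \<Longrightarrow> 1 \<odot> x = x"
    and ip_add_left: "\<lbrakk>x \<in> H; y \<in> H; z \<in> H\<rbrakk> \<Longrightarrow> ip (x \<oplus> y) z = ip x z + ip y z"
    and ip_scale_left: "\<lbrakk>x \<in> H; y \<in> H\<rbrakk> \<Longrightarrow> ip (c \<odot> x) y = c * ip x y"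
    and ip_commute: "\<lbrakk>x \<in> H; y \<in> H\<rbrakk> \<Longrightarrow> ip x y = cnj (ip y x)"
    and ip_pos: "\<lbrakk>x \<in> H; x \<noteq> \<zero>\<rbrakk> \<Longrightarrow> Re (ip x x) > 0"
begin

definition hnorm :: "'h \<Rightarrow> real" where
  "hnorm x = sqrt (Re (ip x x))"

definition hdist :: "'h \<Rightarrow> 'h \<Rightarrow> real" where
  "hdist x y = hnorm (x \<oplus> (-1) \<odot> y)"

definition hcauchy :: "(nat \<Rightarrow> 'h) \<Rightarrow> bool" where
  "hcauchy X \<longleftrightarrow> (\<forall>e>0. \<exists>N. \<forall>m\<ge>N. \<forall>n\<ge>N. hdist (X m) (X n) < e)"

definition closed_subspace :: "'h set \<Rightarrow> bool" where
  "closed_subspace K \<longleftrightarrow>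
     K \<subseteq> H \<and> \<zero> \<in> K \<and> (\<forall>x\<in>K. \<forall>y\<in>K. x \<oplus> y \<in> K) \<and> (\<forall>c. \<forall>x\<in>K. c \<odot> x \<in> K) \<and>
     (\<forall>X l. (\<forall>n. X n \<in> K) \<and> l \<in> H \<and> (\<lambda>n. hdist (X n) l) \<longlonglongrightarrow> 0 \<longrightarrow> l \<in> K)"

end

locale complex_hilbert_space = complex_inner_product_space +
  assumes complete:
    "\<lbrakk>\<And>n. X n \<in> H; hcauchy X\<rbrakk> \<Longrightarrow> \<exists>l\<in>H. (\<lambda>n. hdist (X n) l) \<longlonglongrightarrow> 0"

locale star_representation = complex_hilbert_space H vadd vzero vscale ip
  for H :: "'h set"
    and vadd :: "'h \<Rightarrow> 'h \<Rightarrow> 'h"  (infixl "\<oplus>" 65)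
    and vzero :: 'h  ("\<zero>")
    and vscale :: "complex \<Rightarrow> 'h \<Rightarrow> 'h"  (infixr "\<odot>" 75)
    and ip :: "'h \<Rightarrow> 'h \<Rightarrow> complex" +
  fixes \<pi> :: "'a::cstar_algebra \<Rightarrow> 'h \<Rightarrow> 'h"
  assumes op_closed: "x \<in> H \<Longrightarrow> \<pi> a x \<in> H"
    and op_add: "\<lbrakk>x \<in> H; y \<in> H\<rbrakk> \<Longrightarrow> \<pi> a (x \<oplus> y) = \<pi> a x \<oplus> \<pi> a y"
    and op_scale: "x \<in> H \<Longrightarrow> \<pi> a (c \<odot> x) = c \<odot> \<pi> a x"
    and op_bounded: "\<exists>B. \<forall>x\<in>H. hnorm (\<pi> a x) \<le> B * hnorm x"
    and rep_add: "x \<in> H \<Longrightarrow> \<pi> (a + b) x = \<pi> a x \<oplus> \<pi> b x"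
    and rep_scale: "x \<in> H \<Longrightarrow> \<pi> (c *\<^sub>C a) x = c \<odot> \<pi> a x"
    and rep_mult: "x \<in> H \<Longrightarrow> \<pi> (a * b) x = \<pi> a (\<pi> b x)"
    and rep_star: "\<lbrakk>x \<in> H; y \<in> H\<rbrakk> \<Longrightarrow> ip (\<pi> (star a) x) y = ip x (\<pi> a y)"
begin

definition rep_kernel :: "'a set" where
  "rep_kernel = {a. \<forall>x\<in>H. \<pi> a x = \<zero>}"

end

locale irreducible_representation = star_representation +
  assumes rep_nonzero: "\<exists>a. \<exists>x\<in>H. \<pi> a x \<noteq> \<zero>"
    and irreducible:
      "\<lbrakk>closed_subspace K; \<And>a x. x \<in> K \<Longrightarrow> \<pi> a x \<in> K\<rbrakk> \<Longrightarrow> K = {\<zero>} \<or> K = H"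


section \<open>The primitive ideal space\<close>

text \<open>
  HOL cannot quantify existentially over types, so the Hilbert spaces in the following
  definition have elements of the fixed type \<open>'a \<Rightarrow> complex\<close>. Nothing is lost: lemma
  \<open>primitive_ideal_rep_kernel\<close> below shows that the kernel of an irreducible
  representation on a Hilbert space over any type is primitive in this sense.
\<close>

definition primitive_ideal :: "'a::cstar_algebra set \<Rightarrow> bool" where
  "primitive_ideal P \<longleftrightarrow>
     (\<exists>(H :: ('a \<Rightarrow> complex) set) vadd vzero vscale ip \<pi>.
        irreducible_representation H vadd vzero vscale ip \<pi> \<and>
        P = star_representation.rep_kernel H vzero \<pi>)"

definition Prim :: "'a::cstar_algebra set set" where
  "Prim = {P. primitive_ideal P}"

definition ideal_kernel :: "'a::cstar_algebra set set \<Rightarrow> 'a set" where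
  "ideal_kernel F = \<Inter>F"

definition ideal_hull :: "'a::cstar_algebra set \<Rightarrow> 'a set set" where
  "ideal_hull I = {P \<in> Prim. I \<subseteq> P}"

text \<open>
  The hull-kernel topology: a set of primitive ideals is closed iff it equals the hull of
  its kernel. See \<open>openin_prim_space\<close> below.
\<close>

definition prim_space :: "'a::cstar_algebra set topology" where
  "prim_space =
     topology (\<lambda>U. U \<subseteq> Prim \<and> ideal_hull (ideal_kernel (Prim - U)) = Prim - U)"

definition quasi_completely_regular_space :: "'x topology \<Rightarrow> bool" where
  "quasi_completely_regular_space X \<longleftrightarrow>
     (\<forall>U. openin X U \<and> U \<noteq> {} \<longrightarrow>
        (\<exists>f. continuous_map X euclideanreal f \<and> (\<exists>x\<in>topspace X. f x \<noteq> 0) \<and>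
             (\<forall>x\<in>topspace X - U. f x = 0)))"


section \<open>Independence of the representation type\<close>

context complex_inner_product_space
begin

lemma neg_closed: "x \<in> H \<Longrightarrow> (-1) \<odot> x \<in> H"
  by (rule scale_closed)

lemma zero_scale: "x \<in> H \<Longrightarrow> 0 \<odot> x = \<zero>"
  using scale_add_left[of x 1 "-1"] add_inverse[of x] scale_one[of x] by simp

lemma diff_eq_zero: "\<lbrakk>x \<in> H; y \<in> H; x \<oplus> (-1) \<odot> y = \<zero>\<rbrakk> \<Longrightarrow> x = y"
  by (metis add_assoc add_commute add_inverse add_zero neg_closed zero_closed)

lemma ip_add_right: "\<lbrakk>x \<in> H; y \<in> H; z \<in> H\<rbrakk> \<Longrightarrow> ip z (x \<oplus> y) = ip z x + ip z y"
  by (metis add_closed complex_cnj_add ip_add_left ip_commute)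

lemma ip_scale_right: "\<lbrakk>x \<in> H; y \<in> H\<rbrakk> \<Longrightarrow> ip x (c \<odot> y) = cnj c * ip x y"
  by (metis complex_cnj_mult ip_commute ip_scale_left scale_closed)

lemma ip_zero_left: "y \<in> H \<Longrightarrow> ip \<zero> y = 0"
  by (metis ip_scale_left mult_zero_left zero_closed zero_scale)

lemma ip_self_nonneg: "x \<in> H \<Longrightarrow> Re (ip x x) \<ge> 0"
  by (metis ip_pos ip_zero_left less_eq_real_def zero_complex.sel(1))

lemma ip_self_real: "x \<in> H \<Longrightarrow> ip x x = complex_of_real (Re (ip x x))"
  using ip_commute[of x x] by (simp add: complex_eq_iff)

lemma hnorm_nonneg: "x \<in> H \<Longrightarrow> hnorm x \<ge> 0"
  by (simp add: hnorm_def ip_self_nonneg)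

lemma hnorm_zero_iff: "x \<in> H \<Longrightarrow> hnorm x = 0 \<longleftrightarrow> x = \<zero>"
  unfolding hnorm_def
  by (metis ip_pos ip_zero_left order_less_irrefl real_sqrt_eq_zero_cancel_iff
      zero_complex.sel(1))

lemma hnorm_neg: "x \<in> H \<Longrightarrow> hnorm ((-1) \<odot> x) = hnorm x"
  by (simp add: hnorm_def ip_scale_left ip_scale_right scale_closed)

lemma cauchy_schwarz:
  assumes x: "x \<in> H" and y: "y \<in> H"
  shows "cmod (ip x y) \<le> hnorm x * hnorm y"
proof (cases "y = \<zero>")
  case True
  then have "ip x y = 0"
    using ip_commute[OF x y] ip_zero_left[OF x] by simp
  then show ?thesis
    using hnorm_nonneg x y by simp
next
  case False
  define q where "q = Re (ip y y)"
  define c where "c = - ip x y / complex_of_real q"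
  have q: "q > 0"
    using False y ip_pos q_def by blast
  have yy: "ip y y = complex_of_real q"
    using ip_self_real[OF y] q_def by simp
  have yx: "ip y x = cnj (ip x y)"
    using ip_commute[OF y x] .
  have cy: "c \<odot> y \<in> H"
    using scale_closed y by blast
  have "ip (x \<oplus> c \<odot> y) (x \<oplus> c \<odot> y)
      = ip x x + c * cnj (ip x y) + (cnj c * ip x y + c * (cnj c * complex_of_real q))"
    using x y cy
    by (simp add: ip_add_left ip_add_right add_closed ip_scale_left ip_scale_right yy yx
        algebra_simps)
  also have "\<dots> = ip x x - ip x y * cnj (ip x y) / complex_of_real q"
    using q by (simp add: c_def field_simps)
  finally have "Re (ip x x - ip x y * cnj (ip x y) / complex_of_real q) \<ge> 0"
    using ip_self_nonneg[OF add_closed[OF x cy]] by simp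
  then have "Re (ip x x) - (cmod (ip x y))\<^sup>2 / q \<ge> 0"
    by (simp add: complex_norm_square[symmetric] flip: of_real_power of_real_divide)
  then have "(cmod (ip x y))\<^sup>2 \<le> Re (ip x x) * q"
    using q by (simp add: field_simps)
  then have "cmod (ip x y) \<le> sqrt (Re (ip x x) * q)"
    by (rule real_le_rsqrt)
  then show ?thesis
    by (simp add: hnorm_def q_def real_sqrt_mult)
qed

end

context star_representation
begin

lemma op_zero: "\<pi> a \<zero> = \<zero>"
  by (metis op_closed op_scale zero_closed zero_scale)

lemma hdist_op_tendsto:
  assumes "\<And>n. X n \<in> H" "l \<in> H" "(\<lambda>n. hdist (X n) l) \<longlonglongrightarrow> 0"
  shows "(\<lambda>n. hdist (\<pi> a (X n)) (\<pi> a l)) \<longlonglongrightarrow> 0"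
proof -
  obtain B where B: "\<forall>x\<in>H. hnorm (\<pi> a x) \<le> B * hnorm x"
    using op_bounded by blast
  have eq: "hdist (\<pi> a (X n)) (\<pi> a l) = hnorm (\<pi> a (X n \<oplus> (-1) \<odot> l))" for n
    by (simp add: hdist_def assms op_add op_scale neg_closed)
  have mem: "X n \<oplus> (-1) \<odot> l \<in> H" for n
    by (simp add: add_closed assms neg_closed)
  have "(\<lambda>n. B * hdist (X n) l) \<longlonglongrightarrow> 0"
    using tendsto_mult_left[OF assms(3), of B] by simp
  then show ?thesis
  proof (rule tendsto_sandwich[OF _ _ tendsto_const, rotated 2])
    show "\<forall>\<^sub>F n in sequentially. 0 \<le> hdist (\<pi> a (X n)) (\<pi> a l)"
      by (simp add: eq hnorm_nonneg mem op_closed)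
    show "\<forall>\<^sub>F n in sequentially. hdist (\<pi> a (X n)) (\<pi> a l) \<le> B * hdist (X n) l"
      using B mem by (simp add: eq hdist_def[of "X _" l])
  qed
qed

lemma hdist_zero_tendsto_const:
  assumes "l \<in> H" "(\<lambda>n. hdist \<zero> l) \<longlonglongrightarrow> 0"
  shows "l = \<zero>"
proof -
  have "hdist \<zero> l = 0"
    using assms(2) by (simp add: tendsto_const_iff)
  then have "\<zero> \<oplus> (-1) \<odot> l = \<zero>"
    using assms(1) by (simp add: hdist_def hnorm_zero_iff add_closed neg_closed zero_closed)
  then show ?thesis
    using diff_eq_zero[OF zero_closed assms(1)] by simp
qed

lemma closed_subspace_annihilated:
  "closed_subspace {x \<in> H. \<forall>t\<in>T. \<pi> t x = \<zero>}"
  unfolding closed_subspace_def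
proof (intro conjI allI impI ballI; (elim conjE)?)
  fix X l
  assume X: "\<forall>n. X n \<in> {x \<in> H. \<forall>t\<in>T. \<pi> t x = \<zero>}" and l: "l \<in> H"
    and lim: "(\<lambda>n. hdist (X n) l) \<longlonglongrightarrow> 0"
  have "\<pi> t l = \<zero>" if "t \<in> T" for t
  proof (rule hdist_zero_tendsto_const)
    show "\<pi> t l \<in> H"
      using l by (rule op_closed)
    show "(\<lambda>n. hdist \<zero> (\<pi> t l)) \<longlonglongrightarrow> 0"
      using hdist_op_tendsto[of X l t] X l lim that by simp
  qed
  then show "l \<in> {x \<in> H. \<forall>t\<in>T. \<pi> t x = \<zero>}"
    using l by simp
qed (auto simp: zero_closed add_closed scale_closed op_zero op_add op_scale add_zero
    intro: scale_closed, metis mult_zero_right scale_scale zero_closed zero_scale)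

lemma closed_subspace_orthogonal:
  assumes S: "S \<subseteq> H"
  shows "closed_subspace {x \<in> H. \<forall>y\<in>S. ip x y = 0}"
  unfolding closed_subspace_def
proof (intro conjI allI impI ballI; (elim conjE)?)
  fix X l
  assume X: "\<forall>n. X n \<in> {x \<in> H. \<forall>y\<in>S. ip x y = 0}" and l: "l \<in> H"
    and lim: "(\<lambda>n. hdist (X n) l) \<longlonglongrightarrow> 0"
  have "ip l y = 0" if y: "y \<in> S" for y
  proof -
    have yH: "y \<in> H"
      using S y by blast
    have bound: "cmod (ip l y) \<le> hdist (X n) l * hnorm y" for n
    proof -
      have Xn: "X n \<in> H" "ip (X n) y = 0"
        using X y by auto
      have "ip (X n \<oplus> (-1) \<odot> l) y = - ip l y"
        using Xn l yH by (simp add: ip_add_left ip_scale_left neg_closed)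
      then show ?thesis
        using cauchy_schwarz[of "X n \<oplus> (-1) \<odot> l" y] Xn l yH
        by (simp add: hdist_def add_closed neg_closed)
    qed
    have "(\<lambda>n. hdist (X n) l * hnorm y) \<longlonglongrightarrow> 0"
      using tendsto_mult_right[OF lim, of "hnorm y"] by simp
    then have "cmod (ip l y) \<le> 0"
      using bound by (intro LIMSEQ_le_const) auto
    then show ?thesis
      by simp
  qed
  then show "l \<in> {x \<in> H. \<forall>y\<in>S. ip x y = 0}"
    using l by simp
qed (use S in \<open>auto simp: zero_closed add_closed scale_closed ip_zero_left ip_add_left
    ip_scale_left subset_iff\<close>)

end

context irreducible_representation
begin

lemma transport:
  assumes inj: "inj_on \<Phi> H"
  defines "\<Psi> \<equiv> inv_into H \<Phi>"
  shows "irreducible_representation (\<Phi> ` H) (\<lambda>x y. \<Phi> (\<Psi> x \<oplus> \<Psi> y)) (\<Phi> \<zero>)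
    (\<lambda>c x. \<Phi> (c \<odot> \<Psi> x)) (\<lambda>x y. ip (\<Psi> x) (\<Psi> y)) (\<lambda>a x. \<Phi> (\<pi> a (\<Psi> x)))"
    (is "irreducible_representation ?H ?add ?zero ?scale ?ip ?rep")
proof -
  have inv: "\<Psi> (\<Phi> x) = x" if "x \<in> H" for x
    using that inj by (simp add: \<Psi>_def)
  have comm: "\<Phi> (x \<oplus> y) = \<Phi> (y \<oplus> x)" if "x \<in> H" "y \<in> H" for x y
    using that by (simp add: add_commute)
  interpret T: complex_inner_product_space ?H ?add ?zero ?scale ?ip
    by unfold_locales
      (auto simp: inv zero_closed add_closed scale_closed add_assoc add_zero add_inverse
        scale_add_right scale_add_left scale_scale scale_one ip_add_left ip_scale_left
        intro: ip_commute ip_pos comm)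
  have norm: "T.hnorm (\<Phi> x) = hnorm x" if "x \<in> H" for x
    using that by (simp add: T.hnorm_def hnorm_def inv)
  have dist: "T.hdist (\<Phi> x) (\<Phi> y) = hdist x y" if "x \<in> H" "y \<in> H" for x y
    using that by (simp add: T.hdist_def hdist_def inv norm add_closed neg_closed)
  interpret T: complex_hilbert_space ?H ?add ?zero ?scale ?ip
  proof
    fix X
    assume X: "\<And>n. X n \<in> ?H" and C: "T.hcauchy X"
    define Y where "Y = (\<lambda>n. \<Psi> (X n))"
    have Y: "Y n \<in> H" "X n = \<Phi> (Y n)" for n
      using X[of n] by (auto simp: Y_def inv)
    have "hcauchy Y"
      using C by (simp add: T.hcauchy_def hcauchy_def Y dist)
    then obtain l where "l \<in> H" "(\<lambda>n. hdist (Y n) l) \<longlonglongrightarrow> 0"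
      using complete[of Y] Y by blast
    then show "\<exists>l\<in>?H. (\<lambda>n. T.hdist (X n) l) \<longlonglongrightarrow> 0"
      by (auto simp: Y dist)
  qed
  interpret T: star_representation ?H ?add ?zero ?scale ?ip ?rep
  proof
    fix a
    obtain B where "\<forall>x\<in>H. hnorm (\<pi> a x) \<le> B * hnorm x"
      using op_bounded by blast
    then show "\<exists>B. \<forall>x\<in>?H. T.hnorm (?rep a x) \<le> B * T.hnorm x"
      by (auto simp: inv norm op_closed)
  qed (auto simp: inv op_closed op_add op_scale rep_add rep_scale rep_mult rep_star
      add_closed scale_closed)
  show ?thesis
  proof
    show "\<exists>a. \<exists>x\<in>?H. ?rep a x \<noteq> ?zero"
      using rep_nonzero inj by (fastforce simp: inv inj_on_eq_iff op_closed zero_closed)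
    fix K
    assume K: "T.closed_subspace K" and invar: "\<And>a x. x \<in> K \<Longrightarrow> ?rep a x \<in> K"
    define L where "L = {x \<in> H. \<Phi> x \<in> K}"
    have KL: "K = \<Phi> ` L"
      using K by (auto simp: L_def T.closed_subspace_def)
    have add: "\<Phi> (x \<oplus> y) \<in> K" if "x \<in> L" "y \<in> L" for x y
    proof -
      have "?add (\<Phi> x) (\<Phi> y) \<in> K"
        using K that unfolding T.closed_subspace_def L_def by blast
      then show ?thesis
        using that by (simp add: inv L_def)
    qed
    have scale: "\<Phi> (c \<odot> x) \<in> K" if "x \<in> L" for c x
    proof -
      have "?scale c (\<Phi> x) \<in> K"
        using K that unfolding T.closed_subspace_def L_def by blast
      then show ?thesis
        using that by (simp add: inv L_def)
    qed
    have Kclosed: "m \<in> K" if "\<forall>n. Y n \<in> K" "m \<in> ?H" "(\<lambda>n. T.hdist (Y n) m) \<longlonglongrightarrow> 0" for Y m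
      using K that unfolding T.closed_subspace_def by blast
    have lim: "l \<in> L" if X: "\<forall>n. X n \<in> L" and l: "l \<in> H" "(\<lambda>n. hdist (X n) l) \<longlonglongrightarrow> 0" for X l
    proof -
      have "\<And>n. X n \<in> H" "\<And>n. \<Phi> (X n) \<in> K"
        using X by (auto simp: L_def)
      then have "(\<lambda>n. T.hdist (\<Phi> (X n)) (\<Phi> l)) \<longlonglongrightarrow> 0" "\<And>n. \<Phi> (X n) \<in> K"
        using l by (auto simp: dist)
      moreover have "\<Phi> l \<in> ?H"
        using l by blast
      ultimately have "\<Phi> l \<in> K"
        using Kclosed[of "\<lambda>n. \<Phi> (X n)" "\<Phi> l"] by simp
      then show ?thesis
        using l by (simp add: L_def)
    qed
    have "\<zero> \<in> L"
      using K by (auto simp: L_def T.closed_subspace_def zero_closed)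
    then have "closed_subspace L"
      unfolding closed_subspace_def
    proof (intro conjI allI impI ballI; (elim conjE)?)
      show "L \<subseteq> H"
        by (auto simp: L_def)
      show "x \<oplus> y \<in> L" if "x \<in> L" "y \<in> L" for x y
        using add[OF that] that by (simp add: L_def add_closed)
      show "c \<odot> x \<in> L" if "x \<in> L" for c x
        using scale[OF that] that by (simp add: L_def scale_closed)
    qed (use lim in blast)+
    moreover have "\<pi> a x \<in> L" if "x \<in> L" for a x
      using invar[of "\<Phi> x" a] that by (simp add: L_def inv op_closed)
    ultimately have "L = {\<zero>} \<or> L = H"
      using irreducible by blast
    then show "K = {?zero} \<or> K = ?H"
      using KL by auto
  qed
qed

lemma primitive_ideal_rep_kernel: "primitive_ideal rep_kernel"
proof -
  obtain a0 x0 where x0: "x0 \<in> H" "\<pi> a0 x0 \<noteq> \<zero>"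
    using rep_nonzero by blast
  define \<Phi> where "\<Phi> = (\<lambda>x a. ip x (\<pi> a x0))"
  define K where "K = {x \<in> H. \<forall>y \<in> range (\<lambda>a. \<pi> a x0). ip x y = 0}"
  have "closed_subspace K"
    unfolding K_def by (rule closed_subspace_orthogonal) (auto simp: x0 op_closed)
  moreover have "\<pi> a x \<in> K" if "x \<in> K" for a x
  proof -
    have "ip (\<pi> a x) (\<pi> b x0) = 0" for b
    proof -
      have "ip (\<pi> (star (star a)) x) (\<pi> b x0) = ip x (\<pi> (star a * b) x0)"
        using that x0 by (subst rep_star) (auto simp: K_def op_closed rep_mult)
      then show ?thesis
        using that by (simp add: K_def star_star)
    qed
    then show ?thesis
      using that by (auto simp: K_def op_closed)
  qed
  ultimately have "K = {\<zero>} \<or> K = H"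
    using irreducible by blast
  moreover have "\<pi> a0 x0 \<notin> K"
  proof
    assume "\<pi> a0 x0 \<in> K"
    then have "ip (\<pi> a0 x0) (\<pi> a0 x0) = 0"
      by (simp add: K_def)
    then show False
      using ip_pos[of "\<pi> a0 x0"] x0 op_closed[of x0 a0] by simp
  qed
  ultimately have K: "K = {\<zero>}"
    using x0 op_closed by blast
  have inj: "inj_on \<Phi> H"
  proof (rule inj_onI)
    fix x y
    assume xy: "x \<in> H" "y \<in> H" "\<Phi> x = \<Phi> y"
    then have "ip x (\<pi> a x0) = ip y (\<pi> a x0)" for a
      by (metis \<Phi>_def)
    then have "x \<oplus> (-1) \<odot> y \<in> K"
      using xy x0
      by (auto simp: K_def add_closed neg_closed ip_add_left ip_scale_left op_closed)
    then show "x = y"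
      using K diff_eq_zero xy by blast
  qed
  let ?\<Psi> = "inv_into H \<Phi>"
  note T = transport[OF inj]
  have "rep_kernel
      = star_representation.rep_kernel (\<Phi> ` H) (\<Phi> \<zero>) (\<lambda>a x. \<Phi> (\<pi> a (?\<Psi> x)))"
    unfolding rep_kernel_def
      star_representation.rep_kernel_def[OF irreducible_representation.axioms(1)[OF T]]
    using inj by (auto simp: inj_on_eq_iff op_closed zero_closed)
  then show ?thesis
    unfolding primitive_ideal_def using T by blast
qed

lemma rep_kernel_mult:
  assumes "a \<in> rep_kernel"
  shows "b * a \<in> rep_kernel" "a * b \<in> rep_kernel"
  using assms by (auto simp: rep_kernel_def rep_mult op_closed op_zero)

lemma rep_kernel_prime:
  assumes I: "\<And>a x. x \<in> I \<Longrightarrow> a * x \<in> I \<and> x * a \<in> I"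
    and J: "\<And>a x. x \<in> J \<Longrightarrow> a * x \<in> J \<and> x * a \<in> J"
    and IJ: "I \<inter> J \<subseteq> rep_kernel"
  shows "I \<subseteq> rep_kernel \<or> J \<subseteq> rep_kernel"
proof -
  define K where "K = {x \<in> H. \<forall>t\<in>J. \<pi> t x = \<zero>}"
  have "closed_subspace K"
    unfolding K_def by (rule closed_subspace_annihilated)
  moreover have "\<pi> a x \<in> K" if "x \<in> K" for a x
    using that J by (auto simp: K_def op_closed rep_mult[symmetric])
  ultimately consider "K = {\<zero>}" | "K = H"
    using irreducible by blast
  then show ?thesis
  proof cases
    case 1
    have "\<pi> i x \<in> K" if "i \<in> I" "x \<in> H" for i x
    proof -
      have "\<pi> (t * i) x = \<zero>" if "t \<in> J" for t
        using IJ I[OF \<open>i \<in> I\<close>, of t] J[OF that, of i] \<open>x \<in> H\<close> by (auto simp: rep_kernel_def)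
      then show ?thesis
        using that by (auto simp: K_def op_closed rep_mult)
    qed
    then show ?thesis
      using 1 by (auto simp: rep_kernel_def)
  next
    case 2
    then show ?thesis
      by (auto simp: K_def rep_kernel_def)
  qed
qed

end


section \<open>The hull-kernel topology is a topology\<close>

lemma primitive_ideal_mult:
  assumes "primitive_ideal P" "a \<in> P"
  shows "b * a \<in> P" "a * b \<in> P"
proof -
  obtain H :: "('a \<Rightarrow> complex) set" and vadd vzero vscale ip \<pi> where
    R: "irreducible_representation H vadd vzero vscale ip \<pi>"
      and P: "P = star_representation.rep_kernel H vzero \<pi>"
    using assms(1) unfolding primitive_ideal_def by blast
  show "b * a \<in> P" "a * b \<in> P"
    using irreducible_representation.rep_kernel_mult[OF R, of a b] assms(2) unfolding P
    by auto
qed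

lemma primitive_ideal_prime:
  assumes "primitive_ideal P"
    and "\<And>a x. x \<in> I \<Longrightarrow> a * x \<in> I \<and> x * a \<in> I"
    and "\<And>a x. x \<in> J \<Longrightarrow> a * x \<in> J \<and> x * a \<in> J"
    and "I \<inter> J \<subseteq> P"
  shows "I \<subseteq> P \<or> J \<subseteq> P"
proof -
  obtain H :: "('a \<Rightarrow> complex) set" and vadd vzero vscale ip \<pi> where
    R: "irreducible_representation H vadd vzero vscale ip \<pi>"
      and P: "P = star_representation.rep_kernel H vzero \<pi>"
    using assms(1) unfolding primitive_ideal_def by blast
  show ?thesis
    unfolding P by (rule irreducible_representation.rep_kernel_prime[OF R])
      (use assms P in auto)
qed

lemma primitive_ideal_proper:
  assumes "primitive_ideal P"
  shows "P \<noteq> UNIV"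
proof -
  obtain H :: "('a \<Rightarrow> complex) set" and vadd vzero vscale ip \<pi> where
    R: "irreducible_representation H vadd vzero vscale ip \<pi>"
      and P: "P = star_representation.rep_kernel H vzero \<pi>"
    using assms unfolding primitive_ideal_def by blast
  obtain a x where "x \<in> H" "\<pi> a x \<noteq> vzero"
    using irreducible_representation.rep_nonzero[OF R] by blast
  then have "a \<notin> P"
    unfolding P
      star_representation.rep_kernel_def[OF irreducible_representation.axioms(1)[OF R]]
    by blast
  then show ?thesis
    by blast
qed

lemma hull_kernel_eq_iff:
  assumes "U \<subseteq> Prim"
  shows "ideal_hull (ideal_kernel (Prim - U)) = Prim - U \<longleftrightarrow>
     (\<forall>P\<in>U. \<not> \<Inter>(Prim - U) \<subseteq> P)"
proof -
  define Q where "Q = \<Inter>(Prim - U)"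
  have "\<forall>P\<in>Prim - U. Q \<subseteq> P"
    unfolding Q_def by blast
  then show ?thesis
    unfolding ideal_hull_def ideal_kernel_def Q_def[symmetric] using assms by auto
qed

lemma istopology_hull_kernel:
  "istopology (\<lambda>U :: 'a::cstar_algebra set set.
     U \<subseteq> Prim \<and> ideal_hull (ideal_kernel (Prim - U)) = Prim - U)"
  unfolding istopology_def
proof (intro conjI allI impI; (elim conjE)?)
  fix U V :: "'a set set"
  assume U: "U \<subseteq> Prim" "ideal_hull (ideal_kernel (Prim - U)) = Prim - U"
    and V: "V \<subseteq> Prim" "ideal_hull (ideal_kernel (Prim - V)) = Prim - V"
  show UV: "U \<inter> V \<subseteq> Prim"
    using U by blast
  have "\<not> \<Inter>(Prim - U \<inter> V) \<subseteq> P" if P: "P \<in> U \<inter> V" for P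
  proof
    assume "\<Inter>(Prim - U \<inter> V) \<subseteq> P"
    then have "\<Inter>(Prim - U) \<inter> \<Inter>(Prim - V) \<subseteq> P"
      by blast
    moreover have "primitive_ideal P"
      using P U by (auto simp: Prim_def)
    ultimately have "\<Inter>(Prim - U) \<subseteq> P \<or> \<Inter>(Prim - V) \<subseteq> P"
      by (intro primitive_ideal_prime) (auto simp: Prim_def intro: primitive_ideal_mult)
    then show False
      using U V P by (auto simp: hull_kernel_eq_iff)
  qed
  then show "ideal_hull (ideal_kernel (Prim - U \<inter> V)) = Prim - U \<inter> V"
    using UV by (subst hull_kernel_eq_iff) auto
next
  fix \<U> :: "'a set set set"
  assume "\<forall>U\<in>\<U>. U \<subseteq> Prim \<and> ideal_hull (ideal_kernel (Prim - U)) = Prim - U"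
  then have sub: "U \<subseteq> Prim" and hk: "ideal_hull (ideal_kernel (Prim - U)) = Prim - U"
    if "U \<in> \<U>" for U
    using that by simp_all
  have U: "\<not> \<Inter>(Prim - U) \<subseteq> P" if "U \<in> \<U>" "P \<in> U" for U P
    using hull_kernel_eq_iff[OF sub[OF that(1)]] hk[OF that(1)] that(2) by simp
  show *: "\<Union>\<U> \<subseteq> Prim"
    using sub by blast
  have "\<not> \<Inter>(Prim - \<Union>\<U>) \<subseteq> P" if P: "P \<in> \<Union>\<U>" for P
  proof -
    obtain U where U': "U \<in> \<U>" "P \<in> U"
      using P by blast
    have "\<Inter>(Prim - U) \<subseteq> \<Inter>(Prim - \<Union>\<U>)"
      using U' by blast
    then show ?thesis
      using U[OF U'] by blast
  qed
  then show "ideal_hull (ideal_kernel (Prim - \<Union>\<U>)) = Prim - \<Union>\<U>"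
    using * by (subst hull_kernel_eq_iff) auto
qed

lemma openin_prim_space:
  "openin prim_space U \<longleftrightarrow>
     U \<subseteq> Prim \<and> ideal_hull (ideal_kernel (Prim - U)) = Prim - U"
  unfolding prim_space_def topology_inverse'[OF istopology_hull_kernel] by (rule refl)

lemma topspace_prim_space: "topspace prim_space = Prim"
proof (rule subset_antisym)
  show "topspace prim_space \<subseteq> Prim"
    using openin_prim_space[THEN iffD1, OF openin_topspace] by (rule conjunct1)
  have "ideal_hull UNIV = {}"
    unfolding ideal_hull_def Prim_def using primitive_ideal_proper by auto
  then have "openin prim_space Prim"
    by (simp add: openin_prim_space ideal_kernel_def)
  then show "Prim \<subseteq> topspace prim_space"
    by (rule openin_subset)
qed

end

theory Submission
  imports Defs
begin

text \<open>
  The center is found by multiplying a local unit by a continuous function on \<open>Prim\<close>, as in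
  the Dauns-Hofmann theorem.

  A primitive ideal \<open>P\<close> is prime, hence primal, and by Zorn's lemma it contains a minimal
  primal ideal. The hypothesis on minimal primal ideals therefore makes every quotient by a
  primitive ideal unital (\<open>primitive_ideal_unit_mod\<close>). If \<open>v\<close> is a member of the approximate
  identity and is close to the unit modulo \<open>P\<close>, a continuous function of
  \<open>star (1 - v) * (1 - v)\<close> is exactly a unit modulo \<open>P\<close>
  (\<open>unit_mod_of_approximate_unit\<close>). So \<open>Prim\<close> is the union of countably many sets on each of
  which a single element \<open>e n\<close> of the algebra is a unit. These sets are closed, and by a
  Baire category argument one of them contains a non-empty open set \<open>U\<close>
  (\<open>exists_uniform_local_unit\<close>, \<open>local_unit_exists\<close>).

  Quasi-complete regularity gives a continuous \<open>F : Prim \<rightarrow> [0, 1]\<close> that vanishes outside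
  \<open>U\<close> and takes the value \<open>1\<close>. For \<open>s < t\<close> no primitive ideal lies in both of the closed sets
  \<open>{F \<le> s}\<close> and \<open>{F \<ge> t}\<close>, so there is an element of norm at most \<open>1\<close> that is zero modulo the
  ideals of the first set and a unit modulo those of the second (\<open>separating_element\<close>).
  Averages of such elements approximate, uniformly on \<open>Prim\<close>, an element \<open>z\<close> with
  \<open>z - F P *\<^sub>R e \<in> P\<close> for all \<open>P\<close>. It commutes with everything modulo every primitive ideal
  and is not zero, and an element that lies in all primitive ideals is zero
  (\<open>norm_le_of_primitive_ideals\<close>), so \<open>z\<close> is a nonzero central element
  (\<open>central_element_exists\<close>).

  All these steps need primitive ideals with prescribed properties, and all of them come from one
  existence theorem (\<open>irreducible_representation_of_left_ideal\<close>): a proper left ideal of a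
  unital C*-algebra annihilates a nonzero vector of some irreducible representation. The states
  that vanish on the left ideal are the linear functionals below a sublinear functional; a
  minimal sublinear functional with a face property yields an extreme one, without any appeal to
  compactness, and its GNS representation is irreducible. The theorem is applied to the algebra
  with a unit adjoined. The order theory that it rests on, in particular the positivity of
  \<open>star a * a\<close>, is derived from square roots of \<open>1 - h\<close> and from the fact that unitaries have
  norm \<open>1\<close>, so that no spectral theory is used.
\<close>

section \<open>Elementary C*-algebra\<close>

class unital_cstar_algebra = cstar_algebra + real_normed_algebra_1

lemma commute_mult:
  fixes c p q :: "'a::semigroup_mult"
  assumes "c * p = p * c" "c * q = q * c" shows "c * (p * q) = (p * q) * c"
proof -
  have "c * (p * q) = p * (c * q)" by (simp add: mult.assoc[symmetric] assms(1))
  then show ?thesis by (simp add: mult.assoc assms(2))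
qed

lemma square_mult:
  fixes p q :: "'a::semigroup_mult"
  assumes "q * p = p * q" shows "(p * q) * (p * q) = (p * p) * (q * q)"
proof -
  have "(p * q) * (p * q) = p * (q * p) * q" by (simp add: mult.assoc)
  then show ?thesis by (simp add: assms mult.assoc)
qed

lemma scaleC_zero_left [simp]: "0 *\<^sub>C (x::'a::cstar_algebra) = 0"
  using scaleC_of_real[of 0 x] by simp

lemma scaleC_one [simp]: "1 *\<^sub>C (x::'a::cstar_algebra) = x"
  using scaleC_of_real[of 1 x] by simp

lemma scaleC_minus_one: "(-1) *\<^sub>C (x::'a::cstar_algebra) = - x"
  using scaleC_of_real[of "-1" x] by simp

lemma scaleC_zero_right [simp]: "c *\<^sub>C (0::'a::cstar_algebra) = 0"
  using scaleC_add_right[of c 0 0] by simp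

lemma scaleC_minus_right: "c *\<^sub>C (- x::'a::cstar_algebra) = - (c *\<^sub>C x)"
  using scaleC_add_right[of c x "-x"] by (simp add: eq_neg_iff_add_eq_0 add.commute)

lemma scaleC_minus_left: "(- c) *\<^sub>C (x::'a::cstar_algebra) = - (c *\<^sub>C x)"
  using scaleC_add_left[of c "-c" x] by (simp add: eq_neg_iff_add_eq_0 add.commute)

lemma scaleC_diff_right: "c *\<^sub>C (x - y::'a::cstar_algebra) = c *\<^sub>C x - c *\<^sub>C y"
  using scaleC_add_right[of c x "-y"] by (simp add: scaleC_minus_right)

lemma scaleC_scaleR: "c *\<^sub>C (r *\<^sub>R x) = r *\<^sub>R (c *\<^sub>C (x::'a::cstar_algebra))"
  by (simp add: scaleC_of_real[symmetric] scaleC_scaleC mult.commute)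

lemma star_zero [simp]: "star (0::'a::cstar_algebra) = 0"
  using star_add[of 0 "0::'a"] by simp

lemma star_minus: "star (- x::'a::cstar_algebra) = - star x"
  using star_add[of x "-x"] by (simp add: eq_neg_iff_add_eq_0 add.commute)

lemma star_diff: "star (x - y::'a::cstar_algebra) = star x - star y"
  using star_add[of x "-y"] by (simp add: star_minus)

lemma star_scaleR: "star (r *\<^sub>R x::'a::cstar_algebra) = r *\<^sub>R star x"
  using star_scaleC[of "complex_of_real r" x] by (simp add: scaleC_of_real)

lemma star_one [simp]: "star (1::'a::unital_cstar_algebra) = 1"
  using star_mult[of "1::'a" "star 1"] by (simp add: star_star)

lemma norm_star [simp]: "norm (star x) = norm (x::'a::cstar_algebra)"
proof -
  have le: "norm y \<le> norm (star y)" for y :: 'a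
  proof (cases "y = 0")
    case False
    have "(norm y)\<^sup>2 \<le> norm (star y) * norm y"
      using norm_mult_ineq[of "star y" y] by (simp add: cstar_identity)
    then show ?thesis
      using False by (simp add: power2_eq_square)
  qed simp
  show ?thesis
    using le[of x] le[of "star x"] by (simp add: star_star)
qed

lemma bounded_linear_star: "bounded_linear (star :: 'a::cstar_algebra \<Rightarrow> 'a)"
  by (rule bounded_linear_intro[where K = 1]) (simp_all add: star_add star_scaleR)

lemmas tendsto_star = bounded_linear.tendsto[OF bounded_linear_star]

lemma star_mult_self_eq_0: "star x * x = 0 \<longleftrightarrow> (x::'a::cstar_algebra) = 0"
  using cstar_identity[of x] by auto

text \<open>
  The equation says \<open>(1 - b)\<^sup>2 = 1 - h\<close> without mentioning a unit. The iteration
  \<open>b \<mapsto> (h + b\<^sup>2) / 2\<close> converges even for \<open>norm h = 1\<close>, because its increments are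
  dominated by those of the scalar iteration \<open>t \<mapsto> (1 + t\<^sup>2) / 2\<close>, which increases to a
  limit.
\<close>

lemma one_minus_sqrt:
  fixes h :: "'a::cstar_algebra"
  assumes h: "norm h \<le> 1" "star h = h"
  obtains b where "star b = b" "norm b \<le> 1" "2 *\<^sub>R b - b * b = h"
    "\<And>c. c * h = h * c \<Longrightarrow> c * b = b * c"
proof -
  define b where "b n = ((\<lambda>b. (1/2) *\<^sub>R (h + b * b)) ^^ n) 0" for n
  define t where "t n = ((\<lambda>t. (1 + t * t) / 2) ^^ n) (0::real)" for n
  have b0: "b 0 = 0" and bS: "b (Suc n) = (1/2) *\<^sub>R (h + b n * b n)" for n
    by (simp_all add: b_def)
  have t0: "t 0 = 0" and tS: "t (Suc n) = (1 + t n * t n) / 2" for n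
    by (simp_all add: t_def)
  have t01: "0 \<le> t n \<and> t n \<le> 1" for n
  proof (induction n)
    case (Suc n)
    then have "t n * t n \<le> 1 * 1" by (intro mult_mono) auto
    then show ?case using Suc by (simp add: tS)
  qed (simp add: t0)
  have tinc: "t n \<le> t (Suc n)" for n
  proof -
    have "0 \<le> (1 - t n)\<^sup>2" by simp
    then show ?thesis by (simp add: tS power2_eq_square algebra_simps)
  qed
  have bt: "norm (b n) \<le> t n" for n
  proof (induction n)
    case (Suc n)
    have "norm (b n * b n) \<le> t n * t n"
      using norm_mult_ineq[of "b n" "b n"] mult_mono[OF Suc Suc] t01[of n] by simp
    then show ?case
      using h(1) norm_triangle_ineq[of h "b n * b n"] by (simp add: bS tS)
  qed (simp add: b0 t0)
  have inc: "norm (b (Suc n) - b n) \<le> t (Suc n) - t n" for n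
  proof (induction n)
    case 0
    then show ?case using h by (simp add: b0 t0 bS tS)
  next
    case (Suc n)
    define x y where "x = b (Suc n)" and "y = b n"
    have "b (Suc (Suc n)) = (1/2) *\<^sub>R (h + x * x)" "b (Suc n) = (1/2) *\<^sub>R (h + y * y)"
      unfolding x_def y_def by (rule bS)+
    then have "b (Suc (Suc n)) - b (Suc n) = (1/2) *\<^sub>R (h + x * x) - (1/2) *\<^sub>R (h + y * y)"
      by (rule arg_cong2)
    also have "\<dots> = (1/2) *\<^sub>R (x * (x - y) + (x - y) * y)"
      by (simp add: algebra_simps)
    finally have "norm (b (Suc (Suc n)) - b (Suc n)) = norm ((1/2) *\<^sub>R (x * (x - y) + (x - y) * y))"
      by simp
    also have "\<dots> \<le> (1/2) * (norm x * norm (x - y) + norm (x - y) * norm y)"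
      using norm_triangle_ineq[of "x * (x - y)" "(x - y) * y"]
        norm_mult_ineq[of x "x - y"] norm_mult_ineq[of "x - y" y] by simp
    also have "\<dots> = (1/2) * ((norm x + norm y) * norm (x - y))"
      by (simp add: algebra_simps)
    also have "\<dots> \<le> (1/2) * ((t (Suc n) + t n) * (t (Suc n) - t n))"
      using Suc bt[of n] bt[of "Suc n"] t01
      by (intro mult_left_mono mult_mono add_mono) (auto simp: x_def y_def)
    also have "\<dots> = (1 + t (Suc n) * t (Suc n)) / 2 - (1 + t n * t n) / 2"
      by (simp add: algebra_simps diff_divide_distrib add_divide_distrib)
    also have "\<dots> = t (Suc (Suc n)) - t (Suc n)" by (simp only: tS)
    finally show ?case .
  qed
  have diff: "norm (b (n + k) - b n) \<le> t (n + k) - t n" for n k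
  proof (induction k)
    case (Suc k)
    show ?case
      using inc[of "n + k"] Suc norm_triangle_ineq[of "b (Suc (n + k)) - b (n + k)" "b (n + k) - b n"]
      by simp
  qed simp
  have "Bseq t" by (rule BseqI'[of _ 1]) (simp add: t01)
  moreover have "incseq t" by (rule incseq_SucI) (rule tinc)
  ultimately have "convergent t" by (intro Bseq_monoseq_convergent incseq_imp_monoseq)
  then have Ct: "Cauchy t" by (rule convergent_Cauchy)
  have "Cauchy b"
  proof (rule metric_CauchyI)
    fix e :: real assume "e > 0"
    then obtain M where M: "\<forall>m\<ge>M. \<forall>n\<ge>M. dist (t m) (t n) < e"
      using metric_CauchyD[OF Ct] by blast
    have "dist (b m) (b n) < e" if "m \<ge> M" "n \<ge> M" "n \<le> m" for m n
    proof -
      have "dist (b m) (b n) \<le> t m - t n"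
        using diff[of n "m - n"] that by (simp add: dist_norm)
      also have "\<dots> < e"
        using M[rule_format, OF that(1,2)] unfolding dist_real_def by linarith
      finally show ?thesis .
    qed
    then show "\<exists>M. \<forall>m\<ge>M. \<forall>n\<ge>M. dist (b m) (b n) < e"
      by (metis dist_commute nat_le_linear)
  qed
  then obtain l where l: "b \<longlonglongrightarrow> l"
    using Cauchy_convergent_iff convergent_def by blast
  have "(\<lambda>n. b (Suc n)) \<longlonglongrightarrow> (1/2) *\<^sub>R (h + l * l)"
    unfolding bS by (intro tendsto_intros l)
  then have l_eq: "l = (1/2) *\<^sub>R (h + l * l)"
    using l LIMSEQ_Suc LIMSEQ_unique by blast
  have sq: "2 *\<^sub>R l - l * l = h"
    by (subst (1) l_eq) simp
  have "star (b n) = b n" for n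
    by (induction n) (simp_all add: b0 bS star_scaleR star_add star_mult h)
  then have st: "star l = l"
    using tendsto_star[OF l] l LIMSEQ_unique by auto
  have nl: "norm l \<le> 1"
    using bt t01 by (intro LIMSEQ_le_const2[OF tendsto_norm[OF l]]) (meson order_trans)
  have comm: "c * l = l * c" if "c * h = h * c" for c
  proof -
    have "c * b n = b n * c" for n
    proof (induction n)
      case (Suc n)
      have "c * (b n * b n) = b n * b n * c"
        by (rule commute_mult[OF Suc Suc])
      then show ?case using that by (simp add: bS algebra_simps)
    qed (simp add: b0)
    then show ?thesis
      using tendsto_mult_left[OF l, of c] tendsto_mult_right[OF l, of c] LIMSEQ_unique by auto
  qed
  show ?thesis using that[OF st nl sq comm] by blast
qed


section \<open>The order of a unital C*-algebra\<close>

text \<open>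
  For a self-adjoint element the norm condition says that its spectrum lies in
  \<open>[0, 2 * R]\<close>; it makes closure under sums immediate.
\<close>

definition is_positive :: "'a::unital_cstar_algebra \<Rightarrow> bool" where
  "is_positive x \<longleftrightarrow> star x = x \<and> (\<exists>R. norm (R *\<^sub>R 1 - x) \<le> R)"

lemma positive_selfadjoint: "is_positive x \<Longrightarrow> star x = x"
  by (simp add: is_positive_def)

lemma positive_add:
  assumes "is_positive x" "is_positive y" shows "is_positive (x + y)"
proof -
  obtain R S where "norm (R *\<^sub>R 1 - x) \<le> R" "norm (S *\<^sub>R 1 - y) \<le> S"
    using assms by (auto simp: is_positive_def)
  then have "norm ((R + S) *\<^sub>R 1 - (x + y)) \<le> R + S"
    using norm_triangle_ineq[of "R *\<^sub>R 1 - x" "S *\<^sub>R 1 - y"] by (simp add: algebra_simps)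
  then show ?thesis using assms by (auto simp: is_positive_def star_add)
qed

lemma positive_scaleR:
  assumes "is_positive x" "r \<ge> 0" shows "is_positive (r *\<^sub>R x)"
proof -
  obtain R where "norm (R *\<^sub>R 1 - x) \<le> R"
    using assms by (auto simp: is_positive_def)
  then have "norm ((r * R) *\<^sub>R 1 - r *\<^sub>R x) \<le> r * R"
    using assms(2) by (simp add: scaleR_scaleR[symmetric] scaleR_diff_right[symmetric] mult_left_mono del: scaleR_scaleR)
  then show ?thesis using assms by (auto simp: is_positive_def star_scaleR)
qed

lemma positive_of_real: "r \<ge> 0 \<Longrightarrow> is_positive (r *\<^sub>R 1)"
  unfolding is_positive_def by (intro conjI exI[of _ r]) (auto simp: star_scaleR)

lemma positive_of_real_iff: "is_positive (r *\<^sub>R 1 :: 'a::unital_cstar_algebra) \<longleftrightarrow> r \<ge> 0"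
proof
  assume "is_positive (r *\<^sub>R 1 :: 'a)"
  then obtain R where "norm (R *\<^sub>R 1 - r *\<^sub>R 1 :: 'a) \<le> R" by (auto simp: is_positive_def)
  then have "\<bar>R - r\<bar> \<le> R" by (simp add: scaleR_diff_left[symmetric])
  then show "r \<ge> 0" by simp
qed (rule positive_of_real)

lemma positive_diff_of_norm_le: "star x = x \<Longrightarrow> norm x \<le> r \<Longrightarrow> is_positive (r *\<^sub>R 1 - x)"
  unfolding is_positive_def by (intro conjI exI[of _ r]) (auto simp: star_scaleR star_diff)

text \<open>If \<open>x\<close> and \<open>s\<close> commute, \<open>x + \<i> s\<close> is a multiple of a unitary with real part \<open>x\<close>.\<close>

lemma norm_le_of_sum_of_squares:
  fixes x s :: "'a::unital_cstar_algebra"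
  assumes "star x = x" "star s = s" "x * s = s * x" "x * x + s * s = m\<^sup>2 *\<^sub>R 1" "m \<ge> 0"
  shows "norm x \<le> m"
proof -
  define w where "w = x + \<i> *\<^sub>C s"
  have sw: "star w = x - \<i> *\<^sub>C s"
    by (simp add: w_def star_add star_scaleC assms scaleC_minus_left)
  have "star w * w = x * x + s * s"
    using assms(3) by (subst sw, subst w_def) (simp add: algebra_simps scaleC_diff_right scaleC_add_right mult_scaleC_left mult_scaleC_right scaleC_scaleC scaleC_minus_one)
  then have "(norm w)\<^sup>2 = m\<^sup>2"
    using cstar_identity[of w] assms by simp
  then have nw: "norm w = m" using assms by simp
  have "2 *\<^sub>R x = w + star w" unfolding sw by (simp add: w_def scaleR_2)
  then have "2 * norm x \<le> 2 * m"
    by (metis (no_types) norm_scaleR norm_star norm_triangle_ineq nw abs_numeral mult_2)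
  then show ?thesis by simp
qed

text \<open>
  For \<open>norm x = 1\<close>, the self-adjoint root \<open>s\<close> of \<open>1 - x\<^sup>2\<close> has norm at most \<open>1\<close> by the
  previous lemma, hence so has \<open>1 - x\<^sup>2 = s\<^sup>2\<close>.
\<close>

lemma positive_square:
  fixes x :: "'a::unital_cstar_algebra"
  assumes x: "star x = x" shows "is_positive (x * x)"
proof (cases "x = 0")
  case True
  then show ?thesis using positive_of_real[of 0] by simp
next
  case False
  define u where "u = (1 / norm x) *\<^sub>R x"
  have u: "star u = u" "norm u = 1" using False x by (simp_all add: u_def star_scaleR)
  have xu: "x = norm x *\<^sub>R u" using False by (simp add: u_def)
  have nuu: "norm (u * u) \<le> 1" using norm_mult_ineq[of u u] u by simp
  obtain b where b: "star b = b" "2 *\<^sub>R b - b * b = u * u" "\<And>c. c * (u*u) = (u*u) * c \<Longrightarrow> c * b = b * c"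
    using one_minus_sqrt[of "u*u"] nuu u by (metis star_mult)
  define s where "s = 1 - b"
  have uu: "u * u = b + b - b * b" using b(2) by (simp add: scaleR_2)
  have ss: "s * s = 1 - u * u" unfolding uu by (simp add: s_def algebra_simps)
  have "u * b = b * u" using b(3)[of u] by (simp add: mult.assoc)
  then have "s * u = u * s" "star s = s" by (simp_all add: s_def algebra_simps star_diff b)
  then have "norm s \<le> 1"
    by (intro norm_le_of_sum_of_squares[of s u]) (simp_all add: ss u)
  then have n1: "norm (1 - u * u) \<le> 1"
    using ss norm_mult_ineq[of s s] mult_mono[of "norm s" 1 "norm s" 1] by simp
  have "(norm x)\<^sup>2 *\<^sub>R 1 - x * x = (norm x)\<^sup>2 *\<^sub>R (1 - u * u)"
    by (subst (2 3) xu) (simp add: scaleR_diff_right power2_eq_square)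
  then have "norm ((norm x)\<^sup>2 *\<^sub>R 1 - x * x) \<le> (norm x)\<^sup>2"
    using n1 by (simp add: mult_left_le)
  then show ?thesis by (auto simp: is_positive_def star_mult x)
qed

text \<open>
  The root commutes with everything that commutes with \<open>x\<close>; this replaces the commutativity of
  the continuous functional calculus.
\<close>

lemma positive_sqrt:
  fixes x :: "'a::unital_cstar_algebra"
  assumes x: "is_positive x"
  obtains y where "is_positive y" "y * y = x" "\<And>c. c * x = x * c \<Longrightarrow> c * y = y * c"
proof -
  obtain R where R: "norm (R *\<^sub>R 1 - x) \<le> R" using x by (auto simp: is_positive_def)
  have R0: "R \<ge> 0" using R norm_ge_zero order_trans by blast
  show thesis
  proof (cases "R = 0")
    case True
    then have "x = 0" using R by simp
    then show thesis using that[of 0] positive_of_real[of 0] by simp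
  next
    case False
    with R0 have Rp: "R > 0" by simp
    define h where "h = 1 - (1/R) *\<^sub>R x"
    have "h = (1/R) *\<^sub>R (R *\<^sub>R 1 - x)" using Rp by (simp add: h_def scaleR_diff_right)
    then have "norm h = (1/R) * norm (R *\<^sub>R 1 - x)" using Rp by simp
    then have "norm h \<le> 1" using R Rp by simp
    moreover have "star h = h" using x by (simp add: h_def star_diff star_scaleR is_positive_def)
    ultimately obtain b where b: "star b = b" "norm b \<le> 1" "2 *\<^sub>R b - b * b = h"
      "\<And>c. c * h = h * c \<Longrightarrow> c * b = b * c"
      using one_minus_sqrt by metis
    define y where "y = sqrt R *\<^sub>R (1 - b)"
    have "norm (sqrt R *\<^sub>R 1 - y) \<le> sqrt R"
      using b(2) R0 by (simp add: y_def scaleR_diff_right mult_left_le)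
    moreover have "star y = y" by (simp add: y_def star_scaleR star_diff b)
    ultimately have "is_positive y" by (auto simp: is_positive_def)
    moreover have "y * y = R *\<^sub>R (1 - h)"
      using R0 by (simp add: y_def b(3)[symmetric] algebra_simps scaleR_2)
    then have "y * y = x" using Rp by (simp add: h_def)
    moreover have "c * y = y * c" if "c * x = x * c" for c
      using b(4)[of c] that by (simp add: y_def h_def algebra_simps)
    ultimately show thesis using that by blast
  qed
qed

lemma positive_mult:
  fixes x y :: "'a::unital_cstar_algebra"
  assumes "is_positive x" "is_positive y" "x * y = y * x" shows "is_positive (x * y)"
proof -
  obtain p where p: "is_positive p" "p * p = x" "\<And>c. c * x = x * c \<Longrightarrow> c * p = p * c"
    using positive_sqrt[OF assms(1)] by metis
  obtain q where q: "is_positive q" "q * q = y" "\<And>c. c * y = y * c \<Longrightarrow> c * q = q * c"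
    using positive_sqrt[OF assms(2)] by metis
  have pq: "p * q = q * p" using q(3)[of p] p(3)[of y] assms(3) by simp
  have "(p * q) * (p * q) = x * y"
    using square_mult[OF pq[symmetric]] by (simp add: p(2) q(2))
  moreover have "star (p * q) = p * q"
    using pq by (simp add: star_mult positive_selfadjoint[OF p(1)] positive_selfadjoint[OF q(1)])
  ultimately show ?thesis using positive_square[of "p * q"] by simp
qed

text \<open>
  The roots \<open>p\<close> of \<open>m - y\<close> and \<open>q\<close> of \<open>m + y\<close> commute, and \<open>y\<^sup>2 + (p q)\<^sup>2 = m\<^sup>2\<close>.
\<close>

lemma norm_le_of_positive_bounds:
  fixes y :: "'a::unital_cstar_algebra"
  assumes m: "is_positive (m *\<^sub>R 1 - y)" "is_positive (m *\<^sub>R 1 + y)" shows "norm y \<le> m"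
proof -
  have "is_positive ((2 * m) *\<^sub>R 1 :: 'a)"
  proof -
    have "(m *\<^sub>R 1 - y) + (m *\<^sub>R 1 + y) = (2 * m) *\<^sub>R 1"
      by (simp only: mult_2 scaleR_add_left) simp
    then show ?thesis using positive_add[OF m] by simp
  qed
  then have m0: "m \<ge> 0" by (simp add: positive_of_real_iff)
  have y: "star y = y"
    using positive_selfadjoint[OF m(2)] by (simp add: star_add star_scaleR)
  obtain p where p: "is_positive p" "p * p = m *\<^sub>R 1 - y"
      "\<And>c. c * (m *\<^sub>R 1 - y) = (m *\<^sub>R 1 - y) * c \<Longrightarrow> c * p = p * c"
    using positive_sqrt[OF m(1)] by metis
  obtain q where q: "is_positive q" "q * q = m *\<^sub>R 1 + y"
      "\<And>c. c * (m *\<^sub>R 1 + y) = (m *\<^sub>R 1 + y) * c \<Longrightarrow> c * q = q * c"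
    using positive_sqrt[OF m(2)] by metis
  have yp: "y * p = p * y" using p(3)[of y] by (simp add: algebra_simps)
  have yq: "y * q = q * y" using q(3)[of y] by (simp add: algebra_simps)
  have pq: "p * q = q * p" using q(3)[of p] yp by (simp add: algebra_simps)
  have "(p * q) * (p * q) = (m *\<^sub>R 1 - y) * (m *\<^sub>R 1 + y)"
    using square_mult[OF pq[symmetric]] by (simp add: p(2) q(2))
  then have "y * y + (p * q) * (p * q) = m\<^sup>2 *\<^sub>R 1"
    by (simp add: algebra_simps power2_eq_square)
  moreover have "y * (p * q) = (p * q) * y" by (rule commute_mult) (rule yp yq)+
  moreover have "star (p * q) = p * q"
    using pq by (simp add: star_mult positive_selfadjoint[OF p(1)] positive_selfadjoint[OF q(1)])
  ultimately show ?thesis using norm_le_of_sum_of_squares[of y "p * q" m] y m0 by blast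
qed

lemma norm_le_of_positive:
  fixes x :: "'a::unital_cstar_algebra"
  assumes "is_positive x" "is_positive (m *\<^sub>R 1 - x)" shows "norm x \<le> m"
proof (rule norm_le_of_positive_bounds)
  have "is_positive (m *\<^sub>R 1 :: 'a)" using positive_add[OF assms] by simp
  then show "is_positive (m *\<^sub>R 1 + x)" using assms(1) by (rule positive_add)
qed (fact assms(2))

lemma positive_antisym: "is_positive x \<Longrightarrow> is_positive (- x) \<Longrightarrow> x = (0::'a::unital_cstar_algebra)"
  using norm_le_of_positive[of x 0] by simp

lemma inverse_of_norm_less:
  fixes x :: "'a::unital_cstar_algebra"
  assumes "norm (1 - x) < 1" obtains y where "x * y = 1" "y * x = 1"
proof -
  define d where "d = 1 - x"
  have S: "summable (\<lambda>n. d ^ n)"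
    using assms complete_algebra_summable_geometric by (auto simp: d_def)
  define y where "y = (\<Sum>n. d ^ n)"
  have y: "y = (\<Sum>n. d ^ Suc n) + 1"
    using suminf_split_head[OF S] by (simp add: y_def)
  have "d * y = (\<Sum>n. d ^ Suc n)" unfolding y_def by (simp add: suminf_mult[OF S])
  then have 1: "x * y = 1" using y by (simp add: d_def algebra_simps)
  have "y * d = (\<Sum>n. d ^ Suc n)" unfolding y_def by (simp add: suminf_mult2[OF S] power_commutes)
  then have "y * x = 1" using y by (simp add: d_def algebra_simps)
  with 1 show ?thesis using that by blast
qed

lemma inverse_one_plus_positive:
  fixes k :: "'a::unital_cstar_algebra"
  assumes k: "is_positive k"
  obtains y where "(1 + k) * y = 1" "y * (1 + k) = 1" "is_positive y" "norm y \<le> 1"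
    "is_positive (1 - y)" "\<And>c. c * k = k * c \<Longrightarrow> c * y = y * c"
proof -
  obtain R where R: "norm (R *\<^sub>R 1 - k) \<le> R" using k by (auto simp: is_positive_def)
  have R0: "R \<ge> 0" using R norm_ge_zero order_trans by blast
  define x where "x = (1 / (R + 1)) *\<^sub>R (1 + k)"
  have "(R + 1) *\<^sub>R (1 - x) = R *\<^sub>R 1 - k" using R0 by (simp add: x_def algebra_simps)
  then have "(R + 1) * norm (1 - x) \<le> R"
    using R R0 by (metis norm_scaleR abs_of_nonneg add_nonneg_nonneg zero_le_one)
  then have "(R + 1) * norm (1 - x) < (R + 1) * 1" by simp
  then have "norm (1 - x) < 1" using R0 by (simp only: mult_less_cancel_left_pos)
  then obtain z where z: "x * z = 1" "z * x = 1" using inverse_of_norm_less by blast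
  define y where "y = (1 / (R + 1)) *\<^sub>R z"
  have y: "(1 + k) * y = 1" "y * (1 + k) = 1" using z by (simp_all add: y_def x_def)
  have comm: "c * y = y * c" if "c * k = k * c" for c
  proof -
    have "c * y = y * (1 + k) * c * y" using y by simp
    also have "\<dots> = y * ((1 + k) * c) * y" by (simp only: mult.assoc)
    also have "(1 + k) * c = c * (1 + k)" using that by (simp add: algebra_simps)
    also have "y * (c * (1 + k)) * y = y * c * ((1 + k) * y)" by (simp only: mult.assoc)
    finally show ?thesis by (simp only: y mult_1_right)
  qed
  have sk: "star k = k" using k by (rule positive_selfadjoint)
  have "star y * (1 + k) = 1"
    using arg_cong[OF y(1), of star] by (simp add: sk star_add star_mult)
  then have "star y * (1 + k) * y = y" by simp
  then have sy: "star y = y" by (simp only: mult.assoc y mult_1_right)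
  have yk: "k * y = y * k" using comm[of k] by simp
  obtain q where q: "is_positive q" "q * q = k" "\<And>c. c * k = k * c \<Longrightarrow> c * q = q * c"
    using positive_sqrt[OF k] by metis
  have yq: "y * q = q * y" using q(3)[of y] yk by simp
  have "y = y * (1 + k) * y" using y by simp
  also have "\<dots> = y * y + y * k * y" by (simp add: algebra_simps)
  also have "y * k * y = y * q * (q * y)" by (simp add: mult.assoc flip: q(2))
  also have "\<dots> = (y * q) * (y * q)" by (simp only: yq)
  finally have "y = y * y + (y * q) * (y * q)" .
  moreover have "is_positive (y * y)" by (rule positive_square) fact
  moreover have "is_positive ((y * q) * (y * q))"
    by (rule positive_square) (simp add: star_mult sy yq positive_selfadjoint[OF q(1)])
  ultimately have py: "is_positive y" using positive_add by fastforce
  have "1 - y = k * y" using y by (simp add: algebra_simps)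
  then have p1y: "is_positive (1 - y)" using positive_mult[OF k py] yk by simp
  then have "norm y \<le> 1" using norm_le_of_positive[OF py, of 1] by simp
  with y py p1y comm show thesis using that by blast
qed

text \<open>
  With \<open>k = - star c * c\<close> and \<open>d = c * star c\<close>, the element \<open>d\<close> is positive because
  \<open>star c * c + c * star c\<close> is a sum of squares. The resolvents of \<open>k\<close> and \<open>d\<close> determine
  each other, so \<open>p = d / (1 - d / \<rho>)\<close> exists for \<open>\<rho> = norm d\<close> and has norm at most
  \<open>\<rho>\<close>. Then \<open>(1 - d / \<rho>) (\<rho> - p) = \<rho> - 2 d\<close> is positive, so that \<open>norm d \<le> \<rho> / 2\<close>.
\<close>

lemma star_mult_self_not_negative:
  fixes c :: "'a::unital_cstar_algebra"
  assumes neg: "is_positive (- (star c * c))" shows "c = 0"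
proof (rule ccontr)
  assume c0: "c \<noteq> 0"
  define k where "k = - (star c * c)"
  define d where "d = c * star c"
  define \<rho> where "\<rho> = (norm c)\<^sup>2"
  have k: "is_positive k" using neg by (simp add: k_def)
  have \<rho>: "\<rho> > 0" using c0 by (simp add: \<rho>_def)
  define x where "x = (1/2) *\<^sub>R (c + star c)"
  define y where "y = (1/2) *\<^sub>R (\<i> *\<^sub>C (star c - c))"
  have sx: "star x = x" by (simp add: x_def star_scaleR star_add star_star add.commute)
  have sy: "star y = y"
    by (simp add: y_def star_scaleR star_scaleC star_diff star_star scaleC_minus_left scaleC_diff_right)
  have "4 *\<^sub>R (x * x) = (c + star c) * (c + star c)"
    by (simp add: x_def)
  moreover have "4 *\<^sub>R (y * y) = - ((star c - c) * (star c - c))"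
    by (simp add: y_def mult_scaleC_left mult_scaleC_right scaleC_scaleC scaleC_minus_one scaleC_scaleR)
  ultimately have "4 *\<^sub>R (x * x + y * y) = 2 *\<^sub>R (d - k)"
    by (simp add: scaleR_add_right d_def k_def algebra_simps scaleR_2)
  then have "(1/2) *\<^sub>R (4 *\<^sub>R (x * x + y * y)) = (1/2) *\<^sub>R (2 *\<^sub>R (d - k))" by simp
  then have "d = 2 *\<^sub>R (x * x + y * y) + k" by simp
  then have d: "is_positive d"
    using positive_add[OF positive_scaleR[OF positive_add[OF positive_square[OF sx] positive_square[OF sy]], of 2] k]
    by simp
  have nd: "norm d = \<rho>" using cstar_identity[of "star c"] by (simp add: d_def \<rho>_def star_star)
  have "is_positive ((1/\<rho>) *\<^sub>R k)" using positive_scaleR[OF k] \<rho> by simp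
  then obtain v where v: "(1 + (1/\<rho>) *\<^sub>R k) * v = 1" "v * (1 + (1/\<rho>) *\<^sub>R k) = 1" "is_positive v" "norm v \<le> 1"
    by (rule inverse_one_plus_positive)
  define p where "p = c * v * star c"
  have sp: "star p = p" by (simp add: p_def star_mult star_star positive_selfadjoint[OF v(3)] mult.assoc)
  have "norm p \<le> norm c * norm v * norm c"
    unfolding p_def by (metis norm_star norm_mult_ineq mult_right_mono norm_ge_zero order_trans)
  also have "\<dots> \<le> norm c * 1 * norm c"
    using v(4) by (intro mult_right_mono mult_left_mono) auto
  finally have "norm p \<le> \<rho>" by (simp add: \<rho>_def power2_eq_square)
  then have pp: "is_positive (\<rho> *\<^sub>R 1 - p)" using sp by (rule positive_diff_of_norm_le[rotated])
  have pd: "is_positive (1 - (1/\<rho>) *\<^sub>R d)"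
    using positive_diff_of_norm_le[of "(1/\<rho>) *\<^sub>R d" 1] \<rho> nd positive_selfadjoint[OF d]
    by (simp add: star_scaleR)
  have vk: "(1/\<rho>) *\<^sub>R (k * v) = 1 - v" "(1/\<rho>) *\<^sub>R (v * k) = 1 - v"
    using v by (simp_all add: algebra_simps)
  have kv: "star c * c = - k" by (simp add: k_def)
  have "(1/\<rho>) *\<^sub>R (d * p) = - (c * ((1/\<rho>) *\<^sub>R (k * v)) * star c)"
    by (simp add: d_def p_def k_def mult.assoc)
  then have dp: "(1/\<rho>) *\<^sub>R (d * p) = p - d" by (simp add: vk algebra_simps p_def d_def)
  have "(1/\<rho>) *\<^sub>R (p * d) = - (c * ((1/\<rho>) *\<^sub>R (v * k)) * star c)"
    by (simp add: d_def p_def k_def mult.assoc)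
  then have pd': "(1/\<rho>) *\<^sub>R (p * d) = p - d" by (simp add: vk algebra_simps p_def d_def)
  have e1: "(1 - (1/\<rho>) *\<^sub>R d) * (\<rho> *\<^sub>R 1 - p) = \<rho> *\<^sub>R 1 - 2 *\<^sub>R d"
    using dp \<rho> by (simp add: algebra_simps scaleR_2)
  have e2: "(\<rho> *\<^sub>R 1 - p) * (1 - (1/\<rho>) *\<^sub>R d) = \<rho> *\<^sub>R 1 - 2 *\<^sub>R d"
    using pd' \<rho> by (simp add: algebra_simps scaleR_2)
  have "is_positive (\<rho> *\<^sub>R 1 - 2 *\<^sub>R d)"
    using positive_mult[OF pd pp] e1 e2 by simp
  then have "norm (2 *\<^sub>R d) \<le> \<rho>"
    using norm_le_of_positive[OF positive_scaleR[OF d, of 2]] by simp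
  then show False using nd \<rho> by simp
qed

lemma abs_exists:
  fixes x :: "'a::unital_cstar_algebra"
  assumes "star x = x"
  obtains k where "is_positive k" "k * k = x * x" "\<And>c. c * x = x * c \<Longrightarrow> c * k = k * c"
proof -
  obtain k where k: "is_positive k" "k * k = x * x" "\<And>c. c * (x * x) = x * x * c \<Longrightarrow> c * k = k * c"
    using positive_sqrt[OF positive_square[OF assms]] by metis
  have "c * k = k * c" if "c * x = x * c" for c
    by (rule k(3)) (rule commute_mult[OF that that])
  with k that show thesis by blast
qed

text \<open>
  Let \<open>h = star a * a\<close>, let \<open>k\<close> be its absolute value, and let \<open>n = k - h\<close>, twice the
  negative part of \<open>h\<close>. Then \<open>star (a * n) * (a * n) = - k * n\<^sup>2\<close> is negative.
\<close>

theorem positive_star_mult_self: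
  fixes a :: "'a::unital_cstar_algebra"
  shows "is_positive (star a * a)"
proof -
  define h where "h = star a * a"
  have sh: "star h = h" by (simp add: h_def star_mult star_star)
  obtain k where k: "is_positive k" "k * k = h * h" "\<And>c. c * h = h * c \<Longrightarrow> c * k = k * c"
    using abs_exists[OF sh] by metis
  have hk: "h * k = k * h" using k(3) by simp
  define n where "n = k - h"
  have sn: "star n = n" by (simp add: n_def star_diff sh positive_selfadjoint[OF k(1)])
  obtain y where y: "is_positive y" "y * y = k" "\<And>c. c * k = k * c \<Longrightarrow> c * y = y * c"
    using positive_sqrt[OF k(1)] by metis
  have yn: "n * y = y * n" using y(3)[of n] hk by (simp add: n_def algebra_simps)
  have kn: "n * k = k * n" using hk by (simp add: n_def algebra_simps)
  have hn: "h * n = - (k * n)" using k(2) hk by (simp add: n_def algebra_simps)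
  have "star (a * n) * (a * n) = n * (h * n)" by (simp add: star_mult sn h_def mult.assoc)
  also have "\<dots> = - (n * k * n)" by (simp add: hn mult.assoc)
  also have "n * k * n = n * y * (y * n)" by (simp add: mult.assoc flip: y(2))
  also have "\<dots> = (y * n) * (y * n)" by (simp only: yn)
  finally have e: "star (a * n) * (a * n) = - ((y * n) * (y * n))" .
  have syn: "star (y * n) = y * n" by (simp add: star_mult sn yn positive_selfadjoint[OF y(1)])
  have "a * n = 0"
    using positive_square[OF syn] e by (intro star_mult_self_not_negative) simp
  then have "star (y * n) * (y * n) = 0" using e syn by simp
  then have yn0: "y * n = 0" by (simp only: star_mult_self_eq_0)
  then have "y * (y * n) = 0" by simp
  then have "k * n = 0" by (simp add: mult.assoc flip: y(2))
  moreover have "n * n = n * k - n * h" by (simp add: n_def algebra_simps)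
  moreover have "n * h = h * n" using hk by (simp add: n_def algebra_simps)
  ultimately have "star n * n = 0" by (simp add: sn hn kn)
  then have "n = 0" by (simp only: star_mult_self_eq_0)
  then show ?thesis using k(1) by (simp add: n_def h_def)
qed

text \<open>
  For commuting \<open>c\<close> and \<open>k\<close> with \<open>k \<ge> 0\<close>, the equation says that \<open>c\<close> is \<open>k\<close> on the
  support of \<open>c\<close>.
\<close>

lemma positive_of_mult_eq_square:
  fixes c k :: "'a::unital_cstar_algebra"
  assumes c: "star c = c" and k: "is_positive k" and ck: "c * k = k * c" and kc: "k * c = c * c"
  shows "is_positive c"
proof -
  obtain m where m: "is_positive m" "m * m = c * c" "\<And>z. z * c = c * z \<Longrightarrow> z * m = m * z"
    using abs_exists[OF c] by metis
  have mc: "c * m = m * c" and mk: "k * m = m * k" using m(3) ck by simp_all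
  define n where "n = m - c"
  have sn: "star n = n" by (simp add: n_def star_diff c positive_selfadjoint[OF m(1)])
  have nm: "n * m = m * n" using mc by (simp add: n_def algebra_simps)
  have nk: "n * k = k * n" using mk ck by (simp add: n_def algebra_simps)
  have cn: "c * n = - (m * n)" using m(2) mc by (simp add: n_def algebra_simps)
  have "k * (c * n) = c * (c * n)" using kc by (simp add: mult.assoc[symmetric])
  then have "k * m * n = c * (m * n)" by (simp add: cn mult.assoc)
  also have "\<dots> = m * (c * n)" using mc by (simp add: mult.assoc[symmetric])
  also have "\<dots> = - (m * m * n)" by (simp add: cn mult.assoc)
  finally have 0: "m * m * n + k * m * n = 0" by simp
  have e: "n * (m * m * n) + n * (k * m * n) = 0"
    using 0 by (simp add: distrib_left[symmetric])
  have p1: "n * (m * m * n) = star (m * n) * (m * n)"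
    by (simp add: star_mult sn positive_selfadjoint[OF m(1)] mult.assoc)
  have p1': "is_positive (n * (m * m * n))" unfolding p1 by (rule positive_star_mult_self)
  have km: "is_positive (k * m)" by (rule positive_mult[OF k m(1) mk])
  have nkm: "n * (k * m) = k * m * n" by (rule commute_mult) (rule nk nm)+
  then have "(k * m) * n = n * (k * m)" by simp
  then have "(k * m) * (n * n) = (n * n) * (k * m)" by (intro commute_mult)
  then have "is_positive ((k * m) * (n * n))"
    by (intro positive_mult km positive_square sn)
  moreover have "(k * m) * (n * n) = n * (k * m * n)"
    using nkm by (simp add: mult.assoc[symmetric])
  ultimately have "n * (m * m * n) = 0"
    using p1' e by (intro positive_antisym) (auto simp: add_eq_0_iff)
  then have "m * n = 0" using p1 by (metis star_mult_self_eq_0)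
  moreover have "star n * n = 2 *\<^sub>R (m * n)"
    unfolding sn scaleR_2 by (simp add: n_def algebra_simps mc m(2))
  ultimately have "n = 0" by (metis star_mult_self_eq_0 scaleR_zero_right)
  then show ?thesis using m(1) by (simp add: n_def)
qed

lemma positive_part:
  fixes x :: "'a::unital_cstar_algebra"
  assumes x: "star x = x"
  obtains c where "is_positive c" "c * x = c * c" "is_positive (c - x)" "x * c = c * x"
proof -
  obtain k where k: "is_positive k" "k * k = x * x" "\<And>z. z * x = x * z \<Longrightarrow> z * k = k * z"
    using abs_exists[OF x] by metis
  have xk: "x * k = k * x" using k(3) by simp
  have P: "is_positive ((1/2) *\<^sub>R (k + z))" if z: "star z = z" "z * z = x * x" "z * k = k * z" for z
  proof (rule positive_of_mult_eq_square[OF _ k(1)])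
    have "(k + z) * (k + z) = 2 *\<^sub>R (k * (k + z))"
      using z(3) by (simp add: distrib_left distrib_right scaleR_2 z(2) flip: k(2))
    then show "k * ((1/2) *\<^sub>R (k + z)) = ((1/2) *\<^sub>R (k + z)) * ((1/2) *\<^sub>R (k + z))" by simp
  qed (use z positive_selfadjoint[OF k(1)] in \<open>simp_all add: star_scaleR star_add algebra_simps\<close>)
  define c where "c = (1/2) *\<^sub>R (k + x)"
  have "is_positive c" unfolding c_def using P[of x] x xk by simp
  moreover have "4 *\<^sub>R (c * x) = 4 *\<^sub>R (c * c)"
    using xk k(2) by (simp add: c_def algebra_simps scaleR_2)
  then have "c * x = c * c" by simp
  moreover have "c - x = (1/2) *\<^sub>R (k + - x)"
  proof -
    have "c + c = k + x" by (simp add: c_def flip: scaleR_2)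
    then have "2 *\<^sub>R (c - x) = k + - x" by (simp add: scaleR_2 algebra_simps)
    then have "(1/2) *\<^sub>R (2 *\<^sub>R (c - x)) = (1/2) *\<^sub>R (k + - x)" by (rule arg_cong)
    then show ?thesis by simp
  qed
  then have "is_positive (c - x)" using P[of "- x"] x xk by (simp add: star_minus)
  moreover have "x * c = c * x" using xk by (simp add: c_def algebra_simps)
  ultimately show thesis using that by blast
qed


section \<open>Adjoining a unit\<close>

datatype 'a unitization = Adjoin (alg_part: 'a) (scalar_part: complex)

lemma unitization_eq_iff: "x = y \<longleftrightarrow> alg_part x = alg_part y \<and> scalar_part x = scalar_part y"
  by (cases x; cases y) auto

instantiation unitization :: (cstar_algebra) real_algebra_1
begin

definition "0 = Adjoin 0 0"
definition "1 = Adjoin 0 1"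
definition "x + y = Adjoin (alg_part x + alg_part y) (scalar_part x + scalar_part y)"
definition "x - y = Adjoin (alg_part x - alg_part y) (scalar_part x - scalar_part y)"
definition "- x = Adjoin (- alg_part x) (- scalar_part x)"
definition "r *\<^sub>R x = Adjoin (r *\<^sub>R alg_part x) (r *\<^sub>R scalar_part x)"
definition "x * y = Adjoin
  (alg_part x * alg_part y + scalar_part x *\<^sub>C alg_part y + scalar_part y *\<^sub>C alg_part x)
  (scalar_part x * scalar_part y)"

instance
  by intro_classes
    (simp_all add: unitization_eq_iff zero_unitization_def one_unitization_def
      plus_unitization_def minus_unitization_def uminus_unitization_def
      scaleR_unitization_def times_unitization_def algebra_simps
      scaleC_add_left scaleC_add_right scaleC_scaleC mult_scaleC_left mult_scaleC_right
      scaleC_scaleR scaleC_of_real[symmetric] scaleR_conv_of_real)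

end

lemma alg_part_simps [simp]:
  "alg_part 0 = 0" "alg_part 1 = 0" "alg_part (x + y) = alg_part x + alg_part y"
  "alg_part (x - y) = alg_part x - alg_part y" "alg_part (- x) = - alg_part x"
  "alg_part (r *\<^sub>R x) = r *\<^sub>R alg_part x"
  "alg_part (x * y) =
    alg_part x * alg_part y + scalar_part x *\<^sub>C alg_part y + scalar_part y *\<^sub>C alg_part x"
  by (simp_all add: zero_unitization_def one_unitization_def plus_unitization_def
      minus_unitization_def uminus_unitization_def scaleR_unitization_def times_unitization_def)

lemma scalar_part_simps [simp]:
  "scalar_part 0 = 0" "scalar_part 1 = 1" "scalar_part (x + y) = scalar_part x + scalar_part y"
  "scalar_part (x - y) = scalar_part x - scalar_part y" "scalar_part (- x) = - scalar_part x"
  "scalar_part (r *\<^sub>R x) = r *\<^sub>R scalar_part x"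
  "scalar_part (x * y) = scalar_part x * scalar_part y"
  by (simp_all add: zero_unitization_def one_unitization_def plus_unitization_def
      minus_unitization_def uminus_unitization_def scaleR_unitization_def times_unitization_def)

text \<open>
  The multiplication operator alone gives only a seminorm when the algebra already has a
  unit; the scalar part repairs this.
\<close>

definition left_mult :: "'a::cstar_algebra unitization \<Rightarrow> 'a \<Rightarrow> 'a" where
  "left_mult x b = alg_part x * b + scalar_part x *\<^sub>C b"

lemma bounded_linear_scaleC: "bounded_linear (\<lambda>x. c *\<^sub>C (x::'a::cstar_algebra))"
  by (rule bounded_linear_intro[where K = "cmod c"])
    (simp_all add: scaleC_add_right scaleC_scaleR norm_scaleC mult.commute)

lemma bounded_linear_left_mult: "bounded_linear (left_mult x)"
  unfolding left_mult_def
  by (intro bounded_linear_add bounded_linear_mult_right bounded_linear_scaleC)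

lemma left_mult_mult: "left_mult (x * y) b = left_mult x (left_mult y b)"
  by (simp add: left_mult_def algebra_simps scaleC_add_right scaleC_scaleC mult_scaleC_left
      mult_scaleC_right)

lemma left_mult_add: "left_mult (x + y) b = left_mult x b + left_mult y b"
  by (simp add: left_mult_def algebra_simps scaleC_add_left)

lemma scaleR_scaleC: "(r *\<^sub>R c) *\<^sub>C x = r *\<^sub>R (c *\<^sub>C (x::'a::cstar_algebra))"
  by (simp add: scaleC_of_real[symmetric] scaleC_scaleC scaleR_conv_of_real)

lemma left_mult_scaleR: "left_mult (r *\<^sub>R x) b = r *\<^sub>R left_mult x b"
  by (simp add: left_mult_def scaleR_scaleC scaleR_add_right)

lemma left_mult_zero: "left_mult 0 b = 0"
  by (simp add: left_mult_def)

lemma left_mult_one: "left_mult 1 b = b"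
  by (simp add: left_mult_def)

lemma norm_left_mult_le: "norm (left_mult x b) \<le> onorm (left_mult x) * norm b"
  by (rule onorm[OF bounded_linear_left_mult])

instantiation unitization :: (cstar_algebra) real_normed_algebra_1
begin

definition norm_unitization :: "'a unitization \<Rightarrow> real" where
  "norm_unitization x = max (onorm (left_mult x)) (cmod (scalar_part x))"
definition dist_unitization :: "'a unitization \<Rightarrow> 'a unitization \<Rightarrow> real" where
  "dist_unitization x y = norm (x - y)"
definition sgn_unitization :: "'a unitization \<Rightarrow> 'a unitization" where
  "sgn_unitization x = x /\<^sub>R norm x"
definition uniformity_unitization :: "('a unitization \<times> 'a unitization) filter" where
  "uniformity_unitization = (INF e\<in>{0 <..}. principal {(x, y). dist x y < e})"
definition open_unitization :: "'a unitization set \<Rightarrow> bool" where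
  "open_unitization U \<longleftrightarrow> (\<forall>x\<in>U. \<forall>\<^sub>F (x', y) in uniformity. x' = x \<longrightarrow> y \<in> U)"

instance
proof
  fix x y :: "'a unitization" and r :: real
  show "dist x y = norm (x - y)" by (rule dist_unitization_def)
  show "sgn x = x /\<^sub>R norm x" by (rule sgn_unitization_def)
  show "uniformity = (INF e\<in>{0 <..}. principal {(x, y::'a unitization). dist x y < e})"
    by (rule uniformity_unitization_def)
  show "open U \<longleftrightarrow> (\<forall>x\<in>U. \<forall>\<^sub>F (x', y) in uniformity. x' = x \<longrightarrow> y \<in> U)"
    for U :: "'a unitization set"
    by (rule open_unitization_def)
  show "norm x = 0 \<longleftrightarrow> x = 0"
  proof
    assume "norm x = 0"
    moreover have "onorm (left_mult x) \<ge> 0" by (rule onorm_pos_le[OF bounded_linear_left_mult])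
    ultimately have l: "onorm (left_mult x) = 0" and s: "scalar_part x = 0"
      unfolding norm_unitization_def by (smt (verit) norm_ge_zero norm_eq_zero)+
    have "alg_part x * star (alg_part x) = 0"
      using norm_left_mult_le[of x "star (alg_part x)"] l s by (simp add: left_mult_def)
    then have "star (alg_part x) = 0"
      using star_mult_self_eq_0[of "star (alg_part x)"] by (simp add: star_star)
    then have "alg_part x = 0" by (metis star_star star_zero)
    with s show "x = 0" by (simp add: unitization_eq_iff)
  next
    assume "x = 0"
    then have "left_mult x = (\<lambda>_. 0)" by (simp add: fun_eq_iff left_mult_zero)
    then show "norm x = 0" using \<open>x = 0\<close> by (simp add: norm_unitization_def onorm_zero)
  qed
  have "onorm (left_mult (x + y)) \<le> onorm (left_mult x) + onorm (left_mult y)"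
    using onorm_triangle[OF bounded_linear_left_mult bounded_linear_left_mult]
    by (metis (no_types, lifting) ext left_mult_add)
  then show "norm (x + y) \<le> norm x + norm y"
    using norm_triangle_ineq[of "scalar_part x" "scalar_part y"]
    unfolding norm_unitization_def by (auto simp: max_def)
  have "left_mult (r *\<^sub>R x) = (\<lambda>b. r *\<^sub>R left_mult x b)"
    by (simp add: fun_eq_iff left_mult_scaleR)
  then have "onorm (left_mult (r *\<^sub>R x)) = \<bar>r\<bar> * onorm (left_mult x)"
    using onorm_scaleR[OF bounded_linear_left_mult, of r x] by simp
  then show "norm (r *\<^sub>R x) = \<bar>r\<bar> * norm x"
    unfolding norm_unitization_def by (simp add: max_mult_distrib_left)
  have "left_mult (x * y) = left_mult x \<circ> left_mult y"
    by (simp add: fun_eq_iff left_mult_mult)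
  then have "onorm (left_mult (x * y)) \<le> onorm (left_mult x) * onorm (left_mult y)"
    using onorm_compose[OF bounded_linear_left_mult bounded_linear_left_mult] by metis
  also have "\<dots> \<le> norm x * norm y"
    unfolding norm_unitization_def
    by (intro mult_mono) (auto simp: onorm_pos_le[OF bounded_linear_left_mult] max_def)
  finally have "onorm (left_mult (x * y)) \<le> norm x * norm y" .
  moreover have "cmod (scalar_part (x * y)) \<le> norm x * norm y"
    unfolding norm_unitization_def scalar_part_simps norm_mult
    by (intro mult_mono) (auto simp: le_max_iff_disj)
  ultimately show "norm (x * y) \<le> norm x * norm y"
    by (subst norm_unitization_def) simp
  have "left_mult (1 :: 'a unitization) = (\<lambda>b. b)" by (simp add: fun_eq_iff left_mult_one)
  then show "norm (1 :: 'a unitization) = 1"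
    using onorm_id_le[where 'a = 'a] by (simp add: norm_unitization_def max_def)
qed

end

definition of_alg :: "'a::cstar_algebra \<Rightarrow> 'a unitization" where
  "of_alg a = Adjoin a 0"

lemma alg_part_of_alg [simp]: "alg_part (of_alg a) = a"
  and scalar_part_of_alg [simp]: "scalar_part (of_alg a) = 0"
  by (simp_all add: of_alg_def)

lemma of_alg_part: "scalar_part x = 0 \<Longrightarrow> of_alg (alg_part x) = x"
  by (simp add: unitization_eq_iff)

lemma of_alg_simps:
  "of_alg 0 = 0" "of_alg (a + b) = of_alg a + of_alg b" "of_alg (a - b) = of_alg a - of_alg b"
  "of_alg (- a) = - of_alg a" "of_alg (a * b) = of_alg a * of_alg b"
  "of_alg (r *\<^sub>R a) = r *\<^sub>R of_alg a"
  by (simp_all add: unitization_eq_iff)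

lemma of_alg_eq_0_iff [simp]: "of_alg a = 0 \<longleftrightarrow> a = 0"
  by (simp add: unitization_eq_iff)

lemma norm_of_alg [simp]: "norm (of_alg a) = norm a"
proof -
  have b: "bounded_linear (left_mult (of_alg a))" by (rule bounded_linear_left_mult)
  have "onorm (left_mult (of_alg a)) \<le> norm a"
    by (rule onorm_bound) (simp_all add: left_mult_def norm_mult_ineq)
  moreover have "norm a \<le> onorm (left_mult (of_alg a))"
  proof (cases "a = 0")
    case False
    have "(norm a)\<^sup>2 \<le> onorm (left_mult (of_alg a)) * norm a"
      using norm_left_mult_le[of "of_alg a" "star a"] cstar_identity[of "star a"]
      by (simp add: left_mult_def star_star)
    then show ?thesis using False by (simp add: power2_eq_square)
  qed (use onorm_pos_le[OF b] in auto)
  ultimately show ?thesis by (simp add: norm_unitization_def)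
qed

lemma norm_scalar_part_le: "cmod (scalar_part x) \<le> norm x"
  by (simp add: norm_unitization_def)

lemma norm_le_parts: "norm x \<le> norm (alg_part x) + cmod (scalar_part x)"
proof -
  have "onorm (left_mult x) \<le> norm (alg_part x) + cmod (scalar_part x)"
  proof (rule onorm_bound)
    fix b
    show "norm (left_mult x b) \<le> (norm (alg_part x) + cmod (scalar_part x)) * norm b"
      using norm_triangle_ineq[of "alg_part x * b" "scalar_part x *\<^sub>C b"]
        norm_mult_ineq[of "alg_part x" b]
      by (simp add: left_mult_def norm_scaleC distrib_right)
  qed simp
  then show ?thesis by (simp add: norm_unitization_def)
qed

text \<open>
  Together with \<open>norm_scalar_part_le\<close> and \<open>norm_le_parts\<close> this shows that the norm is equivalent
  to the sum of the norms of the parts, from which completeness follows.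
\<close>

lemma norm_alg_part_le: "norm (alg_part x) \<le> 2 * norm x"
proof -
  have "of_alg (alg_part x) = x - Adjoin 0 (scalar_part x)" by (simp add: unitization_eq_iff)
  then have "norm (alg_part x) \<le> norm x + norm (Adjoin 0 (scalar_part x) :: 'a unitization)"
    by (metis norm_of_alg norm_triangle_ineq4)
  also have "norm (Adjoin 0 (scalar_part x) :: 'a unitization) \<le> norm x"
    using norm_le_parts[of "Adjoin 0 (scalar_part x) :: 'a unitization"] norm_scalar_part_le[of x]
    by simp
  finally show ?thesis by simp
qed

instance unitization :: (cstar_algebra) banach
proof
  fix X :: "nat \<Rightarrow> 'a unitization"
  assume C: "Cauchy X"
  have "Cauchy (\<lambda>n. scalar_part (X n))"
    unfolding Cauchy_def
  proof (intro allI impI)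
    fix e :: real assume "e > 0"
    then obtain M where "\<forall>m\<ge>M. \<forall>n\<ge>M. dist (X m) (X n) < e" using metric_CauchyD[OF C] by blast
    then show "\<exists>M. \<forall>m\<ge>M. \<forall>n\<ge>M. dist (scalar_part (X m)) (scalar_part (X n)) < e"
      unfolding dist_norm by (metis norm_scalar_part_le scalar_part_simps(4) order_le_less_trans)
  qed
  then obtain s where s: "(\<lambda>n. scalar_part (X n)) \<longlonglongrightarrow> s"
    using Cauchy_convergent_iff convergent_def by blast
  have "Cauchy (\<lambda>n. alg_part (X n))"
    unfolding Cauchy_def
  proof (intro allI impI)
    fix e :: real assume "e > 0"
    then obtain M where M: "\<forall>m\<ge>M. \<forall>n\<ge>M. dist (X m) (X n) < e / 2"
      using metric_CauchyD[OF C, of "e/2"] by auto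
    have "dist (alg_part (X m)) (alg_part (X n)) < e" if "m \<ge> M" "n \<ge> M" for m n
    proof -
      have "norm (X m - X n) < e / 2" using M that by (simp add: dist_norm)
      then show ?thesis using norm_alg_part_le[of "X m - X n"] by (simp add: dist_norm)
    qed
    then show "\<exists>M. \<forall>m\<ge>M. \<forall>n\<ge>M. dist (alg_part (X m)) (alg_part (X n)) < e" by blast
  qed
  then obtain a where a: "(\<lambda>n. alg_part (X n)) \<longlonglongrightarrow> a"
    using Cauchy_convergent_iff convergent_def by blast
  have "(\<lambda>n. norm (alg_part (X n) - a) + cmod (scalar_part (X n) - s)) \<longlonglongrightarrow> 0"
    using tendsto_add[OF tendsto_norm[OF LIM_zero[OF a]] tendsto_norm[OF LIM_zero[OF s]]] by simp
  then have "(\<lambda>n. X n - Adjoin a s) \<longlonglongrightarrow> 0"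
    by (rule Lim_null_comparison[rotated])
      (auto intro!: always_eventually order_trans[OF norm_le_parts])
  then show "convergent X" unfolding convergent_def using LIM_zero_iff by blast
qed

instantiation unitization :: (cstar_algebra) cstar_algebra
begin

definition scaleC_unitization :: "complex \<Rightarrow> 'a unitization \<Rightarrow> 'a unitization" where
  "scaleC_unitization c x = Adjoin (c *\<^sub>C alg_part x) (c * scalar_part x)"
definition star_unitization :: "'a unitization \<Rightarrow> 'a unitization" where
  "star_unitization x = Adjoin (star (alg_part x)) (cnj (scalar_part x))"

instance
proof
  fix r :: real and c d :: complex and x y :: "'a unitization"
  note ds = scaleC_unitization_def star_unitization_def unitization_eq_iff
  note cs = scaleC_add_left scaleC_add_right scaleC_scaleC mult_scaleC_left mult_scaleC_right
    algebra_simps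
  show "complex_of_real r *\<^sub>C x = r *\<^sub>R x"
    by (simp add: ds scaleC_of_real scaleR_conv_of_real[where 'a = complex])
  show "c *\<^sub>C (x + y) = c *\<^sub>C x + c *\<^sub>C y" by (simp add: ds cs)
  show "(c + d) *\<^sub>C x = c *\<^sub>C x + d *\<^sub>C x" by (simp add: ds cs)
  show "c *\<^sub>C d *\<^sub>C x = (c * d) *\<^sub>C x" by (simp add: ds cs)
  show "c *\<^sub>C x * y = c *\<^sub>C (x * y)" by (simp add: ds cs)
  show "x * c *\<^sub>C y = c *\<^sub>C (x * y)" by (simp add: ds cs)
  show "star (star x) = x" by (simp add: ds star_star)
  show "star (x + y) = star x + star y" by (simp add: ds star_add)
  show "star (c *\<^sub>C x) = cnj c *\<^sub>C star x" by (simp add: ds star_scaleC)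
  show "star (x * y) = star y * star x"
    by (simp add: ds cs star_mult star_add star_scaleC)
  have "left_mult (c *\<^sub>C x) = (\<lambda>b. c *\<^sub>C left_mult x b)"
    by (simp add: fun_eq_iff left_mult_def ds cs)
  moreover have "onorm (\<lambda>b. c *\<^sub>C left_mult x b) = cmod c * onorm (left_mult x)"
    unfolding onorm_def norm_scaleC
    using onorm_scaleR[OF bounded_linear_left_mult, of "cmod c" x] by (simp add: onorm_def)
  ultimately show "norm (c *\<^sub>C x) = cmod c * norm x"
    by (simp add: norm_unitization_def max_mult_distrib_left norm_mult scaleC_unitization_def)
  have sq: "(onorm (left_mult z))\<^sup>2 \<le> onorm (left_mult (star z * z))" for z :: "'a unitization"
  proof -
    have "norm (left_mult z b) \<le> sqrt (onorm (left_mult (star z * z))) * norm b" for b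
    proof -
      have "star (left_mult z b) * left_mult z b = star b * left_mult (star z * z) b"
        by (simp add: left_mult_def star_unitization_def cs star_add star_mult star_scaleC)
      then have "(norm (left_mult z b))\<^sup>2 \<le> norm b * (onorm (left_mult (star z * z)) * norm b)"
        using norm_mult_ineq[of "star b" "left_mult (star z * z) b"]
          mult_left_mono[OF norm_left_mult_le[of "star z * z" b], of "norm b"]
        by (simp add: cstar_identity[symmetric])
      then have "norm (left_mult z b) \<le> sqrt (onorm (left_mult (star z * z)) * (norm b)\<^sup>2)"
        by (intro real_le_rsqrt) (simp add: power2_eq_square algebra_simps)
      then show ?thesis by (simp add: real_sqrt_mult)
    qed
    then have "onorm (left_mult z) \<le> sqrt (onorm (left_mult (star z * z)))"
      by (intro onorm_bound real_sqrt_ge_zero onorm_pos_le[OF bounded_linear_left_mult])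
    then have "(onorm (left_mult z))\<^sup>2 \<le> (sqrt (onorm (left_mult (star z * z))))\<^sup>2"
      by (rule power_mono) (rule onorm_pos_le[OF bounded_linear_left_mult])
    then show ?thesis by (simp add: onorm_pos_le[OF bounded_linear_left_mult])
  qed
  have sub: "onorm (left_mult (u * v)) \<le> onorm (left_mult u) * onorm (left_mult v)"
    for u v :: "'a unitization"
  proof -
    have "left_mult (u * v) = left_mult u \<circ> left_mult v"
      by (simp add: fun_eq_iff left_mult_mult)
    then show ?thesis
      using onorm_compose[OF bounded_linear_left_mult bounded_linear_left_mult] by metis
  qed
  have ge: "onorm (left_mult z) \<ge> 0" for z :: "'a unitization"
    by (rule onorm_pos_le[OF bounded_linear_left_mult])
  have le: "onorm (left_mult z) \<le> onorm (left_mult (star z))" for z :: "'a unitization"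
  proof (cases "onorm (left_mult z) = 0")
    case False
    have "onorm (left_mult z) * onorm (left_mult z) \<le> onorm (left_mult (star z)) * onorm (left_mult z)"
      using sq[of z] sub[of "star z" z] by (simp add: power2_eq_square)
    then show ?thesis using False ge[of z] by (simp add: mult_le_cancel_right)
  qed (simp add: ge)
  have "star (star x) = x" by (simp add: ds star_star)
  then have "onorm (left_mult (star x)) = onorm (left_mult x)"
    using le[of x] le[of "star x"] by simp
  then have o: "onorm (left_mult (star x * x)) = (onorm (left_mult x))\<^sup>2"
    using sq[of x] sub[of "star x" x] by (simp add: power2_eq_square)
  have s: "cmod (scalar_part (star x * x)) = (cmod (scalar_part x))\<^sup>2"
    by (simp add: star_unitization_def norm_mult power2_eq_square)
  have mx: "max (a\<^sup>2) (b\<^sup>2) = (max a b)\<^sup>2" if "a \<ge> 0" "b \<ge> 0" for a b :: real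
    using power_mono[of a b 2] power_mono[of b a 2] that by (cases "a \<le> b") (simp_all add: max_def)
  show "norm (star x * x) = (norm x)\<^sup>2"
    unfolding norm_unitization_def o s by (rule mx[OF ge norm_ge_zero])
qed

end

instance unitization :: (cstar_algebra) unital_cstar_algebra ..

lemma parts_star_scaleC [simp]:
  "alg_part (star x) = star (alg_part x)" "scalar_part (star x) = cnj (scalar_part x)"
  "alg_part (c *\<^sub>C x) = c *\<^sub>C alg_part x" "scalar_part (c *\<^sub>C x) = c * scalar_part x"
  by (simp_all add: star_unitization_def scaleC_unitization_def)

lemma of_alg_star: "of_alg (star a) = star (of_alg a)"
  and of_alg_scaleC: "of_alg (c *\<^sub>C a) = c *\<^sub>C of_alg a"
  by (simp_all add: unitization_eq_iff)

lemma scalar_part_positive: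
  assumes "is_positive x"
  shows "scalar_part x = complex_of_real (Re (scalar_part x))" "Re (scalar_part x) \<ge> 0"
proof -
  have "star x = x" using assms by (rule positive_selfadjoint)
  then have "cnj (scalar_part x) = scalar_part x" by (metis parts_star_scaleC(2))
  then show "scalar_part x = complex_of_real (Re (scalar_part x))"
    by (metis Reals_cnj_iff of_real_Re)
  obtain R where "norm (R *\<^sub>R 1 - x) \<le> R" using assms by (auto simp: is_positive_def)
  then have "cmod (scalar_part (R *\<^sub>R 1 - x)) \<le> R" by (rule order_trans[OF norm_scalar_part_le])
  then have "cmod (complex_of_real R - scalar_part x) \<le> R"
    by (simp add: scaleR_conv_of_real[where 'a = complex])
  then have "R - Re (scalar_part x) \<le> R"
    using complex_Re_le_cmod[of "complex_of_real R - scalar_part x"] by simp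
  then show "Re (scalar_part x) \<ge> 0" by simp
qed


section \<open>Extreme functionals below a sublinear functional\<close>

definition sublinear :: "('v::real_vector \<Rightarrow> real) \<Rightarrow> bool" where
  "sublinear q \<longleftrightarrow>
     (\<forall>x y. q (x + y) \<le> q x + q y) \<and> (\<forall>x. \<forall>t>0. q (t *\<^sub>R x) \<le> t * q x)"

lemma sublinear_add: "sublinear q \<Longrightarrow> q (x + y) \<le> q x + q y"
  by (simp add: sublinear_def)

lemma sublinear_zero: "sublinear q \<Longrightarrow> q 0 = 0"
proof -
  assume q: "sublinear q"
  have "q (2 *\<^sub>R 0) \<le> 2 * q 0" "q ((1/2) *\<^sub>R 0) \<le> (1/2) * q 0"
    using q unfolding sublinear_def by (meson zero_less_numeral half_gt_zero_iff zero_less_one)+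
  then show ?thesis by simp
qed

lemma sublinear_scale:
  assumes q: "sublinear q" and t: "t \<ge> 0" shows "q (t *\<^sub>R x) = t * q x"
proof (cases "t = 0")
  case False
  then have tp: "t > 0" using t by simp
  have le: "q (s *\<^sub>R y) \<le> s * q y" if "s > 0" for s y using q that by (simp add: sublinear_def)
  have "q ((1/t) *\<^sub>R (t *\<^sub>R x)) \<le> (1/t) * q (t *\<^sub>R x)" by (rule le) (use tp in simp)
  then have "t * q x \<le> q (t *\<^sub>R x)" using tp by (simp add: field_simps)
  then show ?thesis using le[OF tp, of x] by simp
qed (simp add: sublinear_zero[OF q])

lemma sublinear_minus: "sublinear q \<Longrightarrow> - q (- x) \<le> q x"
  using sublinear_add[of q x "- x"] sublinear_zero[of q] by simp

lemma sublinear_INF_chain: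
  assumes ne: "C \<noteq> {}" and sub: "\<And>q. q \<in> C \<Longrightarrow> sublinear q"
    and chain: "\<And>q r. q \<in> C \<Longrightarrow> r \<in> C \<Longrightarrow> q \<le> r \<or> r \<le> q"
    and bdd: "\<And>x. bdd_below ((\<lambda>q. q x) ` C)"
  shows "sublinear (\<lambda>x. INF q\<in>C. q x)"
  unfolding sublinear_def
proof (intro conjI allI impI)
  let ?u = "\<lambda>x. INF q\<in>C. q x"
  have low: "?u x \<le> q x" if "q \<in> C" for q x
    by (rule cINF_lower[OF bdd that])
  fix x y
  have "?u (x + y) \<le> q1 x + q2 y" if q: "q1 \<in> C" "q2 \<in> C" for q1 q2
  proof -
    obtain q where "q \<in> C" "q \<le> q1" "q \<le> q2" using chain[OF q] q by blast
    then show ?thesis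
      using low[of q "x + y"] sublinear_add[OF sub, of q x y] le_funD[of q q1 x] le_funD[of q q2 y]
      by linarith
  qed
  then have "?u (x + y) - q1 x \<le> q2 y" if "q1 \<in> C" "q2 \<in> C" for q1 q2
    using that by (simp add: algebra_simps)
  then have "?u (x + y) - q1 x \<le> ?u y" if "q1 \<in> C" for q1
    using that by (intro cINF_greatest ne)
  then have "?u (x + y) - ?u y \<le> q1 x" if "q1 \<in> C" for q1
    using that by (simp add: algebra_simps)
  then have "?u (x + y) - ?u y \<le> ?u x" by (intro cINF_greatest ne)
  then show "?u (x + y) \<le> ?u x + ?u y" by simp
  fix t :: real assume t: "t > 0"
  have "?u (t *\<^sub>R x) / t \<le> q x" if "q \<in> C" for q
    using low[OF that, of "t *\<^sub>R x"] sublinear_scale[OF sub[OF that], of t x] t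
    by (simp add: field_simps)
  then have "?u (t *\<^sub>R x) / t \<le> ?u x" by (intro cINF_greatest ne)
  then show "?u (t *\<^sub>R x) \<le> t * ?u x" using t by (simp add: field_simps)
qed

text \<open>
  Every linear functional below \<open>sublinear_shift q y\<close> takes the maximal value \<open>q y\<close>
  at \<open>y\<close>.
\<close>

definition sublinear_shift :: "('v::real_vector \<Rightarrow> real) \<Rightarrow> 'v \<Rightarrow> 'v \<Rightarrow> real" where
  "sublinear_shift q y x = (INF t\<in>{0..}. q (x + t *\<^sub>R y) - t * q y)"

lemma sublinear_shift_le:
  assumes q: "sublinear q" and t: "t \<ge> 0"
  shows "sublinear_shift q y x \<le> q (x + t *\<^sub>R y) - t * q y"
  unfolding sublinear_shift_def
proof (rule cINF_lower)
  have "- q (- x) \<le> q (x + s *\<^sub>R y) - s * q y" if "s \<ge> 0" for s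
    using sublinear_add[OF q, of "x + s *\<^sub>R y" "- x"] sublinear_scale[OF q that, of y] by simp
  then show "bdd_below ((\<lambda>t. q (x + t *\<^sub>R y) - t * q y) ` {0..})"
    by (intro bdd_belowI2) auto
qed (use t in simp)

lemma sublinear_shift_greatest:
  "(\<And>t. t \<ge> 0 \<Longrightarrow> m \<le> q (x + t *\<^sub>R y) - t * q y) \<Longrightarrow> m \<le> sublinear_shift q y x"
  unfolding sublinear_shift_def by (intro cINF_greatest) auto

lemma sublinear_sublinear_shift:
  assumes q: "sublinear q" shows "sublinear (sublinear_shift q y)"
  unfolding sublinear_def
proof (intro conjI allI impI)
  let ?s = "sublinear_shift q y"
  fix x z
  have 1: "?s (x + z) \<le> (q (x + s *\<^sub>R y) - s * q y) + (q (z + t *\<^sub>R y) - t * q y)"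
    if "s \<ge> 0" "t \<ge> 0" for s t
    using sublinear_shift_le[OF q, of "s + t" y "x + z"] that
      sublinear_add[OF q, of "x + s *\<^sub>R y" "z + t *\<^sub>R y"]
    by (simp add: algebra_simps)
  have 2: "?s (x + z) - (q (x + s *\<^sub>R y) - s * q y) \<le> ?s z" if s: "s \<ge> 0" for s
  proof (rule sublinear_shift_greatest)
    fix t :: real assume "t \<ge> 0"
    from 1[OF s this] show "?s (x + z) - (q (x + s *\<^sub>R y) - s * q y) \<le> q (z + t *\<^sub>R y) - t * q y"
      by linarith
  qed
  have "?s (x + z) - ?s z \<le> ?s x"
  proof (rule sublinear_shift_greatest)
    fix s :: real assume "s \<ge> 0"
    from 2[OF this] show "?s (x + z) - ?s z \<le> q (x + s *\<^sub>R y) - s * q y" by linarith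
  qed
  then show "?s (x + z) \<le> ?s x + ?s z" by simp
  fix t :: real assume t: "t > 0"
  have "?s (t *\<^sub>R x) / t \<le> ?s x"
  proof (rule sublinear_shift_greatest)
    fix s :: real assume "s \<ge> 0"
    have "?s (t *\<^sub>R x) \<le> q (t *\<^sub>R (x + s *\<^sub>R y)) - (t * s) * q y"
      using sublinear_shift_le[OF q, of "t * s" y "t *\<^sub>R x"] t \<open>s \<ge> 0\<close> by (simp add: scaleR_add_right)
    then show "?s (t *\<^sub>R x) / t \<le> q (x + s *\<^sub>R y) - s * q y"
      using sublinear_scale[OF q, of t "x + s *\<^sub>R y"] t by (simp add: field_simps)
  qed
  then show "?s (t *\<^sub>R x) \<le> t * ?s x" using t by (simp add: field_simps)
qed

text \<open>
  A minimal sublinear functional among those whose dominated functionals form a face of the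
  functionals below \<open>p\<close> is linear: otherwise shifting it in some direction gives a smaller
  one, and the shift cuts out a face because it asks for a maximal value. Being linear, it is
  the only point of its face.
\<close>

theorem extreme_linear_functional_exists:
  fixes p :: "'v::real_vector \<Rightarrow> real"
  assumes p: "sublinear p"
  obtains \<phi> where "linear \<phi>" "\<And>x. \<phi> x \<le> p x"
    "\<And>\<psi> \<theta> t. \<lbrakk>linear \<psi>; linear \<theta>; \<And>x. \<psi> x \<le> p x; \<And>x. \<theta> x \<le> p x; 0 < t; t < 1;
        \<And>x. \<phi> x = t * \<psi> x + (1 - t) * \<theta> x\<rbrakk> \<Longrightarrow> \<psi> = \<phi>"
proof -
  define face where "face q \<longleftrightarrow> (\<forall>\<psi> \<theta> t. linear \<psi> \<and> linear \<theta> \<and> \<psi> \<le> p \<and> \<theta> \<le> p \<and> 0 < t \<and> t < 1 \<and>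
      (\<forall>x. t * \<psi> x + (1 - t) * \<theta> x \<le> q x) \<longrightarrow> \<psi> \<le> q \<and> \<theta> \<le> q)" for q
  define Q where "Q = {q. sublinear q \<and> q \<le> p \<and> face q}"
  have pQ: "p \<in> Q" using p by (simp add: Q_def face_def)
  have "\<exists>m\<in>Q. \<forall>a\<in>Q. m \<ge> a \<longrightarrow> a = m"
  proof (rule predicate_Zorn)
    show "partial_order_on Q (relation_of (\<ge>) Q)"
      by (rule partial_order_on_relation_ofI) auto
    fix C assume "C \<in> Chains (relation_of (\<ge>) Q)"
    then have CQ: "C \<subseteq> Q" and chain: "\<And>q r. q \<in> C \<Longrightarrow> r \<in> C \<Longrightarrow> q \<le> r \<or> r \<le> q"
      by (auto simp: Chains_def relation_of_def)
    show "\<exists>u\<in>Q. \<forall>a\<in>C. a \<ge> u"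
    proof (cases "C = {}")
      case False
      define u where "u x = (INF q\<in>C. q x)" for x
      have bdd: "bdd_below ((\<lambda>q. q x) ` C)" for x
      proof (rule bdd_belowI2)
        fix q assume "q \<in> C"
        then have "sublinear q" "q (- x) \<le> p (- x)" using CQ by (auto simp: Q_def le_fun_def)
        then show "- p (- x) \<le> q x" using sublinear_minus[of q x] by simp
      qed
      have low: "u x \<le> q x" if "q \<in> C" for q x
        unfolding u_def by (rule cINF_lower[OF bdd that])
      have great: "m \<le> u x" if "\<And>q. q \<in> C \<Longrightarrow> m \<le> q x" for m x
        unfolding u_def using that by (rule cINF_greatest[OF False])
      obtain q0 where q0: "q0 \<in> C" using False by blast
      have "sublinear u" unfolding u_def
        using CQ chain bdd by (intro sublinear_INF_chain[OF False]) (auto simp: Q_def)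
      moreover have "u \<le> p"
        using low[OF q0] CQ q0 by (auto simp: Q_def le_fun_def intro: order_trans)
      moreover have "face u"
        unfolding face_def
      proof (intro allI impI; elim conjE)
        fix \<psi> \<theta> :: "'v \<Rightarrow> real" and t :: real
        assume A: "linear \<psi>" "linear \<theta>" "\<psi> \<le> p" "\<theta> \<le> p" "0 < t" "t < 1"
          "\<forall>x. t * \<psi> x + (1 - t) * \<theta> x \<le> u x"
        have "\<psi> \<le> q \<and> \<theta> \<le> q" if "q \<in> C" for q
        proof -
          have "face q" using that CQ by (auto simp: Q_def)
          moreover have "\<forall>x. t * \<psi> x + (1 - t) * \<theta> x \<le> q x"
            using A(7) low[OF that] order_trans by blast
          ultimately show ?thesis unfolding face_def using A by blast
        qed
        then show "\<psi> \<le> u \<and> \<theta> \<le> u" by (auto simp: le_fun_def intro!: great)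
      qed
      ultimately have "u \<in> Q" by (simp add: Q_def)
      then show ?thesis using low by (auto simp: le_fun_def)
    qed (use pQ in auto)
  qed
  then obtain q where qQ: "q \<in> Q" and min: "\<And>a. a \<in> Q \<Longrightarrow> a \<le> q \<Longrightarrow> a = q" by blast
  have q: "sublinear q" "q \<le> p" "face q" using qQ by (auto simp: Q_def)
  have neg: "q (- y) = - q y" for y
  proof -
    let ?s = "sublinear_shift q y"
    have sq: "?s \<le> q" using sublinear_shift_le[OF q(1), of 0 y] by (simp add: le_fun_def)
    have "face ?s"
      unfolding face_def
    proof (intro allI impI; elim conjE)
      fix \<psi> \<theta> :: "'v \<Rightarrow> real" and t :: real
      assume A: "linear \<psi>" "linear \<theta>" "\<psi> \<le> p" "\<theta> \<le> p" "0 < t" "t < 1"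
        "\<forall>x. t * \<psi> x + (1 - t) * \<theta> x \<le> ?s x"
      have "\<forall>x. t * \<psi> x + (1 - t) * \<theta> x \<le> q x"
        using A(7) sq by (auto simp: le_fun_def intro: order_trans)
      then have le: "\<psi> \<le> q" "\<theta> \<le> q" using q(3) A unfolding face_def by blast+
      have "t * \<psi> (- y) + (1 - t) * \<theta> (- y) \<le> - q y"
        using A(7)[rule_format, of "- y"] sublinear_shift_le[OF q(1), of 1 y "- y"]
          sublinear_zero[OF q(1)] by simp
      then have "t * (q y - \<psi> y) + (1 - t) * (q y - \<theta> y) \<le> 0"
        using A(1,2) by (simp add: linear_neg algebra_simps)
      moreover have "q y - \<psi> y \<ge> 0" "q y - \<theta> y \<ge> 0" using le by (simp_all add: le_fun_def)
      then have "t * (q y - \<psi> y) \<ge> 0" "(1 - t) * (q y - \<theta> y) \<ge> 0"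
        using A(5,6) by simp_all
      ultimately have "t * (q y - \<psi> y) = 0" "(1 - t) * (q y - \<theta> y) = 0" by linarith+
      then have eq: "\<psi> y = q y" "\<theta> y = q y" using A(5,6) by simp_all
      have "f \<le> ?s" if "linear f" "f \<le> q" "f y = q y" for f
      proof (unfold le_fun_def, intro allI, rule sublinear_shift_greatest)
        fix x and r :: real
        show "f x \<le> q (x + r *\<^sub>R y) - r * q y"
          using le_funD[OF that(2), of "x + r *\<^sub>R y"] that(1,3)
          by (simp add: linear_add linear_cmul)
      qed
      then show "\<psi> \<le> ?s \<and> \<theta> \<le> ?s" using A(1,2) le eq by blast
    qed
    then have "?s \<in> Q"
      using sublinear_sublinear_shift[OF q(1)] sq q(2) by (auto simp: Q_def)
    then have "?s = q" using min sq by blast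
    then have "q (- y) \<le> - q y"
      using sublinear_shift_le[OF q(1), of 1 y "- y"] sublinear_zero[OF q(1)] by simp
    then show ?thesis using sublinear_minus[OF q(1), of y] by simp
  qed
  have "linear q"
  proof (rule linearI)
    fix x y
    show "q (x + y) = q x + q y"
      using sublinear_add[OF q(1), of x y] sublinear_add[OF q(1), of "x + y" "- y"] neg[of y] by simp
    fix r
    show "q (r *\<^sub>R x) = r *\<^sub>R q x"
    proof (cases "r \<ge> 0")
      case True
      then show ?thesis using sublinear_scale[OF q(1)] by simp
    next
      case False
      then have "q (- ((- r) *\<^sub>R x)) = - ((- r) * q x)"
        unfolding neg using sublinear_scale[OF q(1), of "- r" x] by simp
      then show ?thesis by simp
    qed
  qed
  moreover have "q x \<le> p x" for x using q(2) by (rule le_funD)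
  moreover have "\<psi> = q"
    if A: "linear \<psi>" "linear \<theta>" "\<And>x. \<psi> x \<le> p x" "\<And>x. \<theta> x \<le> p x" "0 < t" "t < 1"
      "\<And>x. q x = t * \<psi> x + (1 - t) * \<theta> x" for \<psi> \<theta> and t :: real
  proof -
    have "\<psi> \<le> q" using q(3) A unfolding face_def le_fun_def by (metis order_refl)
    then have "\<psi> x \<le> q x" "\<psi> (- x) \<le> q (- x)" for x by (simp_all add: le_fun_def)
    then have "\<psi> x = q x" for x using neg[of x] A(1) by (metis antisym linear_neg neg_le_iff_le)
    then show ?thesis by blast
  qed
  ultimately show thesis using that by blast
qed


section \<open>Pure states that vanish on a left ideal\<close>

text \<open>
  States are handled through their real parts, because the extension theorem above concerns real
  vector spaces; \<open>complexify\<close> recovers a complex linear functional from its real part.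
\<close>

definition real_state :: "('a::unital_cstar_algebra \<Rightarrow> real) \<Rightarrow> bool" where
  "real_state \<phi> \<longleftrightarrow> linear \<phi> \<and> (\<forall>x. \<phi> x \<le> norm x) \<and> \<phi> 1 = 1"

definition complexify :: "('a::cstar_algebra \<Rightarrow> real) \<Rightarrow> 'a \<Rightarrow> complex" where
  "complexify \<phi> x = Complex (\<phi> x) (- \<phi> (\<i> *\<^sub>C x))"

lemma real_state_nonneg:
  assumes "real_state \<phi>" "is_positive x" shows "\<phi> x \<ge> 0"
proof -
  obtain R where "norm (R *\<^sub>R 1 - x) \<le> R" using assms(2) by (auto simp: is_positive_def)
  moreover have "\<phi> (R *\<^sub>R 1 - x) = R - \<phi> x"
    using assms(1) by (simp add: real_state_def linear_diff linear_cmul)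
  moreover have "\<phi> (R *\<^sub>R 1 - x) \<le> norm (R *\<^sub>R 1 - x)" using assms(1) by (simp add: real_state_def)
  ultimately show ?thesis by linarith
qed

text \<open>
  The norm of \<open>r + \<i> h\<close> is at most \<open>sqrt (r\<^sup>2 + (norm h)\<^sup>2)\<close>, which is \<open>r + o(1)\<close> as \<open>r\<close>
  tends to infinity.
\<close>

lemma real_state_skew:
  assumes \<phi>: "real_state \<phi>" and h: "star h = h" shows "\<phi> (\<i> *\<^sub>C h) = 0"
proof -
  have le: "\<phi> (\<i> *\<^sub>C k) \<le> 0" if k: "star k = k" for k
  proof (rule ccontr)
    assume "\<not> \<phi> (\<i> *\<^sub>C k) \<le> 0"
    then have pos: "\<phi> (\<i> *\<^sub>C k) > 0" by simp
    define d where "d = \<phi> (\<i> *\<^sub>C k)"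
    \<comment> \<open>this value makes \<open>(r + d)\<^sup>2\<close> exceed \<open>r\<^sup>2 + (norm k)\<^sup>2\<close>\<close>
    define r where "r = (norm k)\<^sup>2 / d"
    have r: "r \<ge> 0" "r * d = (norm k)\<^sup>2" using pos by (simp_all add: r_def d_def)
    define w where "w = r *\<^sub>R 1 + \<i> *\<^sub>C k"
    have "star w * w = r\<^sup>2 *\<^sub>R 1 + k * k"
      by (simp add: w_def star_add star_scaleR star_scaleC k scaleC_minus_left algebra_simps
          mult_scaleC_left mult_scaleC_right scaleC_scaleC scaleC_minus_one power2_eq_square
          scaleC_scaleR scaleC_diff_right scaleC_add_right)
    then have "(norm w)\<^sup>2 \<le> norm (r\<^sup>2 *\<^sub>R (1::'a)) + norm (k * k)"
      using cstar_identity[of w] norm_triangle_ineq[of "r\<^sup>2 *\<^sub>R 1" "k * k"] by simp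
    also have "\<dots> \<le> r\<^sup>2 + (norm k)\<^sup>2"
      using norm_mult_ineq[of k k] by (simp add: power2_eq_square)
    finally have 1: "(norm w)\<^sup>2 \<le> r\<^sup>2 + r * d" using r by simp
    have "r + d = \<phi> w"
      using \<phi> by (simp add: w_def d_def real_state_def linear_add linear_cmul)
    also have "\<dots> \<le> norm w" using \<phi> by (simp add: real_state_def)
    finally have "(r + d)\<^sup>2 \<le> (norm w)\<^sup>2" using r pos by (intro power_mono) (auto simp: d_def)
    then have "d * d + r * d \<le> 0" using 1 by (simp add: power2_eq_square algebra_simps)
    moreover have "d * d > 0" "r * d \<ge> 0" using pos r by (simp_all add: d_def)
    ultimately show False by linarith
  qed
  have "\<phi> (\<i> *\<^sub>C (- h)) = - \<phi> (\<i> *\<^sub>C h)"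
    using \<phi> by (simp add: scaleC_minus_right real_state_def linear_neg)
  then show ?thesis using le[of h] le[of "- h"] h by (simp add: star_minus)
qed

lemma real_state_star:
  assumes "real_state \<phi>" shows "\<phi> (star x) = \<phi> x"
proof -
  define h where "h = - \<i> *\<^sub>C (x - star x)"
  have "star h = h"
    by (simp add: h_def star_scaleC star_minus star_diff star_star scaleC_diff_right scaleC_minus_left)
  then have "\<phi> (\<i> *\<^sub>C h) = 0" by (rule real_state_skew[OF assms])
  moreover have "\<i> *\<^sub>C h = x - star x"
    by (simp add: h_def scaleC_minus_left scaleC_minus_right scaleC_scaleC scaleC_minus_one)
  ultimately show ?thesis using assms by (simp add: real_state_def linear_diff)
qed

text \<open>
  Closure under scalar multiplication follows, since the algebra is unital.
\<close>

definition left_ideal :: "'a::unital_cstar_algebra set \<Rightarrow> bool" where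
  "left_ideal L \<longleftrightarrow> 0 \<in> L \<and> (\<forall>x\<in>L. \<forall>y\<in>L. x + y \<in> L) \<and> (\<forall>b. \<forall>x\<in>L. b * x \<in> L)"

lemma left_ideal_scaleR: "left_ideal L \<Longrightarrow> x \<in> L \<Longrightarrow> r *\<^sub>R x \<in> L"
  using left_ideal_def[of L] by (metis mult_scaleR_left mult_1)

text \<open>
  Otherwise \<open>- l / r\<close> would be within distance less than \<open>1\<close> of the unit, hence invertible.
\<close>

lemma norm_unit_plus_left_ideal:
  assumes L: "left_ideal L" "1 \<notin> L" "l \<in> L" shows "norm (r *\<^sub>R 1 + l) \<ge> \<bar>r\<bar>"
proof (rule ccontr)
  assume "\<not> norm (r *\<^sub>R 1 + l) \<ge> \<bar>r\<bar>"
  then have lt: "norm (r *\<^sub>R 1 + l) < \<bar>r\<bar>" by simp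
  then have r: "r \<noteq> 0" by auto
  define x where "x = (- 1 / r) *\<^sub>R l"
  have "r *\<^sub>R (1 - x) = r *\<^sub>R 1 + l" using r by (simp add: x_def algebra_simps)
  then have "\<bar>r\<bar> * norm (1 - x) < \<bar>r\<bar> * 1" using lt by (metis norm_scaleR mult_1_right)
  then have "norm (1 - x) < 1" using r by (metis mult_less_cancel_left_pos zero_less_abs_iff)
  then obtain y where "y * x = 1" using inverse_of_norm_less by blast
  moreover have "x \<in> L" unfolding x_def by (rule left_ideal_scaleR[OF L(1,3)])
  ultimately have "1 \<in> L" using L(1) unfolding left_ideal_def by metis
  then show False using L by blast
qed

text \<open>
  The real states that vanish on \<open>L\<close> are exactly the linear functionals below
  \<open>p x = inf (norm (x - r - l) + r)\<close>, the infimum being over real \<open>r\<close> and \<open>l \<in> L\<close>. It is finite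
  because \<open>norm (r + l) \<ge> \<bar>r\<bar>\<close>.
\<close>

lemma extreme_real_state_exists:
  fixes L :: "'a::unital_cstar_algebra set"
  assumes L: "left_ideal L" "1 \<notin> L"
  obtains \<phi> where "real_state \<phi>" "\<And>l. l \<in> L \<Longrightarrow> \<phi> l = 0"
    "\<And>\<psi> \<theta> t. \<lbrakk>real_state \<psi>; real_state \<theta>; \<And>l. l \<in> L \<Longrightarrow> \<psi> l = 0; \<And>l. l \<in> L \<Longrightarrow> \<theta> l = 0;
        0 < t; t < 1; \<And>x. \<phi> x = t * \<psi> x + (1 - t) * \<theta> x\<rbrakk> \<Longrightarrow> \<psi> = \<phi>"
proof -
  have L0: "0 \<in> L" and Ladd: "\<And>x y. x \<in> L \<Longrightarrow> y \<in> L \<Longrightarrow> x + y \<in> L"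
    using L(1) by (auto simp: left_ideal_def)
  define f where "f x = (\<lambda>(r, l). norm (x - r *\<^sub>R 1 - l) + r)" for x :: 'a
  define p where "p x = (INF rl\<in>UNIV \<times> L. f x rl)" for x
  have bdd: "bdd_below (f x ` (UNIV \<times> L))" for x
  proof (rule bdd_belowI2)
    fix rl assume "rl \<in> (UNIV::real set) \<times> L"
    then obtain r l where rl: "rl = (r, l)" "l \<in> L" by auto
    have "\<bar>r\<bar> \<le> norm (r *\<^sub>R 1 + l)" by (rule norm_unit_plus_left_ideal[OF L rl(2)])
    also have "\<dots> \<le> norm x + norm (x - r *\<^sub>R 1 - l)"
      using norm_triangle_ineq4[of x "x - r *\<^sub>R 1 - l"] by (simp add: add.commute)
    finally show "- norm x \<le> f x rl" by (simp add: f_def rl(1))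
  qed
  have low: "p x \<le> norm (x - r *\<^sub>R 1 - l) + r" if "l \<in> L" for x r l
    unfolding p_def using cINF_lower[OF bdd, of "(r, l)" x] that by (simp add: f_def)
  have great: "m \<le> p x" if "\<And>r l. l \<in> L \<Longrightarrow> m \<le> norm (x - r *\<^sub>R 1 - l) + r" for m x
    unfolding p_def using that L0 by (intro cINF_greatest) (auto simp: f_def)
  have "sublinear p"
    unfolding sublinear_def
  proof (intro conjI allI impI)
    fix x y
    have 1: "p (x + y) \<le> (norm (x - r *\<^sub>R 1 - l) + r) + (norm (y - s *\<^sub>R 1 - k) + s)"
      if "l \<in> L" "k \<in> L" for r s l k
      using low[OF Ladd[OF that], of "x + y" "r + s"]
        norm_triangle_ineq[of "x - r *\<^sub>R 1 - l" "y - s *\<^sub>R 1 - k"]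
      by (simp add: algebra_simps)
    have 2: "p (x + y) - (norm (x - r *\<^sub>R 1 - l) + r) \<le> p y" if l: "l \<in> L" for r l
    proof (rule great)
      fix s k assume "k \<in> L"
      from 1[OF l this, of r s]
      show "p (x + y) - (norm (x - r *\<^sub>R 1 - l) + r) \<le> norm (y - s *\<^sub>R 1 - k) + s" by linarith
    qed
    have "p (x + y) - p y \<le> p x"
    proof (rule great)
      fix r l assume "l \<in> L"
      from 2[OF this, of r] show "p (x + y) - p y \<le> norm (x - r *\<^sub>R 1 - l) + r" by linarith
    qed
    then show "p (x + y) \<le> p x + p y" by simp
    fix t :: real assume t: "t > 0"
    have "p (t *\<^sub>R x) / t \<le> p x"
    proof (rule great)
      fix r l assume "l \<in> L"
      have "t *\<^sub>R x - (t * r) *\<^sub>R 1 - t *\<^sub>R l = t *\<^sub>R (x - r *\<^sub>R 1 - l)"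
        by (simp add: scaleR_diff_right)
      then have "p (t *\<^sub>R x) \<le> t * norm (x - r *\<^sub>R 1 - l) + t * r"
        using low[OF left_ideal_scaleR[OF L(1) \<open>l \<in> L\<close>], of "t *\<^sub>R x" "t * r" t] t by simp
      then show "p (t *\<^sub>R x) / t \<le> norm (x - r *\<^sub>R 1 - l) + r"
        using t by (simp add: field_simps)
    qed
    then show "p (t *\<^sub>R x) \<le> t * p x" using t by (simp add: field_simps)
  qed
  then obtain \<phi> where lin: "linear \<phi>" and le: "\<And>x. \<phi> x \<le> p x"
    and ext: "\<And>\<psi> \<theta> t. \<lbrakk>linear \<psi>; linear \<theta>; \<And>x. \<psi> x \<le> p x; \<And>x. \<theta> x \<le> p x; 0 < t; t < 1;
        \<And>x. \<phi> x = t * \<psi> x + (1 - t) * \<theta> x\<rbrakk> \<Longrightarrow> \<psi> = \<phi>"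
    by (rule extreme_linear_functional_exists) blast
  \<comment> \<open>the choice \<open>r = - 1\<close> in the infimum gives \<open>p (- 1) \<le> - 1\<close>\<close>
  have "\<phi> 1 \<le> 1" using le[of 1] low[OF L0, of 1 0] by simp
  moreover have "\<phi> (- 1) \<le> - 1" using le[of "- 1"] low[OF L0, of "- 1" "- 1"] by simp
  ultimately have "\<phi> 1 = 1" using lin by (simp add: linear_neg)
  moreover have "\<phi> x \<le> norm x" for x using le[of x] low[OF L0, of x 0] by simp
  ultimately have "real_state \<phi>" using lin by (simp add: real_state_def)
  moreover have "\<phi> l = 0" if "l \<in> L" for l
  proof -
    have "\<phi> k \<le> 0" if "k \<in> L" for k using le[of k] low[OF that, of k 0] by simp
    from this[OF that] this[OF left_ideal_scaleR[OF L(1) that, of "- 1"]]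
    show ?thesis using lin by (simp add: linear_neg)
  qed
  moreover have "\<psi> x \<le> p x" if "real_state \<psi>" "\<And>l. l \<in> L \<Longrightarrow> \<psi> l = 0" for \<psi> x
  proof (rule great)
    fix r l assume "l \<in> L"
    have "\<psi> (x - r *\<^sub>R 1 - l) \<le> norm (x - r *\<^sub>R 1 - l)" using that(1) by (simp add: real_state_def)
    then show "\<psi> x \<le> norm (x - r *\<^sub>R 1 - l) + r"
      using that(1) that(2)[OF \<open>l \<in> L\<close>] by (simp add: real_state_def linear_diff linear_cmul)
  qed
  then have "\<psi> = \<phi>" if "real_state \<psi>" "real_state \<theta>" "\<And>l. l \<in> L \<Longrightarrow> \<psi> l = 0" "\<And>l. l \<in> L \<Longrightarrow> \<theta> l = 0"
    "0 < t" "t < 1" "\<And>x. \<phi> x = t * \<psi> x + (1 - t) * \<theta> x" for \<psi> \<theta> and t :: real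
    using that by (intro ext[of \<psi> \<theta> t]) (auto simp: real_state_def)
  ultimately show thesis using that by blast
qed


section \<open>Orthogonal projections\<close>

context complex_inner_product_space
begin

lemma vector_eqI:
  assumes "x \<in> H" "y \<in> H" "\<And>w. w \<in> H \<Longrightarrow> ip x w = ip y w" shows "x = y"
proof (rule diff_eq_zero[OF assms(1,2)])
  let ?d = "x \<oplus> (-1) \<odot> y"
  have d: "?d \<in> H" using assms by (simp add: add_closed neg_closed)
  have "ip ?d ?d = 0"
    using assms(3)[OF d] assms(1,2) d by (simp add: ip_add_left ip_scale_left neg_closed)
  then show "?d = \<zero>" using ip_pos[OF d] by fastforce
qed

lemma hnorm_square: "x \<in> H \<Longrightarrow> (hnorm x)\<^sup>2 = Re (ip x x)"
  by (simp add: hnorm_def ip_self_nonneg)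

lemma Re_ip_commute: "x \<in> H \<Longrightarrow> y \<in> H \<Longrightarrow> Re (ip x y) = Re (ip y x)"
  by (subst ip_commute) simp_all

lemma ip_zero_right: "x \<in> H \<Longrightarrow> ip x \<zero> = 0"
  by (metis complex_cnj_zero ip_commute ip_zero_left zero_closed)

lemma hnorm_add_square:
  assumes "x \<in> H" "y \<in> H"
  shows "(hnorm (x \<oplus> y))\<^sup>2 = (hnorm x)\<^sup>2 + (hnorm y)\<^sup>2 + 2 * Re (ip x y)"
  using assms Re_ip_commute[OF assms]
  by (simp add: hnorm_square add_closed ip_add_left ip_add_right)

lemma hnorm_scale: "x \<in> H \<Longrightarrow> hnorm (c \<odot> x) = cmod c * hnorm x"
proof -
  assume x: "x \<in> H"
  have "ip (c \<odot> x) (c \<odot> x) = (c * cnj c) * ip x x"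
    using x by (simp add: ip_scale_left ip_scale_right scale_closed)
  then have "Re (ip (c \<odot> x) (c \<odot> x)) = (cmod c)\<^sup>2 * Re (ip x x)"
    by (simp add: complex_norm_square[symmetric] del: of_real_power)
  then show ?thesis by (simp add: hnorm_def real_sqrt_mult)
qed

lemma hnorm_triangle:
  assumes "x \<in> H" "y \<in> H" shows "hnorm (x \<oplus> y) \<le> hnorm x + hnorm y"
proof (rule power2_le_imp_le)
  have "Re (ip x y) \<le> hnorm x * hnorm y"
    using cauchy_schwarz[OF assms] complex_Re_le_cmod[of "ip x y"] by linarith
  then show "(hnorm (x \<oplus> y))\<^sup>2 \<le> (hnorm x + hnorm y)\<^sup>2"
    unfolding hnorm_add_square[OF assms] by (simp add: power2_sum)
qed (simp add: hnorm_nonneg assms)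

lemma diff_closed: "x \<in> H \<Longrightarrow> y \<in> H \<Longrightarrow> x \<oplus> (-1) \<odot> y \<in> H"
  by (simp add: add_closed neg_closed)

lemma hdist_triangle:
  assumes "x \<in> H" "y \<in> H" "z \<in> H" shows "hdist x z \<le> hdist x y + hdist y z"
proof -
  have "x \<oplus> (-1) \<odot> z = (x \<oplus> (-1) \<odot> y) \<oplus> (y \<oplus> (-1) \<odot> z)"
    using assms by (intro vector_eqI) (simp_all add: add_closed scale_closed ip_add_left ip_scale_left)
  then show ?thesis unfolding hdist_def using assms by (simp add: hnorm_triangle diff_closed)
qed

lemma hdist_commute:
  assumes "x \<in> H" "y \<in> H" shows "hdist x y = hdist y x"
proof -
  have "x \<oplus> (-1) \<odot> y = (-1) \<odot> (y \<oplus> (-1) \<odot> x)"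
    using assms by (intro vector_eqI) (simp_all add: add_closed scale_closed ip_add_left ip_scale_left)
  then show ?thesis unfolding hdist_def using assms by (simp add: hnorm_neg diff_closed)
qed

lemma hdist_nonneg: "x \<in> H \<Longrightarrow> y \<in> H \<Longrightarrow> hdist x y \<ge> 0"
  by (simp add: hdist_def hnorm_nonneg diff_closed)

text \<open>
  The parallelogram law for \<open>x - k\<close> and \<open>x - l\<close>.
\<close>

lemma hdist_square_midpoint:
  assumes "x \<in> H" "k \<in> H" "l \<in> H"
  shows "(hdist k l)\<^sup>2 =
    2 * (hdist x k)\<^sup>2 + 2 * (hdist x l)\<^sup>2 - 4 * (hdist x ((1/2) \<odot> (k \<oplus> l)))\<^sup>2"
  using assms Re_ip_commute[of x k] Re_ip_commute[of x l] Re_ip_commute[of k l]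
  by (simp add: hdist_def hnorm_square add_closed scale_closed ip_add_left ip_add_right
      ip_scale_left ip_scale_right field_simps)

end

lemma zero_of_quadratic_nonneg:
  fixes w b :: real
  assumes "b \<ge> 0" "w \<ge> 0" "\<And>t. t > 0 \<Longrightarrow> 0 \<le> t\<^sup>2 * (w * b) - 2 * (t * w)" shows "w = 0"
proof -
  \<comment> \<open>small enough for the linear term to dominate the quadratic one\<close>
  define t where "t = 1 / (b + 1)"
  have t: "t > 0" "t * b \<le> 1" using assms by (simp_all add: t_def)
  have "0 \<le> t * w * (t * b - 2)" using assms(3)[OF t(1)] by (simp add: power2_eq_square algebra_simps)
  moreover have "t * w * (t * b - 2) \<le> t * w * (- 1)"
    using t assms by (intro mult_left_mono) auto
  ultimately have "t * w \<le> 0" by simp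
  then show ?thesis using t assms by (simp add: mult_le_0_iff)
qed

context complex_hilbert_space
begin

text \<open>
  A sequence in \<open>K\<close> that minimizes the distance to \<open>x\<close> is a Cauchy sequence by the parallelogram
  law. If the limit is \<open>l\<close>, moving it in the direction of a vector of \<open>K\<close> cannot decrease the
  distance, which makes \<open>x - l\<close> orthogonal to \<open>K\<close>.
\<close>

lemma orthogonal_decomposition:
  assumes K: "closed_subspace K" and x: "x \<in> H"
  obtains k z where "k \<in> K" "z \<in> H" "x = k \<oplus> z" "\<And>y. y \<in> K \<Longrightarrow> ip z y = 0"
proof -
  have KH: "K \<subseteq> H" and K0: "\<zero> \<in> K" and Kadd: "\<And>y z. y \<in> K \<Longrightarrow> z \<in> K \<Longrightarrow> y \<oplus> z \<in> K"
    and Kscale: "\<And>c y. y \<in> K \<Longrightarrow> c \<odot> y \<in> K"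
    and Klim: "\<And>X l. (\<And>n. X n \<in> K) \<Longrightarrow> l \<in> H \<Longrightarrow> (\<lambda>n. hdist (X n) l) \<longlonglongrightarrow> 0 \<Longrightarrow> l \<in> K"
    using K unfolding closed_subspace_def by blast+
  define f where "f k = (hdist x k)\<^sup>2" for k
  define m where "m = (INF k\<in>K. f k)"
  have low: "m \<le> f k" if "k \<in> K" for k
    unfolding m_def using that by (intro cINF_lower bdd_belowI2[where m = 0]) (auto simp: f_def)
  have m0: "m \<ge> 0" unfolding m_def using K0 by (intro cINF_greatest) (auto simp: f_def)
  have "\<exists>k\<in>K. f k < m + 1 / real (Suc n)" for n
  proof -
    have "Inf (f ` K) < m + 1 / real (Suc n)" by (simp add: m_def)
    then show ?thesis using K0 cInf_lessD[of "f ` K"] by blast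
  qed
  then obtain u where u: "\<And>n. u n \<in> K" "\<And>n. f (u n) < m + 1 / real (Suc n)" by metis
  have uH: "u n \<in> H" for n using u KH by blast
  have ub: "(hdist (u i) (u j))\<^sup>2 < 2 / real (Suc i) + 2 / real (Suc j)" for i j
  proof -
    have "m \<le> f ((1/2) \<odot> (u i \<oplus> u j))" by (intro low Kscale Kadd u)
    then show ?thesis
      using hdist_square_midpoint[OF x uH uH, of i j] u(2)[of i] u(2)[of j]
      unfolding f_def by simp
  qed
  have "hcauchy u"
    unfolding hcauchy_def
  proof (intro allI impI)
    fix e :: real assume e: "e > 0"
    obtain M where M: "4 / e\<^sup>2 < real M" using reals_Archimedean2 by blast
    have "hdist (u i) (u j) < e" if "i \<ge> M" "j \<ge> M" for i j
    proof -
      have "0 < 4 / e\<^sup>2" using e by simp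
      then have Mp: "real M > 0" using M by linarith
      have "2 / real (Suc i) \<le> 2 / real M" "2 / real (Suc j) \<le> 2 / real M"
        using that Mp by (auto intro!: divide_left_mono)
      then have "(hdist (u i) (u j))\<^sup>2 < 4 / real M" using ub[of i j] by simp
      also have "\<dots> < e\<^sup>2" using M Mp e by (simp add: field_simps)
      finally show ?thesis using e by (simp add: power2_less_imp_less)
    qed
    then show "\<exists>N. \<forall>m\<ge>N. \<forall>n\<ge>N. hdist (u m) (u n) < e" by blast
  qed
  then obtain l where l: "l \<in> H" "(\<lambda>n. hdist (u n) l) \<longlonglongrightarrow> 0" using complete[of u] uH by blast
  have lK: "l \<in> K" by (rule Klim[OF u(1) l])
  have "hdist x l \<le> sqrt (m + 1 / real (Suc n)) + hdist (u n) l" for n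
  proof -
    have "hdist x (u n) \<le> sqrt (m + 1 / real (Suc n))"
      using u(2)[of n] by (intro real_le_rsqrt) (simp add: f_def)
    then show ?thesis using hdist_triangle[OF x uH[of n] l(1)] by simp
  qed
  moreover have "(\<lambda>n. sqrt (m + 1 / real (Suc n)) + hdist (u n) l) \<longlonglongrightarrow> sqrt (m + 0) + 0"
    using LIMSEQ_inverse_real_of_nat by (intro tendsto_intros l) (simp add: inverse_eq_divide)
  ultimately have "hdist x l \<le> sqrt m" by (intro LIMSEQ_le_const[of _ "sqrt m"]) auto
  then have fl: "f l \<le> m"
    using m0 hdist_nonneg[OF x l(1)] power_mono[of "hdist x l" "sqrt m" 2] by (simp add: f_def)
  define z where "z = x \<oplus> (-1) \<odot> l"
  have z: "z \<in> H" using x l by (simp add: z_def diff_closed)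
  have orth: "ip z y = 0" if y: "y \<in> K" for y
  proof -
    define w where "w = ip z y"
    have yH: "y \<in> H" using y KH by blast
    have "(cmod w)\<^sup>2 = 0"
    proof (rule zero_of_quadratic_nonneg)
      show "Re (ip y y) \<ge> 0" using ip_self_nonneg[OF yH] .
      fix t :: real assume t: "t > 0"
      define c where "c = complex_of_real t * w"
      have cy: "c \<odot> y \<in> H" "(- c) \<odot> y \<in> H" using yH by (simp_all add: scale_closed)
      have "x \<oplus> (-1) \<odot> (l \<oplus> c \<odot> y) = z \<oplus> (- c) \<odot> y"
        unfolding z_def using x l(1) yH
        by (intro vector_eqI) (simp_all add: add_closed scale_closed ip_add_left ip_scale_left algebra_simps)
      then have "f (l \<oplus> c \<odot> y) = (hnorm z)\<^sup>2 + (hnorm ((- c) \<odot> y))\<^sup>2 + 2 * Re (ip z ((- c) \<odot> y))"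
        unfolding f_def hdist_def by (simp add: hnorm_add_square[OF z cy(2)])
      also have "(hnorm z)\<^sup>2 = f l" by (simp add: f_def hdist_def z_def)
      also have "(hnorm ((- c) \<odot> y))\<^sup>2 = t\<^sup>2 * ((cmod w)\<^sup>2 * Re (ip y y))"
        using t by (simp add: hnorm_scale[OF yH] power_mult_distrib hnorm_square[OF yH] c_def norm_mult)
      also have "Re (ip z ((- c) \<odot> y)) = - (t * (cmod w)\<^sup>2)"
        using z yH by (simp add: ip_scale_right c_def w_def[symmetric] cmod_power2)
          (simp add: power2_eq_square algebra_simps)
      finally show "0 \<le> t\<^sup>2 * ((cmod w)\<^sup>2 * Re (ip y y)) - 2 * (t * (cmod w)\<^sup>2)"
        using low[OF Kadd[OF lK Kscale[OF y]], of c] fl by simp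
    qed simp
    then show ?thesis by (simp add: w_def)
  qed
  have "x = l \<oplus> z"
    unfolding z_def using x l(1)
    by (intro vector_eqI) (simp_all add: add_closed scale_closed ip_add_left ip_scale_left)
  then show thesis using that lK z orth by blast
qed

end

context star_representation
begin

lemma rep_zero: "x \<in> H \<Longrightarrow> \<pi> 0 x = \<zero>"
  using rep_scale[of x 0 0] zero_scale[OF op_closed, of x 0] by simp

lemma rep_minus: "x \<in> H \<Longrightarrow> \<pi> (- a) x = (-1) \<odot> \<pi> a x"
  using rep_scale[of x "-1" a] by (simp add: scaleC_minus_one)

lemma rep_diff: "x \<in> H \<Longrightarrow> \<pi> (a - b) x = \<pi> a x \<oplus> (-1) \<odot> \<pi> b x"
  using rep_add[of x a "- b"] by (simp add: rep_minus)

lemma rep_scaleR: "x \<in> H \<Longrightarrow> \<pi> (r *\<^sub>R a) x = complex_of_real r \<odot> \<pi> a x"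
  using rep_scale[of x "complex_of_real r" a] by (simp add: scaleC_of_real)

lemma ip_rep: "x \<in> H \<Longrightarrow> y \<in> H \<Longrightarrow> ip (\<pi> a x) y = ip x (\<pi> (star a) y)"
  using rep_star[of x y "star a"] by (simp add: star_star)

lemma ip_rep_star_mult:
  "x \<in> H \<Longrightarrow> ip (\<pi> (star a * a) x) x = complex_of_real ((hnorm (\<pi> a x))\<^sup>2)"
  using ip_self_real[OF op_closed, of x a]
  by (simp add: rep_mult rep_star op_closed hnorm_square)

text \<open>
  For \<open>norm a = 1\<close> and \<open>(1 - b)\<^sup>2 = 1 - star a * a\<close>, the difference of the squared
  norms of \<open>x\<close> and \<open>\<pi> a x\<close> is the squared norm of \<open>(1 - b) x\<close>.
\<close>

lemma rep_contractive:
  assumes x: "x \<in> H" shows "hnorm (\<pi> a x) \<le> norm a * hnorm x"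
proof (cases "a = 0")
  case True
  then show ?thesis using x hnorm_zero_iff[OF zero_closed] by (simp add: rep_zero)
next
  case False
  define c where "c = (1 / norm a) *\<^sub>R a"
  have nc: "norm c = 1" using False by (simp add: c_def)
  have ac: "a = norm a *\<^sub>R c" using False by (simp add: c_def)
  have "norm (star c * c) \<le> 1" "star (star c * c) = star c * c"
    by (simp_all add: cstar_identity nc star_mult star_star)
  then obtain b where b: "star b = b" "2 *\<^sub>R b - b * b = star c * c"
    using one_minus_sqrt by metis
  have cc: "star c * c = b + b - b * b" using b(2) by (simp add: scaleR_2)
  have bx: "\<pi> b x \<in> H" "(-1) \<odot> \<pi> b x \<in> H" "\<pi> b (\<pi> b x) \<in> H" using x by (simp_all add: op_closed neg_closed)
  have "Re (ip (\<pi> (star c * c) x) x) = 2 * Re (ip (\<pi> b x) x) - Re (ip (\<pi> (b * b) x) x)"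
    unfolding cc using x bx
    by (simp add: rep_diff rep_add rep_mult ip_add_left ip_scale_left add_closed scale_closed)
  also have "ip (\<pi> (b * b) x) x = complex_of_real ((hnorm (\<pi> b x))\<^sup>2)"
    using ip_rep_star_mult[OF x, of b] b(1) by simp
  finally have "(hnorm (\<pi> c x))\<^sup>2 = 2 * Re (ip (\<pi> b x) x) - (hnorm (\<pi> b x))\<^sup>2"
    using ip_rep_star_mult[OF x, of c] by simp
  moreover have "(hnorm (x \<oplus> (-1) \<odot> \<pi> b x))\<^sup>2 =
      (hnorm x)\<^sup>2 + (hnorm (\<pi> b x))\<^sup>2 - 2 * Re (ip (\<pi> b x) x)"
    using hnorm_add_square[OF x bx(2)] Re_ip_commute[OF x bx(1)] x bx
    by (simp add: hnorm_neg ip_scale_right)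
  moreover have "(hnorm (x \<oplus> (-1) \<odot> \<pi> b x))\<^sup>2 \<ge> 0" by simp
  ultimately have "(hnorm (\<pi> c x))\<^sup>2 \<le> (hnorm x)\<^sup>2" by linarith
  then have "hnorm (\<pi> c x) \<le> hnorm x"
    using hnorm_nonneg[OF x] by (rule power2_le_imp_le)
  moreover have "hnorm (\<pi> a x) = norm a * hnorm (\<pi> c x)"
    by (subst ac) (simp add: rep_scaleR x hnorm_scale op_closed)
  ultimately show ?thesis by (simp add: mult_left_mono)
qed

end


section \<open>The GNS construction\<close>

locale positive_functional =
  fixes \<Phi> :: "'b::unital_cstar_algebra \<Rightarrow> complex"
  assumes functional_add: "\<Phi> (x + y) = \<Phi> x + \<Phi> y"
    and functional_scaleC: "\<Phi> (c *\<^sub>C x) = c * \<Phi> x"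
    and functional_star: "\<Phi> (star x) = cnj (\<Phi> x)"
    and functional_nonneg: "is_positive x \<Longrightarrow> Re (\<Phi> x) \<ge> 0"
begin

lemma functional_diff: "\<Phi> (x - y) = \<Phi> x - \<Phi> y"
  using functional_add[of "x - y" y] by simp

lemma functional_scaleR: "\<Phi> (r *\<^sub>R x) = complex_of_real r * \<Phi> x"
  using functional_scaleC[of "complex_of_real r" x] by (simp add: scaleC_of_real)

definition form :: "'b \<Rightarrow> 'b \<Rightarrow> complex" where
  "form x y = \<Phi> (star y * x)"

lemma form_add_left: "form (x + y) z = form x z + form y z"
  and form_diff_left: "form (x - y) z = form x z - form y z"
  and form_scaleC_left: "form (c *\<^sub>C x) z = c * form x z"
  and form_add_right: "form z (x + y) = form z x + form z y"
  and form_diff_right: "form z (x - y) = form z x - form z y"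
  and form_scaleC_right: "form z (c *\<^sub>C x) = cnj c * form z x"
  by (simp_all add: form_def functional_add functional_diff functional_scaleC algebra_simps
      mult_scaleC_left mult_scaleC_right star_add star_diff star_scaleC)

lemma form_commute: "form x y = cnj (form y x)"
  unfolding form_def functional_star[symmetric] by (simp add: star_mult star_star)

lemma form_mult: "form (b * x) y = form x (star b * y)"
  by (simp add: form_def star_mult star_star mult.assoc)

lemma form_nonneg: "Re (form x x) \<ge> 0"
  unfolding form_def by (intro functional_nonneg positive_star_mult_self)

definition seminorm :: "'b \<Rightarrow> real" where
  "seminorm x = sqrt (Re (form x x))"

lemma seminorm_nonneg: "seminorm x \<ge> 0"
  by (simp add: seminorm_def form_nonneg)

lemma seminorm_square: "(seminorm x)\<^sup>2 = Re (form x x)"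
  by (simp add: seminorm_def form_nonneg)

lemma form_cauchy_schwarz: "cmod (form x y) \<le> seminorm x * seminorm y"
proof -
  define z where "z = form x y"
  have yx: "form y x = cnj z" by (simp add: z_def form_commute[of y x])
  have quad: "0 \<le> Re (form x x) + t\<^sup>2 * ((cmod z)\<^sup>2 * Re (form y y)) - 2 * (t * (cmod z)\<^sup>2)" for t :: real
  proof -
    define c where "c = complex_of_real t * z"
    have zz: "z * cnj z = complex_of_real (cmod z) * complex_of_real (cmod z)"
      by (metis complex_norm_square of_real_power power2_eq_square)
    have e: "cnj c * z = complex_of_real (t * (cmod z)\<^sup>2)"
      "c * cnj z = complex_of_real (t * (cmod z)\<^sup>2)"
      "c * cnj c = complex_of_real (t\<^sup>2 * (cmod z)\<^sup>2)"
      using zz by (simp_all add: c_def power2_eq_square mult_ac)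
    have "form (x - c *\<^sub>C y) (x - c *\<^sub>C y)
        = form x x - (cnj c * z + c * cnj z) + (c * cnj c) * form y y"
      by (simp add: form_diff_left form_diff_right form_scaleC_left form_scaleC_right yx
          z_def[symmetric] algebra_simps)
    then have "Re (form (x - c *\<^sub>C y) (x - c *\<^sub>C y))
        = Re (form x x) - 2 * (t * (cmod z)\<^sup>2) + t\<^sup>2 * (cmod z)\<^sup>2 * Re (form y y)"
      unfolding e by simp
    then show ?thesis using form_nonneg[of "x - c *\<^sub>C y"] by simp
  qed
  have "(cmod z)\<^sup>2 \<le> Re (form x x) * Re (form y y)"
  proof (cases "Re (form y y) = 0")
    case True
    have "(cmod z)\<^sup>2 \<le> 0"
    proof (rule ccontr)
      assume "\<not> (cmod z)\<^sup>2 \<le> 0"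
      then have p: "(cmod z)\<^sup>2 > 0" by simp
      show False using quad[of "(Re (form x x) + 1) / (cmod z)\<^sup>2"] p True form_nonneg[of x]
        by simp
    qed
    then show ?thesis using True by simp
  next
    case False
    then have p: "Re (form y y) > 0" using form_nonneg[of y] by simp
    show ?thesis using quad[of "1 / Re (form y y)"] p by (simp add: field_simps power2_eq_square)
  qed
  then have "cmod z \<le> sqrt (Re (form x x) * Re (form y y))" by (rule real_le_rsqrt)
  then show ?thesis by (simp add: z_def seminorm_def real_sqrt_mult)
qed

lemma seminorm_triangle: "seminorm (x + y) \<le> seminorm x + seminorm y"
proof (rule power2_le_imp_le)
  have "Re (form y x) = Re (form x y)" by (subst form_commute) simp
  moreover have "Re (form x y) \<le> seminorm x * seminorm y"
    using form_cauchy_schwarz[of x y] complex_Re_le_cmod[of "form x y"] by linarith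
  ultimately show "(seminorm (x + y))\<^sup>2 \<le> (seminorm x + seminorm y)\<^sup>2"
    by (simp add: power2_sum seminorm_square form_add_left form_add_right)
qed (simp add: seminorm_nonneg)

lemma seminorm_scaleC: "seminorm (c *\<^sub>C x) = cmod c * seminorm x"
proof -
  have "form (c *\<^sub>C x) (c *\<^sub>C x) = complex_of_real ((cmod c)\<^sup>2) * form x x"
    by (subst complex_norm_square) (simp add: form_scaleC_left form_scaleC_right mult_ac)
  then show ?thesis by (simp add: seminorm_def real_sqrt_mult)
qed

text \<open>
  With \<open>u\<^sup>2 = (norm b)\<^sup>2 - star b * b\<close>, the difference of the squares of both sides is the squared
  seminorm of \<open>u * x\<close>.
\<close>

lemma seminorm_mult: "seminorm (b * x) \<le> norm b * seminorm x"
proof (rule power2_le_imp_le)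
  have "is_positive ((norm b)\<^sup>2 *\<^sub>R 1 - star b * b)"
    by (intro positive_diff_of_norm_le) (simp_all add: star_mult star_star cstar_identity)
  then obtain u where u: "is_positive u" "u * u = (norm b)\<^sup>2 *\<^sub>R 1 - star b * b"
    by (rule positive_sqrt)
  have su: "star u = u" using u(1) by (rule positive_selfadjoint)
  have "star (u * x) * (u * x) = star x * (u * u) * x" by (simp add: star_mult su mult.assoc)
  also have "\<dots> = (norm b)\<^sup>2 *\<^sub>R (star x * x) - star (b * x) * (b * x)"
    by (simp add: u(2) algebra_simps star_mult)
  finally have "0 \<le> Re (\<Phi> ((norm b)\<^sup>2 *\<^sub>R (star x * x) - star (b * x) * (b * x)))"
    by (metis functional_nonneg positive_star_mult_self)
  then show "(seminorm (b * x))\<^sup>2 \<le> (norm b * seminorm x)\<^sup>2"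
    by (simp add: functional_diff functional_scaleR seminorm_square power_mult_distrib form_def)
qed (simp add: seminorm_nonneg)

text \<open>
  A vector of the completion is represented by the antilinear functional
  \<open>\<lambda>a. lim (\<lambda>n. form (X n) a)\<close> of a Cauchy sequence \<open>X\<close>. The vector space operations are
  then the pointwise ones, and an element \<open>b\<close> of the algebra acts by
  \<open>h \<mapsto> (\<lambda>a. h (star b * a))\<close>.
\<close>

definition cauchy_seqs :: "(nat \<Rightarrow> 'b) set" where
  "cauchy_seqs = {X. \<forall>e>0. \<exists>M. \<forall>m\<ge>M. \<forall>n\<ge>M. seminorm (X m - X n) < e}"

definition limit_form :: "(nat \<Rightarrow> 'b) \<Rightarrow> (nat \<Rightarrow> 'b) \<Rightarrow> complex" where
  "limit_form X Y = lim (\<lambda>n. form (X n) (Y n))"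

definition vec :: "(nat \<Rightarrow> 'b) \<Rightarrow> 'b \<Rightarrow> complex" where
  "vec X a = limit_form X (\<lambda>_. a)"

lemma cauchy_seqs_const: "(\<lambda>_. a) \<in> cauchy_seqs"
  by (simp add: cauchy_seqs_def seminorm_def form_def functional_diff[of 0 0, simplified])

lemma cauchy_seqs_dominated:
  assumes X: "X \<in> cauchy_seqs" and K: "\<And>m n. seminorm (Z m - Z n) \<le> K * seminorm (X m - X n)"
  shows "Z \<in> cauchy_seqs"
  unfolding cauchy_seqs_def
proof (intro CollectI allI impI)
  fix e :: real assume e: "e > 0"
  have "e / (\<bar>K\<bar> + 1) > 0" using e by (simp add: add_nonneg_pos)
  then obtain M where M: "\<forall>m\<ge>M. \<forall>n\<ge>M. seminorm (X m - X n) < e / (\<bar>K\<bar> + 1)"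
    using X unfolding cauchy_seqs_def by blast
  have "seminorm (Z m - Z n) < e" if "m \<ge> M" "n \<ge> M" for m n
  proof -
    have "seminorm (Z m - Z n) \<le> (\<bar>K\<bar> + 1) * seminorm (X m - X n)"
      by (rule order_trans[OF K]) (simp add: mult_right_mono seminorm_nonneg)
    also have "\<dots> < (\<bar>K\<bar> + 1) * (e / (\<bar>K\<bar> + 1))"
      using M that by (intro mult_strict_left_mono) auto
    finally show ?thesis by simp
  qed
  then show "\<exists>M. \<forall>m\<ge>M. \<forall>n\<ge>M. seminorm (Z m - Z n) < e" by blast
qed

lemma cauchy_seqs_add:
  assumes X: "X \<in> cauchy_seqs" and Y: "Y \<in> cauchy_seqs"
  shows "(\<lambda>n. X n + Y n) \<in> cauchy_seqs"
  unfolding cauchy_seqs_def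
proof (intro CollectI allI impI)
  fix e :: real assume "e > 0"
  then have "e / 2 > 0" by simp
  then obtain M M' where M: "\<forall>m\<ge>M. \<forall>n\<ge>M. seminorm (X m - X n) < e / 2"
    "\<forall>m\<ge>M'. \<forall>n\<ge>M'. seminorm (Y m - Y n) < e / 2"
    using X Y unfolding cauchy_seqs_def by blast
  have "seminorm (X m + Y m - (X n + Y n)) < e" if "m \<ge> max M M'" "n \<ge> max M M'" for m n
  proof -
    have "seminorm (X m - X n) < e / 2" "seminorm (Y m - Y n) < e / 2" using M that by auto
    then show ?thesis
      using seminorm_triangle[of "X m - X n" "Y m - Y n"] by (simp add: algebra_simps)
  qed
  then show "\<exists>M. \<forall>m\<ge>M. \<forall>n\<ge>M. seminorm (X m + Y m - (X n + Y n)) < e" by blast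
qed

lemma cauchy_seqs_scaleC:
  assumes "X \<in> cauchy_seqs" shows "(\<lambda>n. c *\<^sub>C X n) \<in> cauchy_seqs"
  by (rule cauchy_seqs_dominated[OF assms, where K = "cmod c"])
    (simp_all add: scaleC_diff_right[symmetric] seminorm_scaleC)

lemma cauchy_seqs_mult:
  assumes "X \<in> cauchy_seqs" shows "(\<lambda>n. b * X n) \<in> cauchy_seqs"
  by (rule cauchy_seqs_dominated[OF assms, where K = "norm b"])
    (simp_all add: right_diff_distrib[symmetric] seminorm_mult)

lemma cauchy_seqs_diff:
  "X \<in> cauchy_seqs \<Longrightarrow> Y \<in> cauchy_seqs \<Longrightarrow> (\<lambda>n. X n - Y n) \<in> cauchy_seqs"
  using cauchy_seqs_add[OF _ cauchy_seqs_scaleC, of X Y "-1"] by (simp add: scaleC_minus_one)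

lemma cauchy_seqs_bounded:
  assumes X: "X \<in> cauchy_seqs" obtains B where "B > 0" "\<And>n. seminorm (X n) \<le> B"
proof -
  obtain M where M: "\<forall>m\<ge>M. \<forall>n\<ge>M. seminorm (X m - X n) < 1"
    using X unfolding cauchy_seqs_def by (auto dest: spec[of _ 1])
  define B where "B = 1 + seminorm (X M) + (\<Sum>i<M. seminorm (X i))"
  have s0: "(\<Sum>i<M. seminorm (X i)) \<ge> 0" by (simp add: sum_nonneg seminorm_nonneg)
  have "seminorm (X n) \<le> B" for n
  proof (cases "n < M")
    case True
    then have "seminorm (X n) \<le> (\<Sum>i<M. seminorm (X i))"
      by (intro member_le_sum) (auto simp: seminorm_nonneg)
    then show ?thesis using seminorm_nonneg[of "X M"] by (simp add: B_def)
  next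
    case False
    then have "seminorm (X n - X M) < 1" using M by simp
    then show ?thesis using seminorm_triangle[of "X n - X M" "X M"] s0 by (simp add: B_def)
  qed
  moreover have "B > 0" using s0 seminorm_nonneg[of "X M"] by (simp add: B_def)
  ultimately show thesis using that by blast
qed

lemma limit_form_tendsto:
  assumes X: "X \<in> cauchy_seqs" and Y: "Y \<in> cauchy_seqs"
  shows "(\<lambda>n. form (X n) (Y n)) \<longlonglongrightarrow> limit_form X Y"
proof -
  obtain B C where B: "B > 0" "\<And>n. seminorm (X n) \<le> B" and C: "C > 0" "\<And>n. seminorm (Y n) \<le> C"
    using cauchy_seqs_bounded[OF X] cauchy_seqs_bounded[OF Y] by metis
  have "Cauchy (\<lambda>n. form (X n) (Y n))"
  proof (rule metric_CauchyI)
    fix e :: real assume e: "e > 0"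
    obtain M where M: "\<forall>m\<ge>M. \<forall>n\<ge>M. seminorm (X m - X n) < e / (2 * C)"
      using X e C(1) unfolding cauchy_seqs_def by (auto dest: spec[of _ "e / (2 * C)"])
    obtain M' where M': "\<forall>m\<ge>M'. \<forall>n\<ge>M'. seminorm (Y m - Y n) < e / (2 * B)"
      using Y e B(1) unfolding cauchy_seqs_def by (auto dest: spec[of _ "e / (2 * B)"])
    have "dist (form (X m) (Y m)) (form (X n) (Y n)) < e" if "m \<ge> max M M'" "n \<ge> max M M'" for m n
    proof -
      have "form (X m) (Y m) - form (X n) (Y n) = form (X m - X n) (Y m) + form (X n) (Y m - Y n)"
        by (simp add: form_diff_left form_diff_right)
      then have "dist (form (X m) (Y m)) (form (X n) (Y n))
          \<le> cmod (form (X m - X n) (Y m)) + cmod (form (X n) (Y m - Y n))"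
        by (metis dist_norm norm_triangle_ineq)
      also have "\<dots> \<le> seminorm (X m - X n) * C + B * seminorm (Y m - Y n)"
        by (intro add_mono order_trans[OF form_cauchy_schwarz] mult_mono)
          (use B C in \<open>auto simp: seminorm_nonneg intro: less_imp_le\<close>)
      also have "\<dots> < (e / (2 * C)) * C + B * (e / (2 * B))"
        using M M' that B(1) C(1) by (intro add_strict_mono mult_strict_right_mono mult_strict_left_mono) auto
      finally show ?thesis using B(1) C(1) by simp
    qed
    then show "\<exists>M. \<forall>m\<ge>M. \<forall>n\<ge>M. dist (form (X m) (Y m)) (form (X n) (Y n)) < e" by blast
  qed
  then show ?thesis unfolding limit_form_def by (simp add: Cauchy_convergent convergent_LIMSEQ_iff[symmetric])
qed

lemma limit_form_eqI:
  "X \<in> cauchy_seqs \<Longrightarrow> Y \<in> cauchy_seqs \<Longrightarrow> (\<lambda>n. form (X n) (Y n)) \<longlonglongrightarrow> l \<Longrightarrow> limit_form X Y = l"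
  using limit_form_tendsto LIMSEQ_unique by blast

lemma limit_form_commute:
  assumes "X \<in> cauchy_seqs" "Y \<in> cauchy_seqs"
  shows "limit_form X Y = cnj (limit_form Y X)"
proof (rule limit_form_eqI[OF assms])
  show "(\<lambda>n. form (X n) (Y n)) \<longlonglongrightarrow> cnj (limit_form Y X)"
    by (subst form_commute) (intro tendsto_cnj limit_form_tendsto assms)
qed

lemma limit_form_add:
  assumes "X \<in> cauchy_seqs" "Y \<in> cauchy_seqs" "Z \<in> cauchy_seqs"
  shows "limit_form (\<lambda>n. X n + Y n) Z = limit_form X Z + limit_form Y Z"
  by (intro limit_form_eqI cauchy_seqs_add assms)
    (simp only: form_add_left, intro tendsto_add limit_form_tendsto assms)

lemma limit_form_scaleC:
  assumes "X \<in> cauchy_seqs" "Z \<in> cauchy_seqs"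
  shows "limit_form (\<lambda>n. c *\<^sub>C X n) Z = c * limit_form X Z"
  by (intro limit_form_eqI cauchy_seqs_scaleC assms)
    (simp only: form_scaleC_left, intro tendsto_mult_left limit_form_tendsto assms)

lemma limit_form_diff:
  assumes "X \<in> cauchy_seqs" "Y \<in> cauchy_seqs" "Z \<in> cauchy_seqs"
  shows "limit_form (\<lambda>n. X n - Y n) Z = limit_form X Z - limit_form Y Z"
  by (intro limit_form_eqI cauchy_seqs_diff assms)
    (simp only: form_diff_left, intro tendsto_diff limit_form_tendsto assms)

lemma limit_form_mult:
  assumes "X \<in> cauchy_seqs" "Y \<in> cauchy_seqs"
  shows "limit_form (\<lambda>n. b * X n) Y = limit_form X (\<lambda>n. star b * Y n)"
  unfolding limit_form_def by (simp add: form_mult)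

lemma limit_form_nonneg:
  assumes "X \<in> cauchy_seqs" shows "Re (limit_form X X) \<ge> 0"
  using tendsto_Re[OF limit_form_tendsto[OF assms assms]]
  by (rule LIMSEQ_le_const) (simp add: form_nonneg)

lemma limit_form_cauchy_schwarz:
  assumes "X \<in> cauchy_seqs" "Y \<in> cauchy_seqs"
  shows "(cmod (limit_form X Y))\<^sup>2 \<le> Re (limit_form X X) * Re (limit_form Y Y)"
proof (rule LIMSEQ_le)
  show "(\<lambda>n. (cmod (form (X n) (Y n)))\<^sup>2) \<longlonglongrightarrow> (cmod (limit_form X Y))\<^sup>2"
    by (intro tendsto_intros limit_form_tendsto assms)
  show "(\<lambda>n. Re (form (X n) (X n)) * Re (form (Y n) (Y n)))
      \<longlonglongrightarrow> Re (limit_form X X) * Re (limit_form Y Y)"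
    by (intro tendsto_intros limit_form_tendsto assms)
  have "(cmod (form (X n) (Y n)))\<^sup>2 \<le> Re (form (X n) (X n)) * Re (form (Y n) (Y n))" for n
    using power_mono[OF form_cauchy_schwarz[of "X n" "Y n"], of 2]
    by (simp add: power_mult_distrib seminorm_square)
  then show "\<exists>N. \<forall>n\<ge>N. (cmod (form (X n) (Y n)))\<^sup>2 \<le> Re (form (X n) (X n)) * Re (form (Y n) (Y n))"
    by blast
qed

text \<open>
  If \<open>vec Z\<close> vanishes, then \<open>form (Z n) (Z M)\<close> tends to \<open>0\<close> for fixed \<open>M\<close>, while
  \<open>form (Z n) (Z n - Z M)\<close> is uniformly small for large \<open>M\<close>.
\<close>

lemma limit_form_self_eq_0:
  assumes Z: "Z \<in> cauchy_seqs" and 0: "\<And>a. vec Z a = 0"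
  shows "limit_form Z Z = 0"
proof -
  obtain B where B: "B > 0" "\<And>n. seminorm (Z n) \<le> B" using cauchy_seqs_bounded[OF Z] by metis
  have "cmod (limit_form Z Z) \<le> e" if e: "e > 0" for e
  proof -
    obtain M where M: "\<forall>m\<ge>M. \<forall>n\<ge>M. seminorm (Z m - Z n) < e / B"
      using Z e B(1) unfolding cauchy_seqs_def by (auto dest: spec[of _ "e / B"])
    have "(\<lambda>n. form (Z n) (Z M)) \<longlonglongrightarrow> 0"
      using limit_form_tendsto[OF Z cauchy_seqs_const, of "Z M"] 0[of "Z M"] by (simp add: vec_def)
    from tendsto_diff[OF limit_form_tendsto[OF Z Z] this]
    have "(\<lambda>n. form (Z n) (Z n - Z M)) \<longlonglongrightarrow> limit_form Z Z" by (simp add: form_diff_right)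
    then have "(\<lambda>n. cmod (form (Z n) (Z n - Z M))) \<longlonglongrightarrow> cmod (limit_form Z Z)" by (rule tendsto_norm)
    moreover have "cmod (form (Z n) (Z n - Z M)) \<le> e" if "n \<ge> M" for n
    proof -
      have "seminorm (Z n - Z M) \<le> e / B" using M that by (simp add: less_imp_le)
      then have "seminorm (Z n) * seminorm (Z n - Z M) \<le> B * (e / B)"
        using B by (intro mult_mono) (auto simp: seminorm_nonneg less_imp_le)
      then have "cmod (form (Z n) (Z n - Z M)) \<le> B * (e / B)"
        by (rule order_trans[OF form_cauchy_schwarz])
      then show ?thesis using B(1) by simp
    qed
    ultimately show ?thesis by (intro LIMSEQ_le_const2[of _ _ e]) auto
  qed
  then have "cmod (limit_form Z Z) \<le> 0" by (rule field_le_epsilon[of _ 0, simplified])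
  then show ?thesis by simp
qed

text \<open>
  The limit form depends on the vectors only, not on the sequences that represent them.
\<close>

lemma limit_form_cong:
  assumes "X \<in> cauchy_seqs" "X' \<in> cauchy_seqs" "Y \<in> cauchy_seqs" "vec X = vec X'"
  shows "limit_form X Y = limit_form X' Y"
proof -
  let ?Z = "\<lambda>n. X n - X' n"
  have Z: "?Z \<in> cauchy_seqs" by (intro cauchy_seqs_diff assms)
  have "vec ?Z a = 0" for a
    using assms(4) by (simp add: vec_def fun_eq_iff limit_form_diff assms(1,2) cauchy_seqs_const)
  then have "limit_form ?Z ?Z = 0" by (rule limit_form_self_eq_0[OF Z])
  then have "limit_form ?Z Y = 0"
    using limit_form_cauchy_schwarz[OF Z assms(3)] by simp
  then show ?thesis by (simp add: limit_form_diff assms)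
qed

definition space :: "('b \<Rightarrow> complex) set" where
  "space = vec ` cauchy_seqs"

definition representative :: "('b \<Rightarrow> complex) \<Rightarrow> nat \<Rightarrow> 'b" where
  "representative h = (SOME X. X \<in> cauchy_seqs \<and> vec X = h)"

definition inner :: "('b \<Rightarrow> complex) \<Rightarrow> ('b \<Rightarrow> complex) \<Rightarrow> complex" where
  "inner h k = limit_form (representative h) (representative k)"

definition add :: "('b \<Rightarrow> complex) \<Rightarrow> ('b \<Rightarrow> complex) \<Rightarrow> 'b \<Rightarrow> complex" where
  "add h k = (\<lambda>a. h a + k a)"

definition scale :: "complex \<Rightarrow> ('b \<Rightarrow> complex) \<Rightarrow> 'b \<Rightarrow> complex" where
  "scale c h = (\<lambda>a. c * h a)"

definition action :: "'b \<Rightarrow> ('b \<Rightarrow> complex) \<Rightarrow> 'b \<Rightarrow> complex" where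
  "action b h = (\<lambda>a. h (star b * a))"

definition cyclic :: "'b \<Rightarrow> complex" where
  "cyclic = vec (\<lambda>_. 1)"

lemma inner_vec:
  assumes X: "X \<in> cauchy_seqs" and Y: "Y \<in> cauchy_seqs"
  shows "inner (vec X) (vec Y) = limit_form X Y"
proof -
  have r: "representative (vec Z) \<in> cauchy_seqs \<and> vec (representative (vec Z)) = vec Z"
    if "Z \<in> cauchy_seqs" for Z
    unfolding representative_def by (rule someI[of _ Z]) (simp add: that)
  have "inner (vec X) (vec Y) = limit_form X (representative (vec Y))"
    unfolding inner_def using r[OF X] r[OF Y] X by (intro limit_form_cong) auto
  also have "\<dots> = cnj (limit_form (representative (vec Y)) X)"
    using r[OF Y] X by (intro limit_form_commute) auto
  also have "limit_form (representative (vec Y)) X = limit_form Y X"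
    using r[OF Y] X Y by (intro limit_form_cong) auto
  finally show ?thesis by (simp add: limit_form_commute[OF X Y])
qed

lemma vec_add:
  "X \<in> cauchy_seqs \<Longrightarrow> Y \<in> cauchy_seqs \<Longrightarrow> add (vec X) (vec Y) = vec (\<lambda>n. X n + Y n)"
  by (simp add: add_def vec_def fun_eq_iff limit_form_add cauchy_seqs_const)

lemma vec_scaleC: "X \<in> cauchy_seqs \<Longrightarrow> scale c (vec X) = vec (\<lambda>n. c *\<^sub>C X n)"
  by (simp add: scale_def vec_def fun_eq_iff limit_form_scaleC cauchy_seqs_const)

lemma vec_mult: "X \<in> cauchy_seqs \<Longrightarrow> action b (vec X) = vec (\<lambda>n. b * X n)"
  by (simp add: action_def vec_def fun_eq_iff limit_form_mult cauchy_seqs_const)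

lemma space_cases:
  assumes "h \<in> space" obtains X where "X \<in> cauchy_seqs" "h = vec X"
  using assms by (auto simp: space_def)

lemma vec_in_space: "X \<in> cauchy_seqs \<Longrightarrow> vec X \<in> space"
  by (simp add: space_def)

lemma add_in_space: "h \<in> space \<Longrightarrow> k \<in> space \<Longrightarrow> add h k \<in> space"
  by (elim space_cases) (simp add: vec_add vec_in_space cauchy_seqs_add)

lemma scale_in_space: "h \<in> space \<Longrightarrow> scale c h \<in> space"
  by (elim space_cases) (simp add: vec_scaleC vec_in_space cauchy_seqs_scaleC)

lemma zero_in_space: "(\<lambda>_. 0) \<in> space"
  using scale_in_space[OF vec_in_space[OF cauchy_seqs_const], of 0] by (simp add: scale_def)

sublocale complex_inner_product_space space add "\<lambda>_. 0" scale inner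
proof
  fix x y z :: "'b \<Rightarrow> complex" and c d :: complex
  show "(\<lambda>_. 0) \<in> space" by (rule zero_in_space)
  show "x \<in> space \<Longrightarrow> y \<in> space \<Longrightarrow> add x y \<in> space" by (rule add_in_space)
  show "x \<in> space \<Longrightarrow> scale c x \<in> space" by (rule scale_in_space)
  show "add (add x y) z = add x (add y z)" "add x y = add y x" "add x (\<lambda>_. 0) = x"
    "add x (scale (- 1) x) = (\<lambda>_. 0)" "scale c (add x y) = add (scale c x) (scale c y)"
    "scale (c + d) x = add (scale c x) (scale d x)" "scale c (scale d x) = scale (c * d) x"
    "scale 1 x = x"
    by (simp_all add: add_def scale_def fun_eq_iff algebra_simps)
  assume x: "x \<in> space"
  then obtain X where X: "X \<in> cauchy_seqs" "x = vec X" by (rule space_cases)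
  show "Re (inner x x) > 0" if "x \<noteq> (\<lambda>_. 0)"
  proof (rule ccontr)
    assume "\<not> Re (inner x x) > 0"
    then have "Re (limit_form X X) = 0" using limit_form_nonneg[OF X(1)] by (simp add: X inner_vec)
    then have "vec X a = 0" for a
      using limit_form_cauchy_schwarz[OF X(1) cauchy_seqs_const, of a] by (simp add: vec_def)
    then show False using that X by auto
  qed
  assume y: "y \<in> space"
  then obtain Y where Y: "Y \<in> cauchy_seqs" "y = vec Y" by (rule space_cases)
  show "inner (scale c x) y = c * inner x y"
    using X Y by (simp add: vec_scaleC inner_vec cauchy_seqs_scaleC limit_form_scaleC)
  show "inner x y = cnj (inner y x)"
    using X Y by (simp add: inner_vec limit_form_commute[symmetric])
  assume "z \<in> space"
  then obtain Z where Z: "Z \<in> cauchy_seqs" "z = vec Z" by (rule space_cases)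
  show "inner (add x y) z = inner x z + inner y z"
    using X Y Z by (simp add: vec_add inner_vec cauchy_seqs_add limit_form_add)
qed

lemma hdist_vec_tendsto:
  assumes "X \<in> cauchy_seqs" "Y \<in> cauchy_seqs"
  shows "(\<lambda>n. seminorm (X n - Y n)) \<longlonglongrightarrow> hdist (vec X) (vec Y)"
proof -
  let ?Z = "\<lambda>n. X n - Y n"
  have Z: "?Z \<in> cauchy_seqs" by (intro cauchy_seqs_diff assms)
  have "add (vec X) (scale (- 1) (vec Y)) = vec ?Z"
    using vec_add[OF assms(1) cauchy_seqs_scaleC[OF assms(2)], of "-1"]
    by (simp add: vec_scaleC assms scaleC_minus_one)
  then have "hdist (vec X) (vec Y) = sqrt (Re (limit_form ?Z ?Z))"
    by (simp add: hdist_def hnorm_def inner_vec[OF Z Z])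
  then show ?thesis
    unfolding seminorm_def using limit_form_tendsto[OF Z Z] by (simp add: tendsto_intros)
qed

lemma hdist_vec_const: "hdist (vec (\<lambda>_. a)) (vec (\<lambda>_. b)) = seminorm (a - b)"
  using hdist_vec_tendsto[OF cauchy_seqs_const cauchy_seqs_const, of a b]
  by (simp add: LIMSEQ_const_iff)

lemma dense_const:
  assumes "h \<in> space" "e > 0" obtains a where "hdist h (vec (\<lambda>_. a)) < e"
proof -
  obtain X where X: "X \<in> cauchy_seqs" "h = vec X" using assms(1) by (rule space_cases)
  obtain M where M: "\<forall>m\<ge>M. \<forall>n\<ge>M. seminorm (X m - X n) < e / 2"
    using X(1) assms(2) unfolding cauchy_seqs_def by (auto dest: spec[of _ "e / 2"])
  have "hdist (vec X) (vec (\<lambda>_. X M)) \<le> e / 2"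
    using hdist_vec_tendsto[OF X(1) cauchy_seqs_const, of "X M"]
    by (rule LIMSEQ_le_const2) (use M in \<open>auto intro!: exI[of _ M] less_imp_le\<close>)
  then show thesis using that[of "X M"] assms(2) X(2) by simp
qed

sublocale complex_hilbert_space space add "\<lambda>_. 0" scale inner
proof
  fix X assume X: "\<And>n. X n \<in> space" and C: "hcauchy X"
  have "\<exists>a. hdist (X n) (vec (\<lambda>_. a)) < 1 / real (Suc n)" for n
    using dense_const[OF X, of "1 / real (Suc n)" n] by (metis of_nat_0_less_iff zero_less_Suc zero_less_divide_1_iff)
  then obtain y where y: "\<And>n. hdist (X n) (vec (\<lambda>_. y n)) < 1 / real (Suc n)" by metis
  have v: "vec (\<lambda>_. a) \<in> space" for a by (intro vec_in_space cauchy_seqs_const)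
  have small: "\<exists>M. \<forall>n\<ge>M. 1 / real (Suc n) < e" if e: "e > 0" for e :: real
  proof -
    obtain M where "1 / real (Suc M) < e" using reals_Archimedean[OF e] by (auto simp: inverse_eq_divide)
    then show ?thesis by (intro exI[of _ M]) (auto intro: order_le_less_trans[rotated] simp: frac_le)
  qed
  have "y \<in> cauchy_seqs"
    unfolding cauchy_seqs_def
  proof (intro CollectI allI impI)
    fix e :: real assume "e > 0"
    then have e3: "e / 3 > 0" by simp
    obtain M where M: "\<forall>m\<ge>M. \<forall>n\<ge>M. hdist (X m) (X n) < e / 3"
      using C e3 unfolding hcauchy_def by blast
    obtain M' where M': "\<forall>n\<ge>M'. 1 / real (Suc n) < e / 3" using small[OF e3] by blast
    have "seminorm (y m - y n) < e" if "m \<ge> max M M'" "n \<ge> max M M'" for m n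
    proof -
      have "hdist (vec (\<lambda>_. y m)) (vec (\<lambda>_. y n))
          \<le> hdist (vec (\<lambda>_. y m)) (X m) + (hdist (X m) (X n) + hdist (X n) (vec (\<lambda>_. y n)))"
        using hdist_triangle[OF v X v] hdist_triangle[OF X X v] by (meson add_left_mono order_trans)
      moreover have "hdist (vec (\<lambda>_. y m)) (X m) < e / 3"
        using y[of m] M' that hdist_commute[OF v X] by (metis max.bounded_iff order_less_trans)
      moreover have "hdist (X n) (vec (\<lambda>_. y n)) < e / 3"
        using y[of n] M' that by (metis max.bounded_iff order_less_trans)
      moreover have "hdist (X m) (X n) < e / 3" using M that by simp
      ultimately show ?thesis by (simp add: hdist_vec_const)
    qed
    then show "\<exists>M. \<forall>m\<ge>M. \<forall>n\<ge>M. seminorm (y m - y n) < e" by blast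
  qed
  note yC = this
  have "(\<lambda>n. hdist (X n) (vec y)) \<longlonglongrightarrow> 0"
  proof (rule LIMSEQ_I)
    fix e :: real assume "e > 0"
    then have e3: "e / 3 > 0" by simp
    obtain M where M: "\<forall>m\<ge>M. \<forall>n\<ge>M. seminorm (y m - y n) < e / 3"
      using yC e3 unfolding cauchy_seqs_def by blast
    obtain M' where M': "\<forall>n\<ge>M'. 1 / real (Suc n) < e / 3" using small[OF e3] by blast
    have "norm (hdist (X n) (vec y) - 0) < e" if "n \<ge> max M M'" for n
    proof -
      have "hdist (vec (\<lambda>_. y n)) (vec y) \<le> e / 3"
        using hdist_vec_tendsto[OF cauchy_seqs_const yC, of "y n"]
        by (rule LIMSEQ_le_const2) (use M that in \<open>auto intro!: exI[of _ M] less_imp_le\<close>)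
      moreover have "hdist (X n) (vec (\<lambda>_. y n)) < e / 3"
        using y[of n] M' that by (metis max.bounded_iff order_less_trans)
      moreover have "hdist (X n) (vec y) \<ge> 0" by (intro hdist_nonneg X vec_in_space yC)
      ultimately show ?thesis
        using hdist_triangle[OF X v vec_in_space[OF yC], of n "y n"] e3 by simp
    qed
    then show "\<exists>N. \<forall>n\<ge>N. norm (hdist (X n) (vec y) - 0) < e" by blast
  qed
  then show "\<exists>l\<in>space. (\<lambda>n. hdist (X n) l) \<longlonglongrightarrow> 0" using vec_in_space[OF yC] by blast
qed

lemma hnorm_action_le:
  assumes "h \<in> space" shows "hnorm (action b h) \<le> norm b * hnorm h"
proof -
  obtain X where X: "X \<in> cauchy_seqs" "h = vec X" using assms by (rule space_cases)
  have bX: "(\<lambda>n. b * X n) \<in> cauchy_seqs" by (rule cauchy_seqs_mult[OF X(1)])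
  have "sqrt (Re (limit_form (\<lambda>n. b * X n) (\<lambda>n. b * X n))) \<le> norm b * sqrt (Re (limit_form X X))"
  proof (rule LIMSEQ_le)
    show "(\<lambda>n. seminorm (b * X n)) \<longlonglongrightarrow> sqrt (Re (limit_form (\<lambda>n. b * X n) (\<lambda>n. b * X n)))"
      unfolding seminorm_def by (intro tendsto_intros limit_form_tendsto bX)
    show "(\<lambda>n. norm b * seminorm (X n)) \<longlonglongrightarrow> norm b * sqrt (Re (limit_form X X))"
      unfolding seminorm_def by (intro tendsto_intros limit_form_tendsto X)
  qed (use seminorm_mult in blast)
  then show ?thesis by (simp add: hnorm_def X vec_mult inner_vec bX)
qed

sublocale star_representation space add "\<lambda>_. 0" scale inner action
proof
  fix x y :: "'b \<Rightarrow> complex" and a b :: 'b and c :: complex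
  show "action a (add x y) = add (action a x) (action a y)"
    "action a (scale c x) = scale c (action a x)" "action (a * b) x = action a (action b x)"
    by (simp_all add: action_def add_def scale_def star_mult mult.assoc)
  show "\<exists>B. \<forall>x\<in>space. hnorm (action a x) \<le> B * hnorm x" using hnorm_action_le by blast
  assume "x \<in> space"
  then obtain X where X: "X \<in> cauchy_seqs" "x = vec X" by (rule space_cases)
  show "action a x \<in> space" using X by (simp add: vec_mult vec_in_space cauchy_seqs_mult)
  show "action (a + b) x = add (action a x) (action b x)"
    using X by (simp add: vec_mult vec_add cauchy_seqs_mult distrib_right)
  show "action (c *\<^sub>C a) x = scale c (action a x)"
    using X by (simp add: vec_mult vec_scaleC cauchy_seqs_mult mult_scaleC_left)
  assume "y \<in> space"
  then obtain Y where Y: "Y \<in> cauchy_seqs" "y = vec Y" by (rule space_cases)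
  show "inner (action (star a) x) y = inner x (action a y)"
    using X Y by (simp add: vec_mult inner_vec cauchy_seqs_mult limit_form_mult star_star)
qed

lemma cyclic_in_space: "cyclic \<in> space"
  unfolding cyclic_def by (intro vec_in_space cauchy_seqs_const)

lemma action_one: "action 1 h = h"
  by (simp add: action_def)

text \<open>
  The reproducing property: the value of a vector at \<open>a\<close> is its inner product with the orbit
  point of \<open>a\<close>. A vector orthogonal to the orbit of \<open>cyclic\<close> is therefore zero.
\<close>

lemma inner_action_cyclic: assumes "h \<in> space" shows "inner h (action a cyclic) = h a"
proof -
  obtain X where X: "X \<in> cauchy_seqs" "h = vec X" using assms by (rule space_cases)
  show ?thesis
    using X by (simp add: cyclic_def vec_mult inner_vec cauchy_seqs_const vec_def)
qed

lemma inner_action_cyclic_cyclic: "inner (action a cyclic) cyclic = \<Phi> a"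
proof -
  have "limit_form (\<lambda>_. a) (\<lambda>_. 1) = form a 1"
    by (intro limit_form_eqI cauchy_seqs_const) simp
  then show ?thesis
    by (simp add: cyclic_def vec_mult inner_vec cauchy_seqs_const form_def)
qed

end


section \<open>Irreducible representations from left ideals\<close>

text \<open>
  Let \<open>\<eta>\<close> and \<open>\<zeta>\<close> be the components of \<open>cyclic\<close> in an invariant subspace and in its orthogonal
  complement. If both are nonzero, the hypothesis makes \<open>\<eta>\<close> a multiple \<open>t\<close> of \<open>cyclic\<close> with
  \<open>t = \<bar>t\<bar>\<^sup>2\<close>, which forces \<open>\<zeta> = 0\<close>. If one of them is zero, \<open>cyclic\<close> lies in the subspace or is
  orthogonal to it.
\<close>

lemma (in positive_functional) irreducible_of_extreme:
  assumes one: "\<Phi> 1 = 1"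
    and extreme: "\<And>\<eta> \<zeta>. \<lbrakk>\<eta> \<in> space; \<zeta> \<in> space; cyclic = add \<eta> \<zeta>;
        \<And>b. inner (action b \<eta>) \<zeta> = 0; \<eta> \<noteq> (\<lambda>_. 0); \<zeta> \<noteq> (\<lambda>_. 0)\<rbrakk>
      \<Longrightarrow> \<forall>b. inner (action b \<eta>) \<eta> = inner \<eta> \<eta> * \<Phi> b"
  shows "irreducible_representation space add (\<lambda>_. 0) scale inner action"
proof
  have cc: "inner cyclic cyclic = 1"
    using inner_action_cyclic_cyclic[of 1] by (simp add: action_one one)
  have "cyclic \<noteq> (\<lambda>_. 0)" using cc ip_zero_left[OF cyclic_in_space] by auto
  then show "\<exists>a. \<exists>x\<in>space. action a x \<noteq> (\<lambda>_. 0)"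
    using cyclic_in_space by (metis action_one)
  fix K assume K: "closed_subspace K" and inv: "\<And>a x. x \<in> K \<Longrightarrow> action a x \<in> K"
  have KH: "K \<subseteq> space" and K0: "(\<lambda>_. 0) \<in> K" using K by (auto simp: closed_subspace_def)
  obtain \<eta> \<zeta> where \<eta>: "\<eta> \<in> K" and \<zeta>: "\<zeta> \<in> space" and sum: "cyclic = add \<eta> \<zeta>"
    and orth: "\<And>y. y \<in> K \<Longrightarrow> inner \<zeta> y = 0"
    using orthogonal_decomposition[OF K cyclic_in_space] by metis
  have \<eta>H: "\<eta> \<in> space" using \<eta> KH by blast
  consider "\<eta> = (\<lambda>_. 0)" | "\<zeta> = (\<lambda>_. 0)" | "\<eta> \<noteq> (\<lambda>_. 0)" "\<zeta> \<noteq> (\<lambda>_. 0)" by blast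
  then show "K = {\<lambda>_. 0} \<or> K = space"
  proof cases
    case 1
    then have c: "cyclic = \<zeta>" using sum by (simp add: add_def)
    have "k a = 0" if k: "k \<in> K" for k a
    proof -
      have "k a = inner (action (star a) k) cyclic"
        using k KH by (subst rep_star) (auto simp: inner_action_cyclic cyclic_in_space)
      also have "\<dots> = cnj (inner \<zeta> (action (star a) k))"
        unfolding c using k KH inv \<zeta> by (intro ip_commute) auto
      finally show ?thesis using orth[OF inv[OF k]] by simp
    qed
    then have "k = (\<lambda>_. 0)" if "k \<in> K" for k using that by auto
    then show ?thesis using K0 by blast
  next
    case 2
    then have c: "cyclic \<in> K" using sum \<eta> by (simp add: add_def)
    have "x \<in> K" if x: "x \<in> space" for x
    proof -
      obtain k z where kz: "k \<in> K" "z \<in> space" "x = add k z" "\<And>y. y \<in> K \<Longrightarrow> inner z y = 0"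
        using orthogonal_decomposition[OF K x] by metis
      have "z a = 0" for a using kz(4)[OF inv[OF c]] inner_action_cyclic[OF kz(2)] by metis
      then show ?thesis using kz by (simp add: add_def)
    qed
    then show ?thesis using KH by blast
  next
    case 3
    have orth': "inner (action b \<eta>) \<zeta> = 0" for b
      using orth[OF inv[OF \<eta>], of b] ip_commute[OF op_closed[OF \<eta>H] \<zeta>, of b] by simp
    define t where "t = inner \<eta> \<eta>"
    have ext: "inner (action b \<eta>) \<eta> = t * \<Phi> b" for b
      using extreme[OF \<eta>H \<zeta> sum orth' 3] by (simp add: t_def)
    have "\<eta> a = t * cyclic a" for a
    proof -
      have "\<eta> a = inner (action (star a) \<eta>) cyclic"
        using \<eta>H by (simp add: rep_star inner_action_cyclic cyclic_in_space)
      also have "\<dots> = t * \<Phi> (star a)"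
        unfolding sum using \<eta>H \<zeta> by (simp add: ip_add_right op_closed ext orth')
      also have "\<Phi> (star a) = inner (action (star a) cyclic) cyclic"
        by (simp add: inner_action_cyclic_cyclic)
      also have "\<dots> = cyclic a"
        by (simp add: rep_star cyclic_in_space inner_action_cyclic)
      finally show ?thesis .
    qed
    then have \<eta>t: "\<eta> = scale t cyclic" by (auto simp: scale_def)
    have "t = t * cnj t"
      unfolding t_def by (subst (1 2) \<eta>t)
        (simp add: ip_scale_left ip_scale_right cyclic_in_space scale_closed cc t_def)
    moreover have "t \<noteq> 0" using ip_pos[OF \<eta>H 3(1)] by (auto simp: t_def)
    ultimately have "cnj t = 1" by simp
    then have "t = 1" by (metis complex_cnj_cnj complex_cnj_one)
    then have "\<zeta> = (\<lambda>_. 0)" using \<eta>t sum by (auto simp: scale_def add_def fun_eq_iff)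
    then show ?thesis using 3 by blast
  qed
qed

lemma positive_functional_complexify:
  assumes \<phi>: "real_state \<phi>" shows "positive_functional (complexify \<phi>)"
proof
  have lin: "linear \<phi>" using \<phi> by (simp add: real_state_def)
  fix x y :: 'a and c
  show "complexify \<phi> (x + y) = complexify \<phi> x + complexify \<phi> y"
    by (simp add: complexify_def complex_eq_iff scaleC_add_right linear_add[OF lin])
  have c: "c *\<^sub>C z = Re c *\<^sub>R z + Im c *\<^sub>R (\<i> *\<^sub>C z)" for z :: 'a
    by (subst complex_eq[of c])
      (simp add: scaleC_add_left scaleC_scaleC[symmetric] scaleC_of_real scaleC_scaleR mult.commute)
  have "\<i> *\<^sub>C c *\<^sub>C x = Re c *\<^sub>R (\<i> *\<^sub>C x) - Im c *\<^sub>R x"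
    by (subst c) (simp add: scaleC_add_right scaleC_scaleR scaleC_scaleC scaleC_minus_one)
  then show "complexify \<phi> (c *\<^sub>C x) = c * complexify \<phi> x"
    using c[of x]
    by (simp add: complexify_def complex_eq_iff linear_add[OF lin] linear_diff[OF lin] linear_cmul[OF lin])
  have "\<i> *\<^sub>C star x = - star (\<i> *\<^sub>C x)" by (simp add: star_scaleC scaleC_minus_left)
  then show "complexify \<phi> (star x) = cnj (complexify \<phi> x)"
    by (simp add: complexify_def complex_eq_iff real_state_star[OF \<phi>] linear_neg[OF lin])
  show "Re (complexify \<phi> x) \<ge> 0" if "is_positive x"
    using real_state_nonneg[OF \<phi> that] by (simp add: complexify_def)
qed

lemma real_state_vector_state:
  fixes \<pi> :: "'a::unital_cstar_algebra \<Rightarrow> 'h \<Rightarrow> 'h"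
  assumes rep: "star_representation H vadd vzero vscale ip \<pi>"
    and x: "x \<in> H" "x \<noteq> vzero" and one: "\<pi> 1 x = x"
  shows "real_state (\<lambda>b. Re (ip (\<pi> b x) x) / Re (ip x x))"
proof -
  interpret star_representation H vadd vzero vscale ip \<pi> by (rule rep)
  have p: "Re (ip x x) > 0" by (rule ip_pos[OF x])
  show ?thesis
    unfolding real_state_def
  proof (intro conjI allI linearI)
    fix a b and r :: real
    show "Re (ip (\<pi> (a + b) x) x) / Re (ip x x) = Re (ip (\<pi> a x) x) / Re (ip x x) + Re (ip (\<pi> b x) x) / Re (ip x x)"
      using x(1) by (simp add: rep_add ip_add_left op_closed add_divide_distrib)
    show "Re (ip (\<pi> (r *\<^sub>R a) x) x) / Re (ip x x) = r *\<^sub>R (Re (ip (\<pi> a x) x) / Re (ip x x))"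
      using x(1) by (simp add: rep_scaleR ip_scale_left op_closed)
    have "Re (ip (\<pi> a x) x) \<le> hnorm (\<pi> a x) * hnorm x"
      using cauchy_schwarz[OF op_closed[OF x(1)] x(1), of a] complex_Re_le_cmod[of "ip (\<pi> a x) x"]
      by linarith
    also have "\<dots> \<le> (norm a * hnorm x) * hnorm x"
      by (intro mult_right_mono rep_contractive hnorm_nonneg x)
    also have "\<dots> = norm a * Re (ip x x)"
      using hnorm_square[OF x(1)] by (simp add: power2_eq_square)
    finally show "Re (ip (\<pi> a x) x) / Re (ip x x) \<le> norm a" using p by (simp add: field_simps)
  qed (use p one in simp)
qed

text \<open>
  The GNS representation of an extreme state \<open>\<phi>\<close> among those that vanish on \<open>L\<close>. When \<open>cyclic\<close>
  splits into \<open>\<eta>\<close> and \<open>\<zeta>\<close> with the orbit of \<open>\<eta>\<close> orthogonal to \<open>\<zeta>\<close>, then \<open>\<phi>\<close> is a convex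
  combination of the vector states of \<open>\<eta>\<close> and \<open>\<zeta>\<close>. Elements of \<open>L\<close> annihilate \<open>cyclic\<close> and
  hence both components, so these vector states vanish on \<open>L\<close> as well and extremality applies.
\<close>

theorem irreducible_representation_of_left_ideal:
  fixes L :: "'a::unital_cstar_algebra set"
  assumes L: "left_ideal L" "1 \<notin> L"
  shows "\<exists>(H :: ('a \<Rightarrow> complex) set) vadd vzero vscale ip \<pi> \<xi>.
    irreducible_representation H vadd vzero vscale ip \<pi> \<and> \<xi> \<in> H \<and> \<xi> \<noteq> vzero \<and>
    (\<forall>x\<in>H. \<pi> 1 x = x) \<and> (\<forall>l\<in>L. \<pi> l \<xi> = vzero)"
proof -
  obtain \<phi> where \<phi>: "real_state \<phi>" and \<phi>L: "\<And>l. l \<in> L \<Longrightarrow> \<phi> l = 0"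
    and ext: "\<And>\<psi> \<theta> t. \<lbrakk>real_state \<psi>; real_state \<theta>; \<And>l. l \<in> L \<Longrightarrow> \<psi> l = 0; \<And>l. l \<in> L \<Longrightarrow> \<theta> l = 0;
        0 < t; t < 1; \<And>x. \<phi> x = t * \<psi> x + (1 - t) * \<theta> x\<rbrakk> \<Longrightarrow> \<psi> = \<phi>"
    by (rule extreme_real_state_exists[OF L]) blast
  define \<Phi> where "\<Phi> = complexify \<phi>"
  interpret positive_functional \<Phi>
    unfolding \<Phi>_def by (rule positive_functional_complexify[OF \<phi>])
  have Re\<Phi>: "Re (\<Phi> x) = \<phi> x" for x by (simp add: \<Phi>_def complexify_def)
  have one: "\<Phi> 1 = 1"
    using \<phi> real_state_skew[OF \<phi>, of 1] by (simp add: \<Phi>_def complexify_def real_state_def complex_eq_iff)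
  have Lc: "action l cyclic = (\<lambda>_. 0)" if l: "l \<in> L" for l
  proof -
    have "star l * l \<in> L" using l L(1) by (simp add: left_ideal_def)
    then have "Re (inner (action (star l * l) cyclic) cyclic) = 0"
      by (simp add: inner_action_cyclic_cyclic Re\<Phi> \<phi>L)
    then have "hnorm (action l cyclic) = 0"
      by (simp add: ip_rep_star_mult cyclic_in_space)
    then show ?thesis using hnorm_zero_iff[OF op_closed[OF cyclic_in_space]] by blast
  qed
  have "irreducible_representation space add (\<lambda>_. 0) scale inner action"
  proof (rule irreducible_of_extreme[OF one])
    fix \<eta> \<zeta>
    assume \<eta>: "\<eta> \<in> space" "\<eta> \<noteq> (\<lambda>_. 0)" and \<zeta>: "\<zeta> \<in> space" "\<zeta> \<noteq> (\<lambda>_. 0)"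
      and sum: "cyclic = add \<eta> \<zeta>" and orth: "\<And>b. inner (action b \<eta>) \<zeta> = 0"
    have orth': "inner (action b \<zeta>) \<eta> = 0" for b
      using orth[of "star b"] ip_rep[OF \<zeta>(1) \<eta>(1), of b]
        ip_commute[OF \<zeta>(1) op_closed[OF \<eta>(1)], of "star b"] by simp
    have split: "inner (action b cyclic) cyclic = inner (action b \<eta>) \<eta> + inner (action b \<zeta>) \<zeta>" for b
      unfolding sum using \<eta>(1) \<zeta>(1)
      by (simp add: op_add ip_add_left ip_add_right add_closed op_closed orth orth')
    define t where "t = Re (inner \<eta> \<eta>)"
    define s where "s = Re (inner \<zeta> \<zeta>)"
    have ts: "t > 0" "s > 0" "t + s = 1"
      using ip_pos[OF \<eta>] ip_pos[OF \<zeta>] split[of 1] one inner_action_cyclic_cyclic[of 1]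
      by (simp_all add: t_def s_def action_one complex_eq_iff)
    have zero: "action l \<eta> = (\<lambda>_. 0) \<and> action l \<zeta> = (\<lambda>_. 0)" if l: "l \<in> L" for l
    proof -
      have a: "action l \<eta> \<in> space" "action l \<zeta> \<in> space" using \<eta> \<zeta> by (simp_all add: op_closed)
      have "inner (action l \<eta>) (action l \<zeta>) = 0" "inner (action l \<zeta>) (action l \<eta>) = 0"
        using orth[of "star l * l"] orth'[of "star l * l"] \<eta>(1) \<zeta>(1)
        by (simp_all add: rep_mult rep_star op_closed)
      moreover have "add (action l \<eta>) (action l \<zeta>) = (\<lambda>_. 0)"
        using Lc[OF l] \<eta>(1) \<zeta>(1) by (simp add: sum op_add)
      then have "inner (add (action l \<eta>) (action l \<zeta>)) (action l \<eta>) = 0"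
        "inner (add (action l \<eta>) (action l \<zeta>)) (action l \<zeta>) = 0"
        using a by (simp_all add: ip_zero_left)
      ultimately have "inner (action l \<eta>) (action l \<eta>) = 0" "inner (action l \<zeta>) (action l \<zeta>) = 0"
        using a by (simp_all add: ip_add_left)
      then show ?thesis using a ip_pos by (metis order_less_irrefl zero_complex.sel(1))
    qed
    define \<psi> where "\<psi> b = Re (inner (action b \<eta>) \<eta>) / Re (inner \<eta> \<eta>)" for b
    have \<psi>: "\<psi> = \<phi>"
    proof (rule ext)
      show "real_state \<psi>" unfolding \<psi>_def
        by (fact real_state_vector_state[where \<pi> = action, OF star_representation_axioms \<eta> action_one])
      show "real_state (\<lambda>b. Re (inner (action b \<zeta>) \<zeta>) / Re (inner \<zeta> \<zeta>))"
        by (fact real_state_vector_state[where \<pi> = action, OF star_representation_axioms \<zeta> action_one])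
      show "\<psi> l = 0" "Re (inner (action l \<zeta>) \<zeta>) / Re (inner \<zeta> \<zeta>) = 0" if "l \<in> L" for l
        using zero[OF that] \<eta> \<zeta> by (simp_all add: \<psi>_def ip_zero_left)
      show "0 < t" "t < 1" using ts by simp_all
      show "\<phi> x = t * \<psi> x + (1 - t) * (Re (inner (action x \<zeta>) \<zeta>) / Re (inner \<zeta> \<zeta>))" for x
      proof -
        have "1 - t = s" using ts by simp
        then show ?thesis
          using split[of x] ts(1,2) Re\<Phi>[of x] inner_action_cyclic_cyclic[of x]
          by (simp add: \<psi>_def t_def[symmetric] s_def[symmetric])
      qed
    qed
    have re: "Re (inner (action b \<eta>) \<eta>) = t * \<phi> b" for b
      using fun_cong[OF \<psi>, of b] ts(1) by (simp add: \<psi>_def t_def[symmetric] field_simps)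
    have "inner (action b \<eta>) \<eta> = inner \<eta> \<eta> * \<Phi> b" for b
    proof -
      have "inner \<eta> \<eta> = complex_of_real t" using ip_self_real[OF \<eta>(1)] by (simp add: t_def)
      moreover have "inner (action (\<i> *\<^sub>C b) \<eta>) \<eta> = \<i> * inner (action b \<eta>) \<eta>"
        using \<eta>(1) by (simp add: rep_scale ip_scale_left op_closed)
      then have "Im (inner (action b \<eta>) \<eta>) = - t * \<phi> (\<i> *\<^sub>C b)"
        using re[of "\<i> *\<^sub>C b"] by simp
      ultimately show ?thesis
        using re[of b] by (simp add: complex_eq_iff \<Phi>_def complexify_def)
    qed
    then show "\<forall>b. inner (action b \<eta>) \<eta> = inner \<eta> \<eta> * \<Phi> b" by blast
  qed
  moreover have "cyclic \<noteq> (\<lambda>_. 0)"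
    using inner_action_cyclic_cyclic[of 1] one ip_zero_left[OF cyclic_in_space]
    by (auto simp: action_one)
  ultimately show ?thesis
    using cyclic_in_space Lc action_one by blast
qed

context irreducible_representation
begin

lemma nondegenerate:
  assumes x: "x \<in> H" and 0: "\<And>a. \<pi> a x = \<zero>" shows "x = \<zero>"
proof -
  let ?K = "{x \<in> H. \<forall>t\<in>UNIV. \<pi> t x = \<zero>}"
  have "?K = {\<zero>} \<or> ?K = H"
    by (rule irreducible[OF closed_subspace_annihilated]) (auto simp: op_zero zero_closed)
  moreover have "?K \<noteq> H" using rep_nonzero by blast
  ultimately show ?thesis using x 0 by blast
qed

text \<open>
  The vectors annihilated by a right ideal \<open>T\<close> form a closed invariant subspace.
\<close>

lemma annihilator_of_vector:
  assumes T: "\<And>t a. t \<in> T \<Longrightarrow> t * a \<in> T" and x: "x \<in> H" "x \<noteq> \<zero>"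
    and 0: "\<And>t. t \<in> T \<Longrightarrow> \<pi> t x = \<zero>"
  shows "T \<subseteq> rep_kernel"
proof -
  let ?K = "{x \<in> H. \<forall>t\<in>T. \<pi> t x = \<zero>}"
  have "?K = {\<zero>} \<or> ?K = H"
    by (rule irreducible[OF closed_subspace_annihilated]) (auto simp: op_closed rep_mult[symmetric] T)
  moreover have "x \<in> ?K" using x 0 by blast
  ultimately have "?K = H" using x by blast
  then show ?thesis by (auto simp: rep_kernel_def)
qed

lemma rep_kernel_star: "a \<in> rep_kernel \<Longrightarrow> star a \<in> rep_kernel"
proof -
  assume a: "a \<in> rep_kernel"
  have "\<pi> (star a) x = \<zero>" if x: "x \<in> H" for x
  proof (rule vector_eqI[OF op_closed[OF x] zero_closed])
    fix w assume w: "w \<in> H"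
    show "ip (\<pi> (star a) x) w = ip \<zero> w"
      using a x w by (simp add: rep_star rep_kernel_def ip_zero_left ip_zero_right)
  qed
  then show ?thesis by (simp add: rep_kernel_def)
qed

lemma rep_kernel_of_star_mult: "star a * a \<in> rep_kernel \<Longrightarrow> a \<in> rep_kernel"
proof -
  assume a: "star a * a \<in> rep_kernel"
  have "\<pi> a x = \<zero>" if x: "x \<in> H" for x
  proof -
    have "ip (\<pi> (star a * a) x) x = 0"
      using a x by (simp add: rep_kernel_def ip_zero_left del: rep_mult)
    then have "hnorm (\<pi> a x) = 0" by (simp add: ip_rep_star_mult[OF x])
    then show ?thesis using hnorm_zero_iff op_closed[OF x] by blast
  qed
  then show ?thesis by (simp add: rep_kernel_def)
qed

lemma rep_kernel_element_prime:
  assumes xy: "\<And>b. x * b * y \<in> rep_kernel" shows "x \<in> rep_kernel \<or> y \<in> rep_kernel"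
proof (rule disjCI)
  assume "y \<notin> rep_kernel"
  then obtain z where z: "z \<in> H" "\<pi> y z \<noteq> \<zero>" by (auto simp: rep_kernel_def)
  have "range (\<lambda>b. x * b) \<subseteq> rep_kernel"
  proof (rule annihilator_of_vector[OF _ op_closed[OF z(1)] z(2)])
    show "\<pi> t (\<pi> y z) = \<zero>" if "t \<in> range (\<lambda>b. x * b)" for t
      using that xy z(1) by (auto simp: rep_kernel_def rep_mult op_closed)
  qed (auto simp: mult.assoc)
  then have "star (star x) * star x \<in> rep_kernel" by (auto simp: star_star)
  then have "star x \<in> rep_kernel" by (rule rep_kernel_of_star_mult)
  then show "x \<in> rep_kernel" using rep_kernel_star by (metis star_star)
qed

lemma closed_ideal_rep_kernel: "closed_ideal rep_kernel"
  unfolding closed_ideal_def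
proof (intro conjI ballI allI)
  show "0 \<in> rep_kernel" by (simp add: rep_kernel_def rep_zero)
  fix a b c assume a: "a \<in> rep_kernel"
  show "c *\<^sub>C a \<in> rep_kernel"
    using a zero_scale by (auto simp: rep_kernel_def rep_scale)
      (metis mult_zero_right scale_scale zero_closed zero_scale)
  show "b * a \<in> rep_kernel" "a * b \<in> rep_kernel" using a by (rule rep_kernel_mult)+
next
  fix a b assume "a \<in> rep_kernel" "b \<in> rep_kernel"
  then show "a + b \<in> rep_kernel" by (simp add: rep_kernel_def rep_add add_zero zero_closed)
next
  show "closed rep_kernel"
    unfolding closed_sequential_limits
  proof (intro allI impI; elim conjE)
    fix s l assume s: "\<forall>n. s n \<in> rep_kernel" and l: "s \<longlonglongrightarrow> l"
    have "\<pi> l x = \<zero>" if x: "x \<in> H" for x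
    proof -
      have "hnorm (\<pi> l x) \<le> norm (l - s n) * hnorm x" for n
      proof -
        have "\<pi> (s n) x = \<zero>" using s x by (simp add: rep_kernel_def)
        then have "\<pi> l x = \<pi> (l - s n) x"
          using rep_add[OF x, of "l - s n" "s n"] x by (simp add: add_zero op_closed)
        then show ?thesis using rep_contractive[OF x, of "l - s n"] by simp
      qed
      moreover have "(\<lambda>n. norm (l - s n) * hnorm x) \<longlonglongrightarrow> norm (l - l) * hnorm x"
        by (intro tendsto_intros l)
      ultimately have "hnorm (\<pi> l x) \<le> 0" by (intro LIMSEQ_le_const[of _ 0]) auto
      then show ?thesis
        using hnorm_nonneg[OF op_closed[OF x]] hnorm_zero_iff[OF op_closed[OF x]] by (metis antisym)
    qed
    then show "l \<in> rep_kernel" by (simp add: rep_kernel_def)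
  qed
qed

end

text \<open>
  An ideal inherits irreducibility: a closed subspace \<open>K\<close> invariant under the ideal gives rise
  to the subspace of all \<open>x\<close> that the ideal maps into \<open>K\<close>, which is invariant under the whole
  algebra. If this is the whole space, the ideal annihilates the orthogonal complement of \<open>K\<close>.
\<close>

lemma irreducible_representation_of_alg:
  fixes \<pi> :: "'a::cstar_algebra unitization \<Rightarrow> 'h \<Rightarrow> 'h"
  assumes irr: "irreducible_representation H vadd vzero vscale ip \<pi>"
    and nz: "\<exists>a. \<exists>x\<in>H. \<pi> (of_alg a) x \<noteq> vzero"
  shows "irreducible_representation H vadd vzero vscale ip (\<lambda>a. \<pi> (of_alg a))"
proof -
  interpret U: irreducible_representation H vadd vzero vscale ip \<pi> by (rule irr)
  interpret R: star_representation H vadd vzero vscale ip "\<lambda>a. \<pi> (of_alg a)"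
    by unfold_locales
      (auto simp: of_alg_simps of_alg_star of_alg_scaleC U.op_closed U.op_add U.op_scale
        U.rep_add U.rep_scale U.rep_mult U.rep_star intro: U.op_bounded)
  have ideal: "\<exists>c. of_alg a * b = of_alg c" for a b
    by (rule exI[of _ "alg_part (of_alg a * b)"]) (simp add: unitization_eq_iff)
  have nd: "x = vzero" if x: "x \<in> H" and 0: "\<And>a. \<pi> (of_alg a) x = vzero" for x
  proof (rule ccontr)
    assume "x \<noteq> vzero"
    have "range of_alg \<subseteq> U.rep_kernel"
    proof (rule U.annihilator_of_vector[OF _ x \<open>x \<noteq> vzero\<close>])
      show "t * b \<in> range of_alg" if "t \<in> range of_alg" for t b
        using that ideal by (metis imageE rangeI)
    qed (use 0 in auto)
    then show False using nz by (auto simp: U.rep_kernel_def)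
  qed
  show ?thesis
  proof
    show "\<exists>a. \<exists>x\<in>H. \<pi> (of_alg a) x \<noteq> vzero" by (rule nz)
    fix K assume K: "U.closed_subspace K" and inv: "\<And>a x. x \<in> K \<Longrightarrow> \<pi> (of_alg a) x \<in> K"
    have KH: "K \<subseteq> H" and K0: "vzero \<in> K" and Kadd: "\<And>y z. y \<in> K \<Longrightarrow> z \<in> K \<Longrightarrow> vadd y z \<in> K"
      and Kscale: "\<And>c y. y \<in> K \<Longrightarrow> vscale c y \<in> K"
      and Klim: "\<And>X l. (\<And>n. X n \<in> K) \<Longrightarrow> l \<in> H \<Longrightarrow> (\<lambda>n. U.hdist (X n) l) \<longlonglongrightarrow> 0 \<Longrightarrow> l \<in> K"
      using K unfolding U.closed_subspace_def by blast+
    define K' where "K' = {x \<in> H. \<forall>a. \<pi> (of_alg a) x \<in> K}"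
    have "U.closed_subspace K'"
      unfolding U.closed_subspace_def
    proof (intro conjI allI ballI impI; (elim conjE)?)
      fix X l assume X: "\<forall>n. X n \<in> K'" and l: "l \<in> H" "(\<lambda>n. U.hdist (X n) l) \<longlonglongrightarrow> 0"
      have "\<pi> (of_alg a) l \<in> K" for a
      proof (rule Klim)
        show "\<pi> (of_alg a) (X n) \<in> K" for n using X by (simp add: K'_def)
        show "(\<lambda>n. U.hdist (\<pi> (of_alg a) (X n)) (\<pi> (of_alg a) l)) \<longlonglongrightarrow> 0"
          by (rule U.hdist_op_tendsto) (use X l in \<open>auto simp: K'_def\<close>)
      qed (simp add: U.op_closed l)
      then show "l \<in> K'" using l by (simp add: K'_def)
    qed (auto simp: K'_def U.zero_closed U.op_zero K0 U.add_closed U.op_add Kadd U.scale_closed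
        U.op_scale Kscale)
    moreover have "\<pi> b x \<in> K'" if x: "x \<in> K'" for b x
    proof -
      have xH: "x \<in> H" using x by (simp add: K'_def)
      have "\<pi> (of_alg a) (\<pi> b x) \<in> K" for a
      proof -
        obtain c where "of_alg a * b = of_alg c" using ideal by blast
        then have "\<pi> (of_alg a) (\<pi> b x) = \<pi> (of_alg c) x" by (metis U.rep_mult xH)
        then show ?thesis using x by (simp add: K'_def)
      qed
      then show ?thesis by (simp add: K'_def U.op_closed xH)
    qed
    ultimately consider "K' = {vzero}" | "K' = H" using U.irreducible by blast
    then show "K = {vzero} \<or> K = H"
    proof cases
      case 1
      have "K \<subseteq> K'" using KH inv by (auto simp: K'_def)
      then show ?thesis using 1 K0 by blast
    next
      case 2
      have "x \<in> K" if x: "x \<in> H" for x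
      proof -
        obtain k z where kz: "k \<in> K" "z \<in> H" "x = vadd k z" "\<And>y. y \<in> K \<Longrightarrow> ip z y = 0"
          using U.orthogonal_decomposition[OF K x] by metis
        have "\<pi> (of_alg a) z = vzero" for a
        proof (rule ccontr)
          assume nz: "\<pi> (of_alg a) z \<noteq> vzero"
          have "\<pi> (of_alg (star a)) (\<pi> (of_alg a) z) \<in> K"
            using 2 U.op_closed[OF kz(2)] by (auto simp: K'_def)
          then have "ip z (\<pi> (of_alg (star a)) (\<pi> (of_alg a) z)) = 0" by (rule kz(4))
          then have "ip (\<pi> (of_alg a) z) (\<pi> (of_alg a) z) = 0"
            using U.ip_rep[OF kz(2) U.op_closed[OF kz(2)], of "of_alg a" "of_alg a"]
            by (simp add: of_alg_star)
          then show False using U.ip_pos[OF U.op_closed[OF kz(2)] nz] by simp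
        qed
        then have "z = vzero" using nd kz(2) by blast
        then show ?thesis using kz KH U.add_zero by auto
      qed
      then show ?thesis using KH by blast
    qed
  qed
qed

text \<open>
  All primitive ideals that are needed later are kernels of representations obtained here. An
  element \<open>c\<close> with \<open>1 - of_alg c \<in> L\<close> fixes the vector \<open>\<xi>\<close>, which ensures that the restriction
  to the original algebra is not the zero representation.
\<close>

theorem primitive_vector_of_left_ideal:
  fixes L :: "'a::cstar_algebra unitization set"
  assumes L: "left_ideal L" "1 \<notin> L" and c: "1 - of_alg c \<in> L"
  shows "\<exists>(H :: ('a unitization \<Rightarrow> complex) set) vadd vzero vscale ip \<pi> \<xi>.
    irreducible_representation H vadd vzero vscale ip \<pi> \<and> \<xi> \<in> H \<and> \<xi> \<noteq> vzero \<and>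
    (\<forall>a. of_alg a \<in> L \<longrightarrow> \<pi> a \<xi> = vzero) \<and> (\<forall>a. 1 - of_alg a \<in> L \<longrightarrow> \<pi> a \<xi> = \<xi>)"
proof -
  obtain H :: "('a unitization \<Rightarrow> complex) set" and vadd vzero vscale ip \<pi> \<xi> where
    irr: "irreducible_representation H vadd vzero vscale ip \<pi>" and \<xi>: "\<xi> \<in> H" "\<xi> \<noteq> vzero"
      and one: "\<forall>x\<in>H. \<pi> 1 x = x" and 0: "\<forall>l\<in>L. \<pi> l \<xi> = vzero"
    using irreducible_representation_of_left_ideal[OF L] by blast
  interpret U: irreducible_representation H vadd vzero vscale ip \<pi> by (rule irr)
  have fixed: "\<pi> (of_alg a) \<xi> = \<xi>" if "1 - of_alg a \<in> L" for a
  proof -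
    have "\<pi> (1 - of_alg a) \<xi> = vzero" using 0 that by blast
    then have "vadd \<xi> (vscale (- 1) (\<pi> (of_alg a) \<xi>)) = vzero"
      using one \<xi>(1) by (simp add: U.rep_diff)
    then show ?thesis using U.diff_eq_zero[OF \<xi>(1) U.op_closed[OF \<xi>(1)]] by metis
  qed
  have "irreducible_representation H vadd vzero vscale ip (\<lambda>a. \<pi> (of_alg a))"
    by (rule irreducible_representation_of_alg[OF irr]) (use fixed[OF c] \<xi> in auto)
  then show ?thesis using \<xi> fixed 0 by blast
qed


section \<open>Primitive ideals contain minimal primal ideals\<close>

lemma primitive_ideal_closed_ideal:
  assumes "primitive_ideal P" shows "closed_ideal P"
proof -
  obtain H :: "('a \<Rightarrow> complex) set" and vadd vzero vscale ip \<pi> where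
    R: "irreducible_representation H vadd vzero vscale ip \<pi>"
      and P: "P = star_representation.rep_kernel H vzero \<pi>"
    using assms unfolding primitive_ideal_def by blast
  show ?thesis unfolding P by (rule irreducible_representation.closed_ideal_rep_kernel[OF R])
qed

lemma primitive_ideal_star:
  assumes "primitive_ideal P" "a \<in> P" shows "star a \<in> P"
proof -
  obtain H :: "('a \<Rightarrow> complex) set" and vadd vzero vscale ip \<pi> where
    R: "irreducible_representation H vadd vzero vscale ip \<pi>"
      and P: "P = star_representation.rep_kernel H vzero \<pi>"
    using assms unfolding primitive_ideal_def by blast
  show ?thesis using assms(2) irreducible_representation.rep_kernel_star[OF R, of a] by (simp add: P)
qed

lemma primitive_ideal_element_prime:
  assumes "primitive_ideal P" "\<And>b. x * b * y \<in> P" shows "x \<in> P \<or> y \<in> P"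
proof -
  obtain H :: "('a \<Rightarrow> complex) set" and vadd vzero vscale ip \<pi> where
    R: "irreducible_representation H vadd vzero vscale ip \<pi>"
      and P: "P = star_representation.rep_kernel H vzero \<pi>"
    using assms(1) unfolding primitive_ideal_def by blast
  show ?thesis
    using irreducible_representation.rep_kernel_element_prime[OF R, of x y] assms(2) by (simp add: P)
qed

lemma closed_ideal_simps:
  assumes "closed_ideal P"
  shows "0 \<in> P" "x \<in> P \<Longrightarrow> y \<in> P \<Longrightarrow> x + y \<in> P" "x \<in> P \<Longrightarrow> c *\<^sub>C x \<in> P"
    "x \<in> P \<Longrightarrow> a * x \<in> P" "x \<in> P \<Longrightarrow> x * a \<in> P" "x \<in> P \<Longrightarrow> - x \<in> P"
    "x \<in> P \<Longrightarrow> y \<in> P \<Longrightarrow> x - y \<in> P" "x \<in> P \<Longrightarrow> r *\<^sub>R x \<in> P"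
proof -
  show add: "x \<in> P \<Longrightarrow> y \<in> P \<Longrightarrow> x + y \<in> P" and sc: "x \<in> P \<Longrightarrow> c *\<^sub>C x \<in> P" for x y c
    using assms by (auto simp: closed_ideal_def)
  show "0 \<in> P" "x \<in> P \<Longrightarrow> a * x \<in> P" "x \<in> P \<Longrightarrow> x * a \<in> P"
    using assms by (auto simp: closed_ideal_def)
  show neg: "x \<in> P \<Longrightarrow> - x \<in> P" for x using sc[of x "-1"] by (simp add: scaleC_minus_one)
  show "x \<in> P \<Longrightarrow> y \<in> P \<Longrightarrow> x - y \<in> P" using add[of x "- y"] neg[of y] by simp
  show "x \<in> P \<Longrightarrow> r *\<^sub>R x \<in> P" using sc[of x "complex_of_real r"] by (simp add: scaleC_of_real)
qed

lemma primitive_ideal_contains_factor: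
  assumes P: "primitive_ideal P"
  shows "Js \<noteq> [] \<Longrightarrow> \<forall>J\<in>set Js. closed_ideal J \<Longrightarrow> ideal_prod_list Js \<subseteq> P \<Longrightarrow> \<exists>J\<in>set Js. J \<subseteq> P"
proof (induction Js rule: ideal_prod_list.induct)
  case (3 I J Js)
  let ?R = "ideal_prod_list (J # Js)"
  show ?case
  proof (cases "I \<subseteq> P")
    case False
    then obtain x where x: "x \<in> I" "x \<notin> P" by blast
    have prod: "i * y \<in> P" if "i \<in> I" "y \<in> ?R" for i y
    proof -
      have "i * y \<in> {x * y | x y. x \<in> I \<and> y \<in> ?R}" using that by blast
      then have "i * y \<in> ideal_mult I ?R"
        unfolding ideal_mult_def by (meson closure_subset in_mono span_base)
      then show ?thesis using 3(4) by auto
    qed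
    have "?R \<subseteq> P"
    proof
      fix y assume y: "y \<in> ?R"
      have "x * b * y \<in> P" for b
        using 3(3) x(1) y by (intro prod) (auto simp: closed_ideal_def)
      then show "y \<in> P" using primitive_ideal_element_prime[OF P, of x y] x(2) by blast
    qed
    then show ?thesis using 3(1) 3(3) by auto
  qed auto
qed auto

lemma primitive_ideal_primal:
  assumes "primitive_ideal P" shows "primal_ideal P"
  unfolding primal_ideal_def
proof (intro conjI allI impI; (elim conjE)?)
  show "closed_ideal P" by (rule primitive_ideal_closed_ideal[OF assms])
  fix Js :: "'a set list"
  assume "length Js \<ge> 2" "\<forall>J\<in>set Js. closed_ideal J" "ideal_prod_list Js = {0}"
  then show "\<exists>J\<in>set Js. J \<subseteq> P"
    using closed_ideal_simps(1)[OF \<open>closed_ideal P\<close>]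
    by (intro primitive_ideal_contains_factor[OF assms]) auto
qed

lemma closed_ideal_Inter:
  assumes "\<And>I. I \<in> C \<Longrightarrow> closed_ideal I" shows "closed_ideal (\<Inter>C)"
  unfolding closed_ideal_def
  using assms by (auto simp: closed_ideal_simps intro!: closed_Inter) (auto simp: closed_ideal_def)

text \<open>
  A product with finitely many factors involves only finitely many members of the chain, and the
  smallest of these contains one of the factors.
\<close>

lemma primal_ideal_Inter_chain:
  assumes ne: "C \<noteq> {}" and primal: "\<And>I. I \<in> C \<Longrightarrow> primal_ideal I"
    and chain: "\<And>I J. I \<in> C \<Longrightarrow> J \<in> C \<Longrightarrow> I \<subseteq> J \<or> J \<subseteq> I"
  shows "primal_ideal (\<Inter>C)"
  unfolding primal_ideal_def
proof (intro conjI allI impI; (elim conjE)?)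
  show "closed_ideal (\<Inter>C)" using primal by (intro closed_ideal_Inter) (simp add: primal_ideal_def)
  fix Js :: "'a set list"
  assume Js: "length Js \<ge> 2" "\<forall>J\<in>set Js. closed_ideal J" "ideal_prod_list Js = {0}"
  show "\<exists>J\<in>set Js. J \<subseteq> \<Inter>C"
  proof (rule ccontr)
    assume "\<not> ?thesis"
    then have "\<forall>J\<in>set Js. \<exists>I\<in>C. \<not> J \<subseteq> I" by blast
    then obtain f where f: "\<And>J. J \<in> set Js \<Longrightarrow> f J \<in> C \<and> \<not> J \<subseteq> f J" by metis
    have "\<exists>I\<in>F. \<forall>J\<in>F. I \<subseteq> J" if "finite F" "F \<noteq> {}" "F \<subseteq> C" for F
      using that
    proof (induction F rule: finite_ne_induct)
      case (insert J F)
      then obtain I where "I \<in> F" "\<forall>J\<in>F. I \<subseteq> J" by auto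
      moreover have "I \<subseteq> J \<or> J \<subseteq> I" using chain insert.prems \<open>I \<in> F\<close> by auto
      ultimately show ?case by (metis insert_iff order_refl subset_trans)
    qed auto
    moreover have "finite (f ` set Js)" "f ` set Js \<noteq> {}" "f ` set Js \<subseteq> C" using f Js(1) by auto
    ultimately obtain I where I: "I \<in> f ` set Js" "\<forall>J\<in>f ` set Js. I \<subseteq> J" by meson
    have "primal_ideal I" using I(1) f primal by auto
    then obtain J where "J \<in> set Js" "J \<subseteq> I"
      using Js unfolding primal_ideal_def by auto
    then show False using f I(2) by blast
  qed
qed

lemma minimal_primal_ideal_exists:
  assumes P: "primal_ideal P" obtains I where "minimal_primal_ideal I" "I \<subseteq> P"
proof -
  define Q where "Q = {I. primal_ideal I \<and> I \<subseteq> P}"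
  have "\<exists>I\<in>Q. \<forall>J\<in>Q. I \<supseteq> J \<longrightarrow> J = I"
  proof (rule predicate_Zorn)
    show "partial_order_on Q (relation_of (\<supseteq>) Q)"
      by (rule partial_order_on_relation_ofI) auto
    fix C assume "C \<in> Chains (relation_of (\<supseteq>) Q)"
    then have CQ: "C \<subseteq> Q" and chain: "\<And>I J. I \<in> C \<Longrightarrow> J \<in> C \<Longrightarrow> I \<subseteq> J \<or> J \<subseteq> I"
      by (auto simp: Chains_def relation_of_def)
    show "\<exists>u\<in>Q. \<forall>I\<in>C. I \<supseteq> u"
    proof (cases "C = {}")
      case True
      then show ?thesis using P by (auto simp: Q_def)
    next
      case False
      have "primal_ideal (\<Inter>C)"
        using CQ chain by (intro primal_ideal_Inter_chain[OF False]) (auto simp: Q_def)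
      moreover have "\<Inter>C \<subseteq> P" using False CQ by (auto simp: Q_def)
      ultimately show ?thesis by (auto simp: Q_def)
    qed
  qed
  then obtain I where I: "I \<in> Q" "\<And>J. J \<in> Q \<Longrightarrow> J \<subseteq> I \<Longrightarrow> J = I" by blast
  then have "minimal_primal_ideal I" unfolding minimal_primal_ideal_def Q_def by blast
  then show thesis using that I(1) by (auto simp: Q_def)
qed


section \<open>A local unit\<close>

definition unit_mod :: "'a::cstar_algebra \<Rightarrow> 'a set \<Rightarrow> bool" where
  "unit_mod e P \<longleftrightarrow> (\<forall>a. e * a - a \<in> P \<and> a * e - a \<in> P)"

lemma primitive_ideal_unit_mod:
  assumes "\<And>I :: 'a::cstar_algebra set. minimal_primal_ideal I \<Longrightarrow> modular_ideal I"
    and "primitive_ideal (P :: 'a set)"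
  shows "\<exists>e. unit_mod e P"
proof -
  obtain I where I: "minimal_primal_ideal I" "I \<subseteq> P"
    by (rule minimal_primal_ideal_exists[OF primitive_ideal_primal[OF assms(2)]])
  then have "modular_ideal I" using assms(1) by blast
  then show ?thesis using I(2) unfolding modular_ideal_def unit_mod_def by blast
qed

lemma star_representation_unitization:
  fixes \<pi> :: "'a::cstar_algebra \<Rightarrow> 'h \<Rightarrow> 'h"
  assumes "star_representation H vadd vzero vscale ip \<pi>"
  shows "star_representation H vadd vzero vscale ip
    (\<lambda>b x. vadd (\<pi> (alg_part b) x) (vscale (scalar_part b) x))"
proof -
  interpret star_representation H vadd vzero vscale ip \<pi> by (rule assms)
  note cl = op_closed add_closed scale_closed
  note ips = ip_add_left ip_add_right ip_scale_left ip_scale_right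
  show ?thesis
  proof
    fix a b :: "'a unitization" and x y and c
    show "\<exists>B. \<forall>x\<in>H. hnorm (vadd (\<pi> (alg_part a) x) (vscale (scalar_part a) x)) \<le> B * hnorm x"
    proof (intro exI ballI)
      fix x assume x: "x \<in> H"
      have "hnorm (vadd (\<pi> (alg_part a) x) (vscale (scalar_part a) x))
          \<le> hnorm (\<pi> (alg_part a) x) + hnorm (vscale (scalar_part a) x)"
        by (intro hnorm_triangle cl x)
      also have "\<dots> \<le> (norm (alg_part a) + cmod (scalar_part a)) * hnorm x"
        using rep_contractive[OF x, of "alg_part a"] by (simp add: hnorm_scale x distrib_right)
      finally show "hnorm (vadd (\<pi> (alg_part a) x) (vscale (scalar_part a) x))
          \<le> (norm (alg_part a) + cmod (scalar_part a)) * hnorm x" .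
    qed
    assume x: "x \<in> H"
    show "vadd (\<pi> (alg_part a) x) (vscale (scalar_part a) x) \<in> H" by (intro cl x)
    show "vadd (\<pi> (alg_part a) (vscale c x)) (vscale (scalar_part a) (vscale c x)) =
      vscale c (vadd (\<pi> (alg_part a) x) (vscale (scalar_part a) x))"
      using x by (intro vector_eqI) (simp_all add: cl ips op_scale algebra_simps)
    show "vadd (\<pi> (alg_part (a + b)) x) (vscale (scalar_part (a + b)) x) =
      vadd (vadd (\<pi> (alg_part a) x) (vscale (scalar_part a) x))
        (vadd (\<pi> (alg_part b) x) (vscale (scalar_part b) x))"
      using x by (intro vector_eqI) (simp_all add: cl ips rep_add algebra_simps)
    show "vadd (\<pi> (alg_part (c *\<^sub>C a)) x) (vscale (scalar_part (c *\<^sub>C a)) x) =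
      vscale c (vadd (\<pi> (alg_part a) x) (vscale (scalar_part a) x))"
      using x by (intro vector_eqI) (simp_all add: cl ips rep_scale algebra_simps)
    show "vadd (\<pi> (alg_part (a * b)) x) (vscale (scalar_part (a * b)) x) =
      vadd (\<pi> (alg_part a) (vadd (\<pi> (alg_part b) x) (vscale (scalar_part b) x)))
        (vscale (scalar_part a) (vadd (\<pi> (alg_part b) x) (vscale (scalar_part b) x)))"
      using x by (intro vector_eqI)
        (simp_all add: cl ips rep_add rep_mult rep_scale op_add op_scale algebra_simps)
    assume y: "y \<in> H"
    show "vadd (\<pi> (alg_part a) (vadd x y)) (vscale (scalar_part a) (vadd x y)) =
      vadd (vadd (\<pi> (alg_part a) x) (vscale (scalar_part a) x))
        (vadd (\<pi> (alg_part a) y) (vscale (scalar_part a) y))"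
      using x y by (intro vector_eqI) (simp_all add: cl ips op_add algebra_simps)
    show "ip (vadd (\<pi> (alg_part (star a)) x) (vscale (scalar_part (star a)) x)) y =
      ip x (vadd (\<pi> (alg_part a) y) (vscale (scalar_part a) y))"
      using x y by (simp add: cl ips rep_star)
  qed
qed

lemma (in irreducible_representation) rep_unit_mod:
  assumes e: "unit_mod e rep_kernel" and x: "x \<in> H" shows "\<pi> e x = x"
proof -
  have "\<pi> e x \<oplus> (-1) \<odot> x = \<zero>"
  proof (rule nondegenerate)
    fix a
    have "\<pi> (a * e - a) x = \<zero>" using e x by (auto simp: unit_mod_def rep_kernel_def)
    then show "\<pi> a (\<pi> e x \<oplus> (-1) \<odot> x) = \<zero>"
      using x by (simp add: rep_diff rep_mult op_add op_scale op_closed scale_closed)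
  qed (simp add: x op_closed diff_closed)
  then show ?thesis using diff_eq_zero op_closed x by blast
qed

text \<open>
  Let \<open>d = star (1 - v) * (1 - v)\<close>. If \<open>v\<close> is within \<open>1/2\<close> of the unit modulo \<open>P\<close>, then
  \<open>d \<le> 1/4\<close> modulo \<open>P\<close>. The element \<open>e = 1 - (4/3) * c\<close>, where \<open>c\<close> is the positive part of
  \<open>d - 1/4\<close>, is therefore a unit modulo \<open>P\<close>; the factor \<open>4/3\<close> makes its scalar part vanish.
\<close>

lemma unit_mod_of_approximate_unit:
  fixes v :: "'a::cstar_algebra"
  obtains e where "star e = e"
    "\<And>P p. \<lbrakk>primitive_ideal P; unit_mod p P; norm (v * p - p) \<le> 1/2\<rbrakk> \<Longrightarrow> unit_mod e P"
proof -
  define w where "w = 1 - of_alg v"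
  define d where "d = star w * w"
  define x where "x = d - (1/4) *\<^sub>R 1"
  have sx: "star x = x" by (simp add: x_def d_def star_diff star_mult star_star star_scaleR)
  obtain c where c: "is_positive c" "c * x = c * c" "is_positive (c - x)" "x * c = c * x"
    using positive_part[OF sx] by blast
  have spx: "scalar_part x = 3/4"
    by (simp add: x_def d_def w_def scaleR_conv_of_real[where 'a = complex])
  define g where "g = Re (scalar_part c)"
  have g: "scalar_part c = complex_of_real g" using scalar_part_positive(1)[OF c(1)] by (simp add: g_def)
  have "g \<ge> 3/4" using scalar_part_positive(2)[OF c(3)] by (simp add: spx g_def)
  moreover have "complex_of_real (g * (3/4)) = complex_of_real (g * g)"
    using arg_cong[OF c(2), of scalar_part] by (simp add: spx g)
  then have "g * (3/4) = g * g" by (simp only: of_real_eq_iff)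
  ultimately have g34: "g = 3/4" by simp
  have "scalar_part c = 3/4" unfolding g g34 by simp
  then have "scalar_part (1 - (4/3) *\<^sub>R c) = 0"
    by (simp add: scaleR_conv_of_real[where 'a = complex] mult.commute)
  define e where "e = alg_part (1 - (4/3) *\<^sub>R c)"
  have e: "of_alg e = 1 - (4/3) *\<^sub>R c"
    unfolding e_def by (rule of_alg_part) fact
  have sc: "star c = c" by (rule positive_selfadjoint[OF c(1)])
  have "of_alg (star e) = of_alg e"
    unfolding of_alg_star e by (simp add: star_diff star_scaleR sc)
  then have "star e = e" by (metis alg_part_of_alg)
  moreover have "unit_mod e P"
    if P: "primitive_ideal P" and p: "unit_mod p P" "norm (v * p - p) \<le> 1/2" for P p
  proof -
    obtain H :: "('a \<Rightarrow> complex) set" and vadd vzero vscale ip \<pi> where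
      R: "irreducible_representation H vadd vzero vscale ip \<pi>"
        and PR: "P = star_representation.rep_kernel H vzero \<pi>"
      using P unfolding primitive_ideal_def by blast
    interpret irreducible_representation H vadd vzero vscale ip \<pi> by (rule R)
    define \<rho> where "\<rho> b y = vadd (\<pi> (alg_part b) y) (vscale (scalar_part b) y)" for b y
    interpret U: star_representation H vadd vzero vscale ip \<rho>
      unfolding \<rho>_def by (rule star_representation_unitization) (rule star_representation_axioms)
    have \<rho>of: "\<rho> (of_alg a) y = \<pi> a y" if "y \<in> H" for a y
      using that by (simp add: \<rho>_def zero_scale add_zero op_closed)
    have \<rho>1: "\<rho> 1 y = y" if "y \<in> H" for y
      using that rep_zero[OF that] add_commute[OF zero_closed that] by (simp add: \<rho>_def scale_one add_zero)
    have py: "\<pi> p y = y" if "y \<in> H" for y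
      by (rule rep_unit_mod[OF _ that]) (use p(1) PR in simp)
    have wle: "hnorm (\<rho> w y) \<le> (1/2) * hnorm y" if y: "y \<in> H" for y
    proof -
      have "\<rho> w y = vadd y (vscale (-1) (\<pi> v y))"
        unfolding w_def using y by (simp add: U.rep_diff \<rho>1 \<rho>of)
      also have "\<dots> = \<pi> (p - v * p) y"
        using y by (simp add: rep_diff rep_mult py)
      finally have "hnorm (\<rho> w y) \<le> norm (p - v * p) * hnorm y" using rep_contractive[OF y] by simp
      also have "\<dots> \<le> (1/2) * hnorm y"
        using p(2) hnorm_nonneg[OF y] by (intro mult_right_mono) (auto simp: norm_minus_commute)
      finally show ?thesis .
    qed
    \<comment> \<open>In this representation \<open>x \<le> 0\<close>; hence \<open>(q c)\<^sup>2 = c x c \<le> 0\<close>, where \<open>q\<close> is the root of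
      \<open>c\<close>, so that \<open>c\<close> is mapped to \<open>0\<close>.\<close>
    have xle: "Re (ip (\<rho> x y) y) \<le> 0" if y: "y \<in> H" for y
    proof -
      have "(hnorm (\<rho> w y))\<^sup>2 \<le> ((1/2) * hnorm y)\<^sup>2"
        using wle[OF y] hnorm_nonneg[OF U.op_closed[OF y]] by (rule power_mono)
      moreover have "Re (ip (\<rho> x y) y) = Re (ip (\<rho> d y) y) - (1/4) * Re (ip y y)"
        unfolding x_def using y
        by (simp add: U.rep_diff U.rep_scaleR \<rho>1 ip_add_left ip_scale_left U.op_closed scale_closed)
      ultimately show ?thesis
        unfolding d_def U.ip_rep_star_mult[OF y] hnorm_square[OF y, symmetric]
        by (simp add: power_mult_distrib power2_eq_square)
    qed
    obtain q where q: "is_positive q" "q * q = c" "\<And>z. z * c = c * z \<Longrightarrow> z * q = q * z"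
      using positive_sqrt[OF c(1)] by metis
    have sq: "star q = q" by (rule positive_selfadjoint[OF q(1)])
    have qc: "c * q = q * c" by (rule q(3)) simp
    have kk: "(q * c) * (q * c) = c * x * c"
      using square_mult[OF qc] by (simp add: q(2) c(2) mult.assoc)
    have \<rho>c: "\<rho> c y = vzero" if y: "y \<in> H" for y
    proof -
      have cy: "\<rho> c y \<in> H" by (rule U.op_closed[OF y])
      have "star (q * c) * (q * c) = c * x * c" using kk by (simp add: star_mult sq sc qc)
      then have "(hnorm (\<rho> (q * c) y))\<^sup>2 = Re (ip (\<rho> (c * x * c) y) y)"
        using U.ip_rep_star_mult[OF y, of "q * c"] by simp
      also have "\<dots> = Re (ip (\<rho> x (\<rho> c y)) (\<rho> c y))"
        using U.ip_rep[OF U.op_closed[OF cy] y, of c x] y cy by (simp add: U.rep_mult sc)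
      also have "\<dots> \<le> 0" by (rule xle[OF cy])
      finally have "hnorm (\<rho> (q * c) y) = 0" by simp
      then have "\<rho> (q * c) y = vzero" using hnorm_zero_iff U.op_closed[OF y] by blast
      moreover have "star c * c = q * (q * c)" by (simp add: sc mult.assoc[symmetric] q(2))
      ultimately have "\<rho> (star c * c) y = vzero" using y by (simp only: U.rep_mult U.op_closed U.op_zero)
      then have "hnorm (\<rho> c y) = 0" using U.ip_rep_star_mult[OF y, of c] ip_zero_left[OF y] by simp
      then show ?thesis using hnorm_zero_iff cy by blast
    qed
    have ey: "\<pi> e y = y" if y: "y \<in> H" for y
    proof -
      have "\<pi> e y = \<rho> (1 - (4/3) *\<^sub>R c) y" using \<rho>of[OF y, of e] by (simp add: e)
      also have "\<dots> = vadd y (vscale (-1) (vscale (complex_of_real (4/3)) vzero))"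
        using y by (simp add: U.rep_diff U.rep_scaleR \<rho>1 \<rho>c del: of_real_divide)
      also have "\<dots> = y"
        using y by (intro vector_eqI) (simp_all add: add_closed scale_closed zero_closed ip_add_left ip_scale_left ip_zero_left)
      finally show ?thesis .
    qed
    show ?thesis
      unfolding unit_mod_def PR rep_kernel_def
      by (auto simp: rep_diff rep_mult op_closed ey add_inverse)
  qed
  ultimately show thesis using that by blast
qed

text \<open>Functions of \<open>a\<close>: \<open>c\<close> is \<open>max 0 (a - 1/2)\<close> and \<open>h\<close> is \<open>min (2 * a) 1\<close>.\<close>

lemma plateau_functions:
  fixes a :: "'a::unital_cstar_algebra"
  assumes a: "is_positive a" "norm a = 1"
  obtains c h r s where "c \<noteq> 0" "star c = c" "c = a * r" "h = a * s" "h * c = c"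
proof -
  define x where "x = a - (1/2) *\<^sub>R 1"
  have "star x = x" by (simp add: x_def star_diff star_scaleR positive_selfadjoint[OF a(1)])
  then obtain c where c: "is_positive c" "c * x = c * c" "is_positive (c - x)" "x * c = c * x"
    using positive_part by blast
  have "is_positive (2 *\<^sub>R c)" using positive_scaleR[OF c(1), of 2] by simp
  then obtain y where y: "(1 + 2 *\<^sub>R c) * y = 1"
    by (rule inverse_one_plus_positive)
  have "2 *\<^sub>R (x * c) = 2 *\<^sub>R (a * c) - c" by (simp add: x_def algebra_simps)
  then have ac: "2 *\<^sub>R (a * c) = c + 2 *\<^sub>R (c * c)" using c(2,4) by (simp add: algebra_simps)
  have "c = c * ((1 + 2 *\<^sub>R c) * y)" using y by simp
  also have "\<dots> = (c + 2 *\<^sub>R (c * c)) * y" by (simp add: algebra_simps)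
  also have "\<dots> = a * (2 *\<^sub>R (c * y))" by (simp add: ac[symmetric] mult.assoc)
  finally have r: "c = a * (2 *\<^sub>R (c * y))" .
  define h where "h = 2 *\<^sub>R a - 2 *\<^sub>R c"
  have "h = a * (2 *\<^sub>R 1 - 2 *\<^sub>R (2 *\<^sub>R (c * y)))"
    unfolding h_def by (subst r) (simp add: algebra_simps)
  moreover have "h * c = c" using ac by (simp add: h_def algebra_simps)
  moreover have "c \<noteq> 0"
  proof
    assume "c = 0"
    then have "is_positive ((1/2) *\<^sub>R 1 - a)" using c(3) by (simp add: x_def)
    then show False using norm_le_of_positive[OF a(1)] a(2) by fastforce
  qed
  ultimately show thesis using that r positive_selfadjoint[OF c(1)] by blast
qed

lemma of_alg_mult: "of_alg a * b = of_alg (alg_part (of_alg a * b))"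
  and mult_of_alg: "b * of_alg a = of_alg (alg_part (b * of_alg a))"
  by (simp_all add: unitization_eq_iff)

lemma of_alg_inj: "of_alg a = of_alg b \<longleftrightarrow> a = b"
  by (simp add: unitization_eq_iff)

lemma closed_ideal_unitization_mult:
  assumes P: "closed_ideal P" and a: "a \<in> P"
  shows "alg_part (b * of_alg a) \<in> P" "alg_part (of_alg a * b) \<in> P"
  using a by (simp_all add: closed_ideal_simps[OF P])

text \<open>
  The plateau functions of the normalized square of \<open>(e * b - b) * c\<close>. Since \<open>c\<close> is a left
  factor of this square, everything that acts as a left unit on \<open>c\<close> does so on \<open>c'\<close>.
\<close>

lemma plateau_step:
  fixes e c :: "'a::cstar_algebra"
  assumes c: "star c = c" and b: "(e * b - b) * c \<noteq> 0"
  obtains c' h where "c' \<noteq> 0" "star c' = c'" "h * c' = c'" "\<And>g. g * c = c \<Longrightarrow> g * c' = c'"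
    "\<And>P. primitive_ideal P \<Longrightarrow> unit_mod e P \<Longrightarrow> h \<in> P"
proof -
  define y where "y = (e * b - b) * c"
  have y0: "y \<noteq> 0" using b by (simp add: y_def)
  define a where "a = (1 / (norm y)\<^sup>2) *\<^sub>R (star y * y)"
  have "of_alg a = (1 / (norm y)\<^sup>2) *\<^sub>R (star (of_alg y) * of_alg y)"
    by (simp add: a_def of_alg_simps of_alg_star)
  then have "is_positive (of_alg a)"
    using positive_scaleR[OF positive_star_mult_self, of "1 / (norm y)\<^sup>2" "of_alg y"] by simp
  moreover have "norm (of_alg a) = 1" using y0 by (simp add: a_def cstar_identity)
  ultimately obtain c1 h1 r s where *: "c1 \<noteq> 0" "star c1 = c1" "c1 = of_alg a * r"
      "h1 = of_alg a * s" "h1 * c1 = c1"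
    by (rule plateau_functions)
  define c' where "c' = alg_part c1"
  define h where "h = alg_part h1"
  have c': "of_alg c' = c1" and h: "of_alg h = h1"
    unfolding c'_def h_def *(3,4) using of_alg_mult by metis+
  have "c' \<noteq> 0" using *(1) c' by (metis of_alg_eq_0_iff)
  moreover have "star c' = c'" using *(2) c' by (metis of_alg_star of_alg_inj)
  moreover have "h * c' = c'" using *(5) c' h by (metis of_alg_simps(5) of_alg_inj)
  moreover have "g * c' = c'" if g: "g * c = c" for g
  proof -
    have "a = c * ((1 / (norm y)\<^sup>2) *\<^sub>R (star (e * b - b) * y))"
      by (simp add: a_def y_def star_mult c mult.assoc)
    then have "g * a = a" using g by (metis mult.assoc)
    then have "of_alg g * c1 = c1" unfolding *(3) by (metis mult.assoc of_alg_simps(5))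
    then show ?thesis using c' by (metis of_alg_simps(5) of_alg_inj)
  qed
  moreover have "h \<in> P" if P: "primitive_ideal P" and e: "unit_mod e P" for P
  proof -
    have cP: "closed_ideal P" by (rule primitive_ideal_closed_ideal[OF P])
    have "y \<in> P" using e by (simp add: y_def unit_mod_def closed_ideal_simps(5)[OF cP])
    then have "a \<in> P" unfolding a_def by (intro closed_ideal_simps[OF cP])
    then show ?thesis unfolding h_def *(4) by (rule closed_ideal_unitization_mult(2)[OF cP])
  qed
  ultimately show thesis using that by blast
qed

text \<open>
  The conclusion implies that \<open>e n\<close> is a left unit modulo every primitive ideal without \<open>c\<close>. It holds
  by a Baire category argument: if it fails for every \<open>n\<close>, plateau functions
  \<open>h 0, h 1, \<dots>\<close> with shrinking supports can be chosen so that \<open>h n\<close> lies in every primitive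
  ideal modulo which \<open>e n\<close> is a unit. A primitive ideal containing none of the \<open>h n\<close>, obtained
  from the left ideal of elements that vanish on the supports eventually, is a contradiction.
\<close>

lemma exists_uniform_local_unit:
  fixes e :: "nat \<Rightarrow> 'a::cstar_algebra"
  assumes nonzero: "\<exists>a::'a. a \<noteq> 0"
    and cover: "\<And>P. primitive_ideal P \<Longrightarrow> \<exists>n. unit_mod (e n) P"
  shows "\<exists>n c. c \<noteq> 0 \<and> (\<forall>b. (e n * b - b) * c = 0)"
proof (rule ccontr)
  assume neg: "\<not> ?thesis"
  define good where "good n c c' h \<longleftrightarrow> c' \<noteq> 0 \<and> star c' = c' \<and> h * c' = c' \<and>
    (\<forall>g. g * c = c \<longrightarrow> g * c' = c') \<and> (\<forall>P. primitive_ideal P \<longrightarrow> unit_mod (e n) P \<longrightarrow> h \<in> P)"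
    for n c c' h
  have "\<exists>c' h. good n c c' h" if c: "c \<noteq> 0" "star c = c" for n c
  proof -
    obtain b where "(e n * b - b) * c \<noteq> 0" using neg c(1) by blast
    from plateau_step[OF c(2) this] show ?thesis unfolding good_def by metis
  qed
  then have "\<forall>n c. \<exists>c' h. c \<noteq> 0 \<and> star c = c \<longrightarrow> good n c c' h" by blast
  then obtain C' where "\<forall>n c. \<exists>h. c \<noteq> 0 \<and> star c = c \<longrightarrow> good n c (C' n c) h"
    unfolding choice_iff by blast
  then obtain H where step: "\<And>n c. c \<noteq> 0 \<Longrightarrow> star c = c \<Longrightarrow> good n c (C' n c) (H n c)"
    unfolding choice_iff by blast
  obtain a :: 'a where a: "a \<noteq> 0" using nonzero by blast
  define c where "c = rec_nat (star a * a) C'"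
  have cS: "c (Suc n) = C' n (c n)" for n by (simp add: c_def)
  have c: "c n \<noteq> 0 \<and> star (c n) = c n" for n
  proof (induction n)
    case 0
    show ?case using a star_mult_self_eq_0[of a] by (simp add: c_def star_mult star_star)
  next
    case (Suc n)
    then show ?case using step[of "c n" n] by (simp add: cS good_def)
  qed
  define h where "h n = H n (c n)" for n
  have good: "good n (c n) (c (Suc n)) (h n)" for n
    unfolding cS h_def using step c by blast
  have hc: "h m * c n = c n" if "n \<ge> Suc m" for m n
    using that
  proof (induction n rule: dec_induct)
    case base
    show ?case using good[of m] by (simp add: good_def)
  next
    case (step n)
    then show ?case using good[of n] by (simp add: good_def)
  qed
  define L where "L = {x. \<exists>N. \<forall>n\<ge>N. x * of_alg (c n) = 0}"
  have lL: "left_ideal L"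
    unfolding left_ideal_def
  proof (intro conjI ballI allI)
    fix x y assume "x \<in> L" "y \<in> L"
    then obtain N M where "\<forall>n\<ge>N. x * of_alg (c n) = 0" "\<forall>n\<ge>M. y * of_alg (c n) = 0"
      by (auto simp: L_def)
    then show "x + y \<in> L" by (auto simp: L_def distrib_right intro!: exI[of _ "max N M"])
  qed (auto simp: L_def mult.assoc, metis mult_zero_right)
  have L1: "1 \<notin> L" using c by (auto simp: L_def)
  have hL: "1 - of_alg (h m) \<in> L" for m
    using hc[of m] by (auto simp: L_def algebra_simps of_alg_simps(5)[symmetric] intro!: exI[of _ "Suc m"])
  obtain Hs :: "('a unitization \<Rightarrow> complex) set" and vadd vzero vscale ip \<pi> \<xi> where
    R: "irreducible_representation Hs vadd vzero vscale ip \<pi>" and \<xi>: "\<xi> \<in> Hs" "\<xi> \<noteq> vzero"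
      and fixed: "\<forall>a. 1 - of_alg a \<in> L \<longrightarrow> \<pi> a \<xi> = \<xi>"
    using primitive_vector_of_left_ideal[OF lL L1 hL[of 0]] by blast
  interpret irreducible_representation Hs vadd vzero vscale ip \<pi> by (rule R)
  obtain n where "unit_mod (e n) rep_kernel" using cover primitive_ideal_rep_kernel by blast
  then have "h n \<in> rep_kernel" using good[of n] primitive_ideal_rep_kernel by (auto simp: good_def)
  then have "\<pi> (h n) \<xi> = vzero" using \<xi>(1) by (simp add: rep_kernel_def)
  then show False using fixed hL[of n] \<xi>(2) by simp
qed

theorem local_unit_exists:
  assumes nonzero: "\<exists>a::'a::cstar_algebra. a \<noteq> 0"
    and u: "approximate_identity_seq (u :: nat \<Rightarrow> 'a)"
    and modular: "\<And>I :: 'a set. minimal_primal_ideal I \<Longrightarrow> modular_ideal I"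
  shows "\<exists>(e :: 'a) c. c \<noteq> 0 \<and> (\<forall>P. primitive_ideal P \<and> c \<notin> P \<longrightarrow> unit_mod e P)"
proof -
  have "\<exists>e. star e = e \<and> (\<forall>P p. primitive_ideal P \<and> unit_mod p P \<and> norm (v * p - p) \<le> 1/2 \<longrightarrow> unit_mod e P)"
    for v :: 'a
    using unit_mod_of_approximate_unit[of v] by metis
  then obtain E where E: "\<And>v::'a. star (E v) = E v"
    "\<And>v P p. primitive_ideal P \<Longrightarrow> unit_mod p P \<Longrightarrow> norm (v * p - p) \<le> 1/2 \<Longrightarrow> unit_mod (E v) P"
    by metis
  have "\<exists>n. unit_mod (E (u n)) P" if P: "primitive_ideal P" for P
  proof -
    obtain p where p: "unit_mod p P" using primitive_ideal_unit_mod[OF modular P] by blast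
    have "(\<lambda>n. u n * p) \<longlonglongrightarrow> p" using u by (simp add: approximate_identity_seq_def)
    then obtain N where "\<forall>n\<ge>N. norm (u n * p - p) < 1/2" by (metis LIMSEQ_D zero_less_divide_1_iff zero_less_numeral)
    then have "norm (u N * p - p) \<le> 1/2" by (simp add: less_imp_le)
    then show ?thesis using E(2)[OF P p] by blast
  qed
  then obtain n c where c: "c \<noteq> 0" "\<And>b. (E (u n) * b - b) * c = 0"
    using exists_uniform_local_unit[OF nonzero, of "\<lambda>n. E (u n)"] by blast
  let ?e = "E (u n)"
  have "unit_mod ?e P" if P: "primitive_ideal P" "c \<notin> P" for P
  proof -
    have left: "?e * b - b \<in> P" for b
    proof -
      have "(?e * b - b) * a * c = 0" for a using c(2)[of "b * a"] by (simp add: algebra_simps)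
      then have "(?e * b - b) * a * c \<in> P" for a
        using closed_ideal_simps(1)[OF primitive_ideal_closed_ideal[OF P(1)]] by simp
      then show ?thesis using primitive_ideal_element_prime[OF P(1)] P(2) by blast
    qed
    have "b * ?e - b \<in> P" for b
      using primitive_ideal_star[OF P(1) left[of "star b"]] by (simp add: star_diff star_mult star_star E)
    with left show ?thesis by (simp add: unit_mod_def)
  qed
  then show ?thesis using c(1) by blast
qed


section \<open>Central elements from continuous functions\<close>

text \<open>
  The spectrum of \<open>star a * a\<close> contains \<open>(norm a)\<^sup>2\<close>, so the left ideal generated by
  \<open>(norm a)\<^sup>2 - star a * a\<close> is proper, and some irreducible representation has a unit vector
  that \<open>a\<close> maps to a vector of norm \<open>norm a\<close>.
\<close>

lemma norm_le_of_primitive_ideals: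
  fixes a :: "'a::cstar_algebra"
  assumes r: "r \<ge> 0" and le: "\<And>P. primitive_ideal P \<Longrightarrow> \<exists>p\<in>P. norm (a - p) \<le> r"
  shows "norm a \<le> r"
proof (cases "a = 0")
  case False
  define c where "c = (1 / (norm a)\<^sup>2) *\<^sub>R (star a * a)"
  define d where "d = of_alg c"
  define u where "u = 1 - d"
  have "d = (1 / (norm a)\<^sup>2) *\<^sub>R (star (of_alg a) * of_alg a)"
    by (simp add: d_def c_def of_alg_simps of_alg_star)
  then have d: "is_positive d"
    using positive_scaleR[OF positive_star_mult_self, of "1 / (norm a)\<^sup>2" "of_alg a"] by simp
  have nd: "norm d = 1" using False by (simp add: d_def c_def cstar_identity)
  have su: "star u = u" by (simp add: u_def star_diff positive_selfadjoint[OF d])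
  have u: "is_positive u"
    using positive_diff_of_norm_le[OF positive_selfadjoint[OF d], of 1] nd by (simp add: u_def)
  define L where "L = range (\<lambda>y. y * u)"
  have lL: "left_ideal L"
    unfolding left_ideal_def
  proof (intro conjI ballI allI)
    show "0 \<in> L" unfolding L_def by (rule range_eqI[of _ _ 0]) simp
    fix x y assume "x \<in> L" "y \<in> L"
    then obtain x' y' where "x = x' * u" "y = y' * u" by (auto simp: L_def)
    then show "x + y \<in> L" unfolding L_def by (intro range_eqI[of _ _ "x' + y'"]) (simp add: distrib_right)
  next
    fix b x assume "x \<in> L"
    then obtain x' where "x = x' * u" by (auto simp: L_def)
    then show "b * x \<in> L" unfolding L_def by (intro range_eqI[of _ _ "b * x'"]) (simp add: mult.assoc)
  qed
  have L1: "1 \<notin> L"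
  proof
    assume "1 \<in> L"
    then obtain y where y: "y * u = 1" by (auto simp: L_def)
    have uy: "u * star y = 1" using arg_cong[OF y, of star] by (simp add: star_mult su)
    have "y * u * star y = y" by (simp add: mult.assoc uy)
    then have sy: "star y = y" by (simp add: y)
    define m where "m = norm y"
    have "y \<noteq> 0" using y by auto
    then have m: "m > 0" by (simp add: m_def)
    have "is_positive (m *\<^sub>R 1 - y)" by (rule positive_diff_of_norm_le[OF sy]) (simp add: m_def)
    then have "is_positive ((m *\<^sub>R 1 - y) * u)"
      using u uy y sy by (intro positive_mult) (simp_all add: algebra_simps)
    then have "is_positive (m *\<^sub>R u - 1)" using y by (simp add: algebra_simps)
    then have "is_positive ((1/m) *\<^sub>R (m *\<^sub>R u - 1))" using m by (intro positive_scaleR) auto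
    moreover have "(1/m) *\<^sub>R (m *\<^sub>R u - 1) = (1 - 1/m) *\<^sub>R 1 - d"
      using m by (simp add: u_def algebra_simps)
    ultimately have "norm d \<le> 1 - 1/m" using norm_le_of_positive[OF d] by simp
    then show False using nd m by simp
  qed
  have cL: "1 - of_alg c \<in> L" unfolding L_def by (rule range_eqI[of _ _ 1]) (simp add: u_def d_def)
  obtain H :: "('a unitization \<Rightarrow> complex) set" and vadd vzero vscale ip \<pi> \<xi> where
    R: "irreducible_representation H vadd vzero vscale ip \<pi>" and \<xi>: "\<xi> \<in> H" "\<xi> \<noteq> vzero"
      and c: "\<pi> c \<xi> = \<xi>"
    using primitive_vector_of_left_ideal[OF lL L1 cL] cL by blast
  interpret irreducible_representation H vadd vzero vscale ip \<pi> by (rule R)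
  obtain p where p: "p \<in> rep_kernel" "norm (a - p) \<le> r" using le[OF primitive_ideal_rep_kernel] by blast
  have h\<xi>: "hnorm \<xi> > 0" using \<xi> hnorm_nonneg[OF \<xi>(1)] hnorm_zero_iff[OF \<xi>(1)] by linarith
  have "star a * a = (norm a)\<^sup>2 *\<^sub>R c" using False by (simp add: c_def)
  then have "\<pi> (star a * a) \<xi> = vscale (complex_of_real ((norm a)\<^sup>2)) \<xi>"
    using rep_scaleR[OF \<xi>(1), of "(norm a)\<^sup>2" c] c by simp
  then have "(hnorm (\<pi> a \<xi>))\<^sup>2 = Re (ip (vscale (complex_of_real ((norm a)\<^sup>2)) \<xi>) \<xi>)"
    using ip_rep_star_mult[OF \<xi>(1), of a] by (metis Re_complex_of_real)
  also have "\<dots> = (norm a * hnorm \<xi>)\<^sup>2"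
    using \<xi>(1) by (simp add: ip_scale_left hnorm_square power_mult_distrib del: of_real_power)
  finally have "hnorm (\<pi> a \<xi>) = norm a * hnorm \<xi>"
    using hnorm_nonneg[OF op_closed[OF \<xi>(1)], of a] h\<xi> by (simp add: power2_eq_iff_nonneg)
  moreover have "\<pi> a \<xi> = \<pi> (a - p) \<xi>"
  proof -
    have "\<pi> a \<xi> = vadd (\<pi> (a - p) \<xi>) (\<pi> p \<xi>)" using rep_add[OF \<xi>(1), of "a - p" p] by simp
    then show ?thesis using p(1) \<xi>(1) by (simp add: rep_kernel_def add_zero op_closed)
  qed
  ultimately have "norm a * hnorm \<xi> \<le> norm (a - p) * hnorm \<xi>" using rep_contractive[OF \<xi>(1), of "a - p"] by simp
  then show ?thesis using h\<xi> p(2) by simp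
qed (use r in simp)

text \<open>
  The first part of the proof finds \<open>x\<close> that vanishes on \<open>S\<close> and is a left unit on \<open>T\<close>: the
  elements of the unitization that agree on \<open>T\<close> with an element vanishing on \<open>S\<close> form a left
  ideal, which is not proper because no primitive ideal lies in both closures. With
  \<open>D = (1 - x) * star (1 - x)\<close>, the Cayley transform \<open>(1 - D) / (1 + D)\<close> has norm at most
  \<open>1\<close>, vanishes where \<open>D = 1\<close>, and is a unit where \<open>D = 0\<close>.
\<close>

lemma separating_element:
  fixes S T :: "'a::cstar_algebra set set"
  assumes S: "\<And>P. P \<in> S \<Longrightarrow> primitive_ideal P" and T: "\<And>P. P \<in> T \<Longrightarrow> primitive_ideal P"
    and disj: "\<And>P. primitive_ideal P \<Longrightarrow> \<Inter>S \<subseteq> P \<Longrightarrow> \<Inter>T \<subseteq> P \<Longrightarrow> False"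
    and e: "\<And>P. P \<in> T \<Longrightarrow> unit_mod e P"
  obtains y where "norm y \<le> 1" "\<And>P. P \<in> S \<Longrightarrow> y \<in> P" "\<And>P. P \<in> T \<Longrightarrow> unit_mod y P"
proof -
  have Sc: "closed_ideal P" if "P \<in> S" for P using S[OF that] by (rule primitive_ideal_closed_ideal)
  have Tc: "closed_ideal P" if "P \<in> T" for P using T[OF that] by (rule primitive_ideal_closed_ideal)
  define rel where "rel b x \<longleftrightarrow> x \<in> \<Inter>S \<and> (\<forall>P\<in>T. \<forall>a. alg_part ((b - of_alg x) * of_alg a) \<in> P)" for b x
  define L where "L = {b. \<exists>x. rel b x}"
  have "left_ideal L"
    unfolding left_ideal_def
  proof (intro conjI ballI allI)
    have "rel 0 0" by (simp add: rel_def closed_ideal_simps(1) Sc Tc)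
    then show "0 \<in> L" unfolding L_def by blast
    fix b c assume "b \<in> L" "c \<in> L"
    then obtain x y where x: "rel b x" and y: "rel c y" by (auto simp: L_def)
    have "rel (b + c) (x + y)"
      unfolding rel_def
    proof (intro conjI ballI allI)
      show "x + y \<in> \<Inter>S" using x y by (auto simp: rel_def intro: closed_ideal_simps Sc)
      fix P a assume P: "P \<in> T"
      have "(b + c - of_alg (x + y)) * of_alg a = (b - of_alg x) * of_alg a + (c - of_alg y) * of_alg a"
        by (simp add: algebra_simps of_alg_simps)
      then have "alg_part ((b + c - of_alg (x + y)) * of_alg a) =
          alg_part ((b - of_alg x) * of_alg a) + alg_part ((c - of_alg y) * of_alg a)"
        by (simp only: alg_part_simps(3))
      then show "alg_part ((b + c - of_alg (x + y)) * of_alg a) \<in> P"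
        using x y P unfolding rel_def by (metis closed_ideal_simps(2)[OF Tc])
    qed
    then show "b + c \<in> L" unfolding L_def by blast
  next
    fix c b assume "b \<in> L"
    then obtain x where x: "rel b x" by (auto simp: L_def)
    have "rel (c * b) (alg_part (c * of_alg x))"
      unfolding rel_def
    proof (intro conjI ballI allI)
      show "alg_part (c * of_alg x) \<in> \<Inter>S"
        using x unfolding rel_def by (blast intro: closed_ideal_unitization_mult(1) Sc)
      fix P a assume P: "P \<in> T"
      have "(c * b - of_alg (alg_part (c * of_alg x))) * of_alg a = (c * b - c * of_alg x) * of_alg a"
        by (simp only: mult_of_alg[symmetric])
      also have "\<dots> = c * ((b - of_alg x) * of_alg a)" by (simp add: algebra_simps)
      also have "\<dots> = c * of_alg (alg_part ((b - of_alg x) * of_alg a))"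
        by (simp only: mult_of_alg[symmetric])
      finally show "alg_part ((c * b - of_alg (alg_part (c * of_alg x))) * of_alg a) \<in> P"
        using x P unfolding rel_def by (metis closed_ideal_unitization_mult(1)[OF Tc])
    qed
    then show "c * b \<in> L" unfolding L_def by blast
  qed
  moreover have inS: "of_alg x \<in> L" if "x \<in> \<Inter>S" for x
  proof -
    have "rel (of_alg x) x" using that by (simp add: rel_def closed_ideal_simps(1) Tc)
    then show ?thesis unfolding L_def by blast
  qed
  moreover have inT: "of_alg x \<in> L" if "x \<in> \<Inter>T" for x
  proof -
    have "rel (of_alg x) 0"
      using that by (simp add: rel_def closed_ideal_simps(1) Sc of_alg_simps(1)) (metis closed_ideal_simps(5) Tc)
    then show ?thesis unfolding L_def by blast
  qed
  moreover have eL: "1 - of_alg e \<in> L"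
  proof -
    have "rel (1 - of_alg e) 0"
      unfolding rel_def
    proof (intro conjI ballI allI)
      show "0 \<in> \<Inter>S" by (simp add: closed_ideal_simps(1) Sc)
      fix P a assume P: "P \<in> T"
      have "- (e * a - a) \<in> P" using e[OF P] by (intro closed_ideal_simps(6) Tc P) (simp add: unit_mod_def)
      then show "alg_part ((1 - of_alg e - of_alg 0) * of_alg a) \<in> P" by simp
    qed
    then show ?thesis unfolding L_def by blast
  qed
  moreover have False if proper: "left_ideal L" "1 \<notin> L"
  proof -
    obtain H :: "('a unitization \<Rightarrow> complex) set" and vadd vzero vscale ip \<pi> \<xi> where
      R: "irreducible_representation H vadd vzero vscale ip \<pi>" and \<xi>: "\<xi> \<in> H" "\<xi> \<noteq> vzero"
        and 0: "\<And>a. of_alg a \<in> L \<Longrightarrow> \<pi> a \<xi> = vzero"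
      using primitive_vector_of_left_ideal[OF proper eL] by blast
    interpret irreducible_representation H vadd vzero vscale ip \<pi> by (rule R)
    have "\<Inter>S \<subseteq> rep_kernel" "\<Inter>T \<subseteq> rep_kernel"
      by (rule annihilator_of_vector[OF _ \<xi>]; auto intro: 0 inS inT closed_ideal_simps(5) Sc Tc)+
    then show False using disj[OF primitive_ideal_rep_kernel] by blast
  qed
  ultimately have "1 \<in> L" by blast
  then obtain x where x: "\<And>P. P \<in> S \<Longrightarrow> x \<in> P"
    "\<And>P a. P \<in> T \<Longrightarrow> alg_part ((1 - of_alg x) * of_alg a) \<in> P"
    by (auto simp: L_def rel_def)
  define z where "z = 1 - of_alg x"
  define D where "D = z * star z"
  have D: "is_positive D"
    using positive_star_mult_self[of "star z"] by (simp add: D_def star_star)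
  obtain v where v: "(1 + D) * v = 1" "v * (1 + D) = 1" "is_positive v" "is_positive (1 - v)"
    using inverse_one_plus_positive[OF D] by metis
  define Y where "Y = 2 *\<^sub>R v - 1"
  have "1 - Y = 2 *\<^sub>R (1 - v)" "1 + Y = 2 *\<^sub>R v" by (simp_all add: Y_def algebra_simps scaleR_2)
  then have nY: "norm Y \<le> 1"
    using positive_scaleR[OF v(4), of 2] positive_scaleR[OF v(3), of 2]
    by (intro norm_le_of_positive_bounds) simp_all
  define x' where "x' = x + star x - x * star x"
  have "1 - D = of_alg x'"
    by (simp add: D_def z_def x'_def of_alg_simps of_alg_star star_diff algebra_simps)
  moreover have "Y = v * (1 - D)" using v(2) by (simp add: Y_def algebra_simps scaleR_2)
  ultimately have Yx: "Y = v * of_alg x'" by simp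
  define y where "y = alg_part Y"
  have y: "of_alg y = Y" unfolding y_def Yx by (rule mult_of_alg[symmetric])
  have sY: "star Y = Y" by (simp add: Y_def star_diff star_scaleR positive_selfadjoint[OF v(3)])
  then have sy: "star y = y" using y by (metis of_alg_star of_alg_inj)
  have "norm y \<le> 1" using nY y by (metis norm_of_alg)
  moreover have "y \<in> P" if P: "P \<in> S" for P
  proof -
    have "x' \<in> P"
      unfolding x'_def using x(1)[OF P] primitive_ideal_star[OF S[OF P]]
      by (intro closed_ideal_simps Sc P) auto
    then show ?thesis unfolding y_def Yx by (rule closed_ideal_unitization_mult(1)[OF Sc[OF P]])
  qed
  moreover have "unit_mod y P" if P: "P \<in> T" for P
  proof -
    have left: "y * a - a \<in> P" for a
    proof -
      have "v * D = 1 - v" using v(2) by (metis add_diff_cancel_left' distrib_left mult_1_right)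
      then have Yv: "1 - Y = 2 *\<^sub>R (v * D)"
        by (simp only: Y_def) (simp add: algebra_simps scaleR_2)
      define a' where "a' = alg_part (star z * of_alg a)"
      define a'' where "a'' = alg_part (z * of_alg a')"
      have "of_alg (a - y * a) = (1 - Y) * of_alg a" by (simp add: of_alg_simps y algebra_simps)
      also have "\<dots> = 2 *\<^sub>R (v * (z * (star z * of_alg a)))" by (simp add: Yv D_def mult.assoc)
      also have "star z * of_alg a = of_alg a'" unfolding a'_def by (rule mult_of_alg)
      also have "z * of_alg a' = of_alg a''" unfolding a''_def by (rule mult_of_alg)
      finally have "a - y * a = 2 *\<^sub>R alg_part (v * of_alg a'')"
        by (metis alg_part_of_alg alg_part_simps(6))
      moreover have "a'' \<in> P" unfolding a''_def z_def by (rule x(2)[OF P])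
      ultimately have "a - y * a \<in> P"
        using closed_ideal_unitization_mult(1)[OF Tc[OF P]] closed_ideal_simps(8)[OF Tc[OF P]] by metis
      then have "- (a - y * a) \<in> P" by (rule closed_ideal_simps(6)[OF Tc[OF P]])
      then show ?thesis by simp
    qed
    have "a * y - a \<in> P" for a
      using primitive_ideal_star[OF T[OF P] left[of "star a"]] by (simp add: star_diff star_mult star_star sy)
    with left show ?thesis by (simp add: unit_mod_def)
  qed
  ultimately show thesis using that by blast
qed

lemma closed_ideal_sum: "closed_ideal P \<Longrightarrow> (\<And>k. k \<in> A \<Longrightarrow> f k \<in> P) \<Longrightarrow> sum f A \<in> P"
  by (induction A rule: infinite_finite_induct) (auto simp: closed_ideal_simps)

text \<open>
  The average of elements \<open>y k\<close> that vanish where \<open>F \<le> k / n\<close> and are units where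
  \<open>F \<ge> (k + 1) / n\<close>. Modulo \<open>P\<close>, all but one of them are either \<open>0\<close> or a unit.
\<close>

lemma approximate_multiplier:
  fixes e :: "'a::cstar_algebra" and F :: "'a set \<Rightarrow> real"
  assumes n: "n > 0" and F01: "\<And>P. primitive_ideal P \<Longrightarrow> 0 \<le> F P \<and> F P \<le> 1"
    and le: "\<And>s P. primitive_ideal P \<Longrightarrow> \<Inter>{Q. primitive_ideal Q \<and> F Q \<le> s} \<subseteq> P \<Longrightarrow> F P \<le> s"
    and ge: "\<And>s P. primitive_ideal P \<Longrightarrow> \<Inter>{Q. primitive_ideal Q \<and> F Q \<ge> s} \<subseteq> P \<Longrightarrow> F P \<ge> s"
    and e: "\<And>P. primitive_ideal P \<Longrightarrow> F P > 0 \<Longrightarrow> unit_mod e P"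
  shows "\<exists>z. \<forall>P. primitive_ideal P \<longrightarrow> (\<exists>r. norm r \<le> (1 + norm e) / real n \<and> z - F P *\<^sub>R e - r \<in> P)"
proof -
  define lower where "lower k = {P. primitive_ideal P \<and> F P \<le> real k / real n}" for k
  define upper where "upper k = {P. primitive_ideal P \<and> F P \<ge> real (Suc k) / real n}" for k
  have "\<exists>y. norm y \<le> 1 \<and> (\<forall>P\<in>lower k. y \<in> P) \<and> (\<forall>P\<in>upper k. unit_mod y P)" for k
  proof (rule separating_element[of "lower k" "upper k" e])
    fix P assume P: "primitive_ideal P" "\<Inter>(lower k) \<subseteq> P" "\<Inter>(upper k) \<subseteq> P"
    have "F P \<le> real k / real n" using P le unfolding lower_def by blast
    moreover have "F P \<ge> real (Suc k) / real n" using P ge unfolding upper_def by blast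
    ultimately have "real (Suc k) / real n \<le> real k / real n" by linarith
    then show False using n by (simp add: divide_le_cancel)
  next
    fix P assume P: "P \<in> upper k"
    have "real (Suc k) / real n > 0" using n by simp
    then have "F P > 0" using P unfolding upper_def by (auto intro: less_le_trans)
    then show "unit_mod e P" using P e by (auto simp: upper_def)
  qed (auto simp: lower_def upper_def)
  then obtain y where y: "\<And>k. norm (y k) \<le> 1" "\<And>k P. P \<in> lower k \<Longrightarrow> y k \<in> P"
    "\<And>k P. P \<in> upper k \<Longrightarrow> unit_mod (y k) P"
    by metis
  define z where "z = (1 / real n) *\<^sub>R (\<Sum>k<n. y k)"
  have "\<exists>r. norm r \<le> (1 + norm e) / real n \<and> z - F P *\<^sub>R e - r \<in> P" if P: "primitive_ideal P" for P
  proof -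
    have cP: "closed_ideal P" by (rule primitive_ideal_closed_ideal[OF P])
    define t where "t = F P"
    define m where "m = nat \<lfloor>real n * t\<rfloor>"
    have t: "0 \<le> t" "t \<le> 1" using F01[OF P] by (simp_all add: t_def)
    have m: "real m \<le> real n * t" "real n * t < real m + 1"
      using t(1) by (simp_all add: m_def)
    have "real n * t \<le> real n" using t by (simp add: mult_left_le)
    then have mn: "m \<le> n" using m(1) by linarith
    define w where "w = (if m < n then y m else 0)"
    define r where "r = (1 / real n) *\<^sub>R w + (real m / real n - t) *\<^sub>R e"
    have "real m / real n \<le> t" "t \<le> (real m + 1) / real n" using m n by (simp_all add: field_simps)
    then have "\<bar>real m / real n - t\<bar> \<le> 1 / real n" by (simp add: add_divide_distrib abs_le_iff)
    then have "norm ((real m / real n - t) *\<^sub>R e) \<le> 1 / real n * norm e" by (simp add: mult_right_mono del: times_divide_eq_left)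
    moreover have "norm ((1 / real n) *\<^sub>R w) \<le> 1 / real n"
      using y(1)[of m] n by (simp add: w_def divide_right_mono)
    ultimately have "norm r \<le> 1 / real n + 1 / real n * norm e"
      unfolding r_def using norm_triangle_ineq[of "(1 / real n) *\<^sub>R w" "(real m / real n - t) *\<^sub>R e"] by linarith
    then have nr: "norm r \<le> (1 + norm e) / real n" by (simp add: add_divide_distrib)
    \<comment> \<open>the defect of \<open>y k\<close> from its value modulo \<open>P\<close>, which is left open for \<open>k = m\<close>\<close>
    define d where "d k = y k - (if k < m then e else 0) - (if k = m then y k else 0)" for k
    have "d k \<in> P" for k
    proof -
      consider "k < m" | "k = m" | "k > m" by linarith
      then show ?thesis
      proof cases
        case 1
        then have "real (Suc k) \<le> real n * t" using m(1) by linarith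
        then have "real (Suc k) / real n \<le> t" using n by (simp add: field_simps)
        then have "P \<in> upper k" using P by (simp add: upper_def t_def)
        then have "unit_mod (y k) P" by (rule y(3))
        moreover have "unit_mod e P" using \<open>P \<in> upper k\<close> n P
          by (intro e) (auto simp: upper_def intro: less_le_trans[rotated])
        ultimately have "y k * e - e \<in> P" "y k * e - y k \<in> P" by (simp_all add: unit_mod_def)
        then have "(y k * e - e) - (y k * e - y k) \<in> P" by (rule closed_ideal_simps(7)[OF cP])
        then show ?thesis using 1 by (simp add: d_def)
      next
        case 2
        then show ?thesis using closed_ideal_simps(1)[OF cP] by (simp add: d_def)
      next
        case 3
        then have "real n * t \<le> real k" using m(2) by linarith
        then have "P \<in> lower k" using P n by (simp add: lower_def t_def field_simps)
        then show ?thesis using 3 y(2) by (simp add: d_def)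
      qed
    qed
    then have "(\<Sum>k<n. d k) \<in> P" by (intro closed_ideal_sum cP)
    moreover have "(\<Sum>k<n. d k) = (\<Sum>k<n. y k) - real m *\<^sub>R e - w"
    proof -
      have "{..<n} \<inter> {k. k < m} = {..<m}" using mn by auto
      then have "(\<Sum>k<n. if k < m then e else 0) = real m *\<^sub>R e"
        by (simp add: sum.If_cases sum_constant_scaleR)
      moreover have "(\<Sum>k<n. if k = m then y k else 0) = w" by (simp add: w_def)
      ultimately show ?thesis unfolding d_def by (simp add: sum_subtractf)
    qed
    ultimately have "(1 / real n) *\<^sub>R ((\<Sum>k<n. y k) - real m *\<^sub>R e - w) \<in> P"
      using closed_ideal_simps(8)[OF cP] by metis
    moreover have "(1 / real n) *\<^sub>R ((\<Sum>k<n. y k) - real m *\<^sub>R e - w) = z - t *\<^sub>R e - r"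
      by (simp add: z_def r_def algebra_simps)
    ultimately show ?thesis using nr by (auto simp: t_def)
  qed
  then show ?thesis by blast
qed

text \<open>
  The instance of the Dauns-Hofmann theorem that multiplies the local unit \<open>e\<close> by \<open>F\<close>: the
  limit \<open>z\<close> of the approximate multipliers is congruent to \<open>F P *\<^sub>R e\<close> modulo every primitive
  ideal \<open>P\<close>.
\<close>

theorem central_element_exists:
  fixes e :: "'a::cstar_algebra" and F :: "'a set \<Rightarrow> real"
  assumes F01: "\<And>P. primitive_ideal P \<Longrightarrow> 0 \<le> F P \<and> F P \<le> 1"
    and le: "\<And>s P. primitive_ideal P \<Longrightarrow> \<Inter>{Q. primitive_ideal Q \<and> F Q \<le> s} \<subseteq> P \<Longrightarrow> F P \<le> s"
    and ge: "\<And>s P. primitive_ideal P \<Longrightarrow> \<Inter>{Q. primitive_ideal Q \<and> F Q \<ge> s} \<subseteq> P \<Longrightarrow> F P \<ge> s"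
    and e: "\<And>P. primitive_ideal P \<Longrightarrow> F P > 0 \<Longrightarrow> unit_mod e P"
    and P0: "primitive_ideal P0" "F P0 = 1"
  shows "\<exists>z\<in>center. z \<noteq> (0 :: 'a)"
proof -
  define K where "K = 1 + norm e"
  have "\<forall>n. \<exists>z. \<forall>P. primitive_ideal P \<longrightarrow> (\<exists>r. norm r \<le> K / real (Suc n) \<and> z - F P *\<^sub>R e - r \<in> P)"
    using approximate_multiplier[of "Suc _" F e] F01 le ge e unfolding K_def by blast
  then obtain z where
    "\<forall>n P. primitive_ideal P \<longrightarrow> (\<exists>r. norm r \<le> K / real (Suc n) \<and> z n - F P *\<^sub>R e - r \<in> P)"
    unfolding choice_iff by blast
  then have "\<forall>n P. \<exists>r. primitive_ideal P \<longrightarrow> norm r \<le> K / real (Suc n) \<and> z n - F P *\<^sub>R e - r \<in> P"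
    by blast
  then obtain r where r: "\<And>n P. primitive_ideal P \<Longrightarrow> norm (r n P) \<le> K / real (Suc n)"
    "\<And>n P. primitive_ideal P \<Longrightarrow> z n - F P *\<^sub>R e - r n P \<in> P"
    unfolding choice_iff by blast
  have K: "K > 0" by (simp add: K_def add_pos_nonneg)
  have Kn: "(\<lambda>n. K / real (Suc n)) \<longlonglongrightarrow> 0"
    using tendsto_mult_right_zero[OF LIMSEQ_inverse_real_of_nat, of K] by (simp add: divide_inverse)
  have Cz: "norm (z m - z n) \<le> K / real (Suc m) + K / real (Suc n)" for m n
  proof (rule norm_le_of_primitive_ideals)
    fix P :: "'a set" assume P: "primitive_ideal P"
    have "(z m - F P *\<^sub>R e - r m P) - (z n - F P *\<^sub>R e - r n P) \<in> P"
      by (intro closed_ideal_simps(7) primitive_ideal_closed_ideal P r(2))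
    moreover have "z m - z n - ((z m - F P *\<^sub>R e - r m P) - (z n - F P *\<^sub>R e - r n P)) = r m P - r n P"
      by simp
    moreover have "norm (r m P - r n P) \<le> K / real (Suc m) + K / real (Suc n)"
      using norm_triangle_ineq4[of "r m P" "r n P"] r(1)[OF P, of m] r(1)[OF P, of n] by linarith
    ultimately show "\<exists>p\<in>P. norm (z m - z n - p) \<le> K / real (Suc m) + K / real (Suc n)" by metis
  qed (use K in simp)
  have "Cauchy z"
  proof (rule metric_CauchyI)
    fix d :: real assume "d > 0"
    then have "d / 2 > 0" by simp
    then obtain N where N: "\<forall>n\<ge>N. norm (K / real (Suc n) - 0) < d / 2" using LIMSEQ_D[OF Kn] by blast
    have "dist (z m) (z n) < d" if "m \<ge> N" "n \<ge> N" for m n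
    proof -
      have "K / real (Suc m) < d / 2" "K / real (Suc n) < d / 2" using N that K by (auto simp: abs_less_iff)
      then show ?thesis using Cz[of m n] unfolding dist_norm by linarith
    qed
    then show "\<exists>N. \<forall>m\<ge>N. \<forall>n\<ge>N. dist (z m) (z n) < d" by blast
  qed
  then obtain l where l: "z \<longlonglongrightarrow> l" using Cauchy_convergent_iff convergent_def by blast
  have comm: "norm (z n * a - a * z n) \<le> (2 * norm a) * (K / real (Suc n))" for n a
  proof (rule norm_le_of_primitive_ideals)
    fix P :: "'a set" assume P: "primitive_ideal P"
    have cP: "closed_ideal P" by (rule primitive_ideal_closed_ideal[OF P])
    define p where "p = z n - F P *\<^sub>R e - r n P"
    have p: "p \<in> P" using r(2)[OF P] by (simp add: p_def)
    have "F P *\<^sub>R (e * a - a * e) \<in> P"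
    proof (cases "F P = 0")
      case False
      then have "unit_mod e P" using e[OF P] F01[OF P] by simp
      then have "e * a - a \<in> P" "a * e - a \<in> P" unfolding unit_mod_def by blast+
      then have "(e * a - a) - (a * e - a) \<in> P" by (rule closed_ideal_simps(7)[OF cP])
      then have "e * a - a * e \<in> P" by simp
      then show ?thesis by (rule closed_ideal_simps(8)[OF cP])
    qed (simp add: closed_ideal_simps(1)[OF cP])
    then have "(p * a - a * p) + F P *\<^sub>R (e * a - a * e) \<in> P"
      using p by (intro closed_ideal_simps(2,7,4,5)[OF cP])
    moreover have "z n * a - a * z n - ((p * a - a * p) + F P *\<^sub>R (e * a - a * e)) = r n P * a - a * r n P"
      by (simp add: p_def algebra_simps)
    moreover have "norm (r n P * a - a * r n P) \<le> (2 * norm a) * (K / real (Suc n))"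
    proof -
      have "norm (r n P * a - a * r n P) \<le> norm (r n P) * norm a + norm a * norm (r n P)"
        using norm_triangle_ineq4[of "r n P * a" "a * r n P"] norm_mult_ineq[of "r n P" a]
          norm_mult_ineq[of a "r n P"] by linarith
      also have "\<dots> = (2 * norm a) * norm (r n P)" by simp
      also have "\<dots> \<le> (2 * norm a) * (K / real (Suc n))" using r(1)[OF P] by (intro mult_left_mono) auto
      finally show ?thesis .
    qed
    ultimately show "\<exists>p\<in>P. norm (z n * a - a * z n - p) \<le> (2 * norm a) * (K / real (Suc n))" by metis
  qed (use K in simp)
  have "l * a = a * l" for a
  proof -
    have "(\<lambda>n. norm (z n * a - a * z n)) \<longlonglongrightarrow> norm (l * a - a * l)" by (intro tendsto_intros l)
    moreover have "(\<lambda>n. (2 * norm a) * (K / real (Suc n))) \<longlonglongrightarrow> 0"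
      using tendsto_mult_right_zero[OF Kn] by simp
    ultimately have "norm (l * a - a * l) \<le> 0" using comm by (intro LIMSEQ_le) auto
    then show ?thesis by simp
  qed
  then have "l \<in> center" by (simp add: center_def)
  moreover have "l \<noteq> 0"
  proof
    assume l0: "l = 0"
    have cP: "closed_ideal P0" by (rule primitive_ideal_closed_ideal[OF P0(1)])
    have "(\<lambda>n. r n P0) \<longlonglongrightarrow> 0"
      by (rule Lim_null_comparison[OF _ Kn]) (intro always_eventually allI r(1) P0(1))
    then have "(\<lambda>n. z n - F P0 *\<^sub>R e - r n P0) \<longlonglongrightarrow> l - F P0 *\<^sub>R e - 0" by (intro tendsto_intros l)
    then have "- e \<in> P0"
      using cP r(2)[OF P0(1)] closed_sequentially[of P0 "\<lambda>n. z n - F P0 *\<^sub>R e - r n P0"]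
      by (simp add: closed_ideal_def l0 P0(2))
    have "a \<in> P0" for a
    proof -
      have "e * a - a \<in> P0" using e[OF P0(1)] P0(2) by (simp add: unit_mod_def)
      moreover have "- e * a \<in> P0" by (rule closed_ideal_simps(5)[OF cP \<open>- e \<in> P0\<close>])
      ultimately have "- ((e * a - a) + - e * a) \<in> P0" by (intro closed_ideal_simps(2,6)[OF cP])
      then show ?thesis by simp
    qed
    then show False using primitive_ideal_proper[OF P0(1)] by blast
  qed
  ultimately show ?thesis by blast
qed

text \<open>
  The hypotheses of \<open>central_element_exists\<close> express in this form that the sets \<open>{F \<le> s}\<close> and
  \<open>{F \<ge> s}\<close> are closed.
\<close>

lemma closedin_prim_space_hull:
  assumes "closedin prim_space S" "primitive_ideal P" "\<Inter>S \<subseteq> P" shows "P \<in> S"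
proof -
  have S: "S \<subseteq> Prim" using assms(1) by (auto simp: closedin_def topspace_prim_space)
  have "openin prim_space (Prim - S)" using assms(1) by (simp add: closedin_def topspace_prim_space)
  then have "ideal_hull (ideal_kernel S) = S"
    using S by (simp add: openin_prim_space double_diff)
  moreover have "P \<in> ideal_hull (ideal_kernel S)"
    using assms(2,3) by (simp add: ideal_hull_def ideal_kernel_def Prim_def)
  ultimately show ?thesis by simp
qed

theorem proposition2p3:
  assumes nonzero: "\<exists>a::'a::cstar_algebra. a \<noteq> 0"
    and approx: "\<exists>u :: nat \<Rightarrow> 'a. approximate_identity_seq u"
    and modular: "\<And>I :: 'a set. minimal_primal_ideal I \<Longrightarrow> modular_ideal I"
    and qcr: "quasi_completely_regular_space (prim_space :: 'a set topology)"
  shows "(center :: 'a set) \<noteq> {0}"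
proof -
  obtain u :: "nat \<Rightarrow> 'a" where u: "approximate_identity_seq u" using approx by blast
  have "\<exists>(e :: 'a) c. c \<noteq> 0 \<and> (\<forall>P. primitive_ideal P \<and> c \<notin> P \<longrightarrow> unit_mod e P)"
    by (rule local_unit_exists[OF nonzero u]) (rule modular)
  then obtain e c :: 'a where c: "c \<noteq> 0" and e: "\<And>P. primitive_ideal P \<Longrightarrow> c \<notin> P \<Longrightarrow> unit_mod e P"
    by blast
  define U where "U = {P. primitive_ideal P \<and> c \<notin> P}"
  have UPrim: "U \<subseteq> Prim" by (auto simp: U_def Prim_def)
  have "c \<in> \<Inter>(Prim - U)" by (auto simp: U_def Prim_def)
  then have hk: "\<forall>P\<in>U. \<not> \<Inter>(Prim - U) \<subseteq> P" unfolding U_def by blast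
  have "ideal_hull (ideal_kernel (Prim - U)) = Prim - U"
    by (rule hull_kernel_eq_iff[OF UPrim, THEN iffD2, OF hk])
  with UPrim have "openin prim_space U" by (simp only: openin_prim_space simp_thms)
  moreover have "U \<noteq> {}"
  proof
    assume "U = {}"
    then have "\<exists>p\<in>P. norm (c - p) \<le> 0" if "primitive_ideal P" for P
      using that by (intro bexI[of _ c]) (auto simp: U_def)
    then have "norm c \<le> 0" by (intro norm_le_of_primitive_ideals) auto
    then show False using c by simp
  qed
  ultimately obtain f P0 where f: "continuous_map prim_space euclideanreal f" and P0: "P0 \<in> Prim" "f P0 \<noteq> 0"
    and fU: "\<And>P. P \<in> Prim - U \<Longrightarrow> f P = 0"
    using qcr unfolding quasi_completely_regular_space_def topspace_prim_space by metis
  \<comment> \<open>truncated and normalized, so that the values lie in \<open>[0, 1]\<close> and \<open>F P0 = 1\<close>\<close>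
  define F where "F = (\<lambda>P. min 1 (\<bar>f P\<bar> / \<bar>f P0\<bar>))"
  have "continuous_on UNIV (\<lambda>t. min 1 (\<bar>t\<bar> / \<bar>f P0\<bar>))"
    using P0(2) by (intro continuous_intros) auto
  then have "continuous_map euclideanreal euclideanreal (\<lambda>t. min 1 (\<bar>t\<bar> / \<bar>f P0\<bar>))" by simp
  from continuous_map_compose[OF f this]
  have F: "continuous_map prim_space euclideanreal F" by (simp add: F_def comp_def)
  have closed: "F P \<in> S" if "closed S" "primitive_ideal P" "\<Inter>{Q. primitive_ideal Q \<and> F Q \<in> S} \<subseteq> P" for S P
  proof -
    have "{Q. primitive_ideal Q \<and> F Q \<in> S} = {Q \<in> topspace prim_space. F Q \<in> S}"
      by (auto simp: topspace_prim_space Prim_def)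
    moreover have "closedin prim_space {Q \<in> topspace prim_space. F Q \<in> S}"
      by (rule closedin_continuous_map_preimage[OF F]) (use that(1) in simp)
    ultimately have "closedin prim_space {Q. primitive_ideal Q \<and> F Q \<in> S}" by simp
    then show ?thesis using closedin_prim_space_hull that(2,3) by blast
  qed
  have "\<exists>z\<in>center. z \<noteq> (0 :: 'a)"
  proof (rule central_element_exists[of F e P0])
    show "F P \<le> s" if "primitive_ideal P" "\<Inter>{Q. primitive_ideal Q \<and> F Q \<le> s} \<subseteq> P" for s P
      using closed[of "{..s}" P] that by simp
    show "s \<le> F P" if "primitive_ideal P" "\<Inter>{Q. primitive_ideal Q \<and> s \<le> F Q} \<subseteq> P" for s P
      using closed[of "{s..}" P] that by simp
    show "unit_mod e P" if "primitive_ideal P" "F P > 0" for P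
    proof -
      have "f P \<noteq> 0" using that(2) by (auto simp: F_def)
      then have "P \<in> U" using fU that(1) by (auto simp: Prim_def)
      then show ?thesis using e by (simp add: U_def)
    qed
  qed (use P0 in \<open>auto simp: F_def Prim_def\<close>)
  then show ?thesis by auto
qed

end
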